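(* Let $m\ge 2$ and $k\ge0$ be integers with $m+k\ge3$, and let $w=(1^{(m)},\epsilon^{(k)})$ ($m$ entries $1$ followed by $k$ entries $\epsilon$) with $0<\epsilon\ll1$. Then $\Delta_{0,w}$ has the homotopy type of a wedge of $(m-2)!\,(m-1)^k$ spheres of dimension $m+k-4$.
   Context: For a weight vector $w\in(0,1]^n$ with $\sum w_i>2$, a $w$-stable $n$-marked tree is a finite tree $T$ with a marking $m_T:\{1,\dots,n\}\to V(T)$ such that every vertex has (number of edges) $+$ (sum of weights of marks at it) $>2$; $\Delta_{0,w}$ is the simplicial complex of such trees with positive edge lengths summing to $1$, one simplex $\{\ell\in\mathbf{R}_{\ge0}^{E(T)}:\sum\ell_e=1\}$ per tree, faces with vanishing lengths identified with the simplices of contracted trees. "$0<\epsilon\ll1$" means $\epsilon>0$ sufficiently small. $S^{-1}=\emptyset$. *)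

theory Defs
  imports "HOL-Analysis.Analysis"
begin

section \<open>Quotient spaces, wedges of spheres\<close>

text \<open>The quotient of \<open>X\<close> by the smallest equivalence relation on its points that contains
  \<open>r\<close> (pairs with a component outside \<open>X\<close> are ignored). Its points are the equivalence classes.\<close>

definition glue_class :: "'a topology \<Rightarrow> ('a \<Rightarrow> 'a \<Rightarrow> bool) \<Rightarrow> 'a \<Rightarrow> 'a set" where
  "glue_class X r x =
     Collect (equivclp (\<lambda>y z. y \<in> topspace X \<and> z \<in> topspace X \<and> r y z) x)"

definition quotient_space :: "'a topology \<Rightarrow> ('a \<Rightarrow> 'a \<Rightarrow> bool) \<Rightarrow> 'a set topology" where
  "quotient_space X r = topology (\<lambda>U. U \<subseteq> glue_class X r ` topspace X \<and>
      openin X {x \<in> topspace X. glue_class X r x \<in> U})"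

lemma istopology_quotient_space:
  "istopology (\<lambda>U. U \<subseteq> f ` topspace X \<and> openin X {x \<in> topspace X. f x \<in> U})"
proof -
  have 1: "{x \<in> topspace X. f x \<in> S \<inter> T} =
      {x \<in> topspace X. f x \<in> S} \<inter> {x \<in> topspace X. f x \<in> T}" for S T
    by auto
  have 2: "{x \<in> topspace X. f x \<in> \<Union>K} = (\<Union>S\<in>K. {x \<in> topspace X. f x \<in> S})" for K
    by auto
  show ?thesis
    unfolding istopology_def 1 2 by blast
qed

lemma openin_quotient_space:
  "openin (quotient_space X r) U \<longleftrightarrow>
     U \<subseteq> glue_class X r ` topspace X \<and> openin X {x \<in> topspace X. glue_class X r x \<in> U}"
  unfolding quotient_space_def topology_inverse'[OF istopology_quotient_space] ..

lemma topspace_quotient_space: "topspace (quotient_space X r) = glue_class X r ` topspace X"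
proof
  show "topspace (quotient_space X r) \<subseteq> glue_class X r ` topspace X"
    using openin_quotient_space openin_topspace by blast
  have "{x \<in> topspace X. glue_class X r x \<in> glue_class X r ` topspace X} = topspace X"
    by auto
  then have "openin (quotient_space X r) (glue_class X r ` topspace X)"
    by (simp add: openin_quotient_space)
  then show "glue_class X r ` topspace X \<subseteq> topspace (quotient_space X r)"
    by (rule openin_subset)
qed

lemma quotient_map_glue_class: "quotient_map X (quotient_space X r) (glue_class X r)"
  by (auto simp: quotient_map_def topspace_quotient_space openin_quotient_space)

text \<open>The wedge of the pointed spaces \<open>(X i, p i)\<close>, for a nonempty index set \<open>I\<close>.\<close>

definition wedge :: "('i \<Rightarrow> 'a topology) \<Rightarrow> ('i \<Rightarrow> 'a) \<Rightarrow> 'i set \<Rightarrow> ('i \<times> 'a) set topology" where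
  "wedge X p I = quotient_space (sum_topology X I) (\<lambda>(i, x) (j, y). x = p i \<and> y = p j)"

definition sphere_space :: "int \<Rightarrow> (nat \<Rightarrow> real) topology" where
  "sphere_space d = (if d < 0 then discrete_topology {} else nsphere (nat d))"

definition sphere_basepoint :: "nat \<Rightarrow> real" where
  "sphere_basepoint i = (if i = 0 then 1 else 0)"

text \<open>For \<open>d = -1\<close> there is no base point and the wedge is empty, i.e. \<open>S\<^sup>-\<^sup>1\<close>. The number \<open>r\<close>
  of spheres is meant to be positive.\<close>

definition wedge_of_spheres :: "nat \<Rightarrow> int \<Rightarrow> (nat \<times> (nat \<Rightarrow> real)) set topology" where
  "wedge_of_spheres r d = wedge (\<lambda>_. sphere_space d) (\<lambda>_. sphere_basepoint) {..<r}"


section \<open>Weighted stable marked trees\<close>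

text \<open>Vertices are natural numbers, so that every finite tree has an isomorphic copy. Edges are
  two-element sets of vertices.\<close>

record marked_tree =
  verts :: "nat set"
  edges :: "nat set set"
  mark :: "nat \<Rightarrow> nat"

definition adjacency :: "nat set set \<Rightarrow> (nat \<times> nat) set" where
  "adjacency F = {(u, v). {u, v} \<in> F}"

definition is_tree :: "nat set \<Rightarrow> nat set set \<Rightarrow> bool" where
  "is_tree V E \<longleftrightarrow> finite V \<and> V \<noteq> {} \<and>
     E \<subseteq> {{u, v} | u v. u \<in> V \<and> v \<in> V \<and> u \<noteq> v} \<and>
     (\<forall>u \<in> V. \<forall>v \<in> V. (u, v) \<in> (adjacency E)\<^sup>*) \<and>
     \<not> (\<exists>vs. 3 \<le> length vs \<and> distinct vs \<and>
          (\<forall>i < length vs. {vs ! i, vs ! (Suc i mod length vs)} \<in> E))"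

definition is_stable_tree :: "nat \<Rightarrow> (nat \<Rightarrow> real) \<Rightarrow> marked_tree \<Rightarrow> bool" where
  "is_stable_tree n w T \<longleftrightarrow> is_tree (verts T) (edges T) \<and> mark T \<in> {1..n} \<rightarrow>\<^sub>E verts T \<and>
     (\<forall>v \<in> verts T.
        real (card {e \<in> edges T. v \<in> e}) + (\<Sum>i | i \<in> {1..n} \<and> mark T i = v. w i) > 2)"

text \<open>\<open>f\<close> exhibits \<open>T'\<close> as the tree obtained from \<open>T\<close> by contracting the edges in \<open>S\<close>;
  for \<open>S = {}\<close> it is an isomorphism of marked trees.\<close>

definition is_contraction ::
    "nat \<Rightarrow> nat set set \<Rightarrow> (nat \<Rightarrow> nat) \<Rightarrow> marked_tree \<Rightarrow> marked_tree \<Rightarrow> bool" where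
  "is_contraction n S f T T' \<longleftrightarrow> S \<subseteq> edges T \<and>
     verts T' = f ` verts T \<and>
     (\<forall>u \<in> verts T. \<forall>v \<in> verts T. f u = f v \<longleftrightarrow> (u, v) \<in> (adjacency S)\<^sup>*) \<and>
     edges T' = (\<lambda>e. f ` e) ` (edges T - S) \<and>
     (\<forall>i \<in> {1..n}. mark T' i = f (mark T i))"


section \<open>The complex\<close>

text \<open>This is empty for the tree without edges.\<close>

definition length_simplex :: "marked_tree \<Rightarrow> (nat set \<Rightarrow> real) topology" where
  "length_simplex T = subtopology (powertop_real (edges T))
     {l. (\<forall>e \<in> edges T. 0 \<le> l e) \<and> (\<Sum>e \<in> edges T. l e) = 1}"

text \<open>A length function of a contracted tree \<open>T'\<close> is identified with its extension by zero to
  \<open>T\<close>. Via \<open>S = {}\<close> this also identifies the simplices of isomorphic trees, which leaves one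
  simplex per isomorphism class.\<close>

definition face_identification ::
    "nat \<Rightarrow> marked_tree \<times> (nat set \<Rightarrow> real) \<Rightarrow> marked_tree \<times> (nat set \<Rightarrow> real) \<Rightarrow> bool" where
  "face_identification n = (\<lambda>(T, l) (T', l').
     \<exists>S f. is_contraction n S f T T' \<and>
       (\<forall>e \<in> S. l e = 0) \<and> (\<forall>e \<in> edges T - S. l e = l' (f ` e)))"

definition Delta_0 :: "nat \<Rightarrow> (nat \<Rightarrow> real) \<Rightarrow> (marked_tree \<times> (nat set \<Rightarrow> real)) set topology" where
  "Delta_0 n w = quotient_space (sum_topology length_simplex {T. is_stable_tree n w T})
     (face_identification n)"

text \<open>The weight vector \<open>(1,\<dots>,1,\<epsilon>,\<dots>,\<epsilon>)\<close> with \<open>m\<close> entries \<open>1\<close>; positions start at \<open>1\<close>.\<close>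

definition heavy_light :: "nat \<Rightarrow> real \<Rightarrow> nat \<Rightarrow> real" where
  "heavy_light m \<epsilon> i = (if i \<le> m then 1 else \<epsilon>)"

end

theory Submission
  imports Defs "HOL-Library.Nat_Bijection"
begin

text \<open>A stable tree is determined by the splits of its edges, each recorded as the side avoiding the
  mark \<open>1\<close>; these sides form a laminar family, and every laminar family of admissible sets arises.
  Hence \<open>\<Delta>\<^sub>0\<^sub>,\<^sub>w\<close> is the base of the cone of nonnegative functions on admissible
  sets with laminar support. Forgetting a mark \<open>j\<close>, and recording the length of the edge that cuts
  off \<open>{i, j}\<close> as a point on the \<open>i\<close>-th leg of a spider, maps the cone for \<open>n + 1\<close>
  marks to the product of the cone for \<open>n\<close> marks with a spider. This is a homotopy equivalence
  relative to the apex: in the inverse and in the homotopies, the mark \<open>j\<close> slides along the tree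
  towards the mark \<open>1\<close>. By induction \<open>\<Delta>\<^sub>0\<^sub>,\<^sub>w\<close> becomes a product of \<open>m + k - 3\<close>
  spiders minus the apex, i.e. a join of finite discrete sets. Collapsing all points with some
  coordinate on the first leg (a contractible set: push every coordinate along that leg) leaves one
  sphere for each choice of the remaining legs.\<close>

section \<open>Homotopy equivalences of cones\<close>

text \<open>The slide is forced by continuity at the centre of the spider. If a point on the leg
  \<open>i\<close> merely hung \<open>j\<close> on the mark \<open>i\<close>, then for
  \<open>y i\<close> tending to \<open>0\<close> different legs would leave \<open>j\<close> at
  different vertices. So \<open>j\<close> slides on by the sum of all edge lengths: no path to the
  mark \<open>1\<close> is longer, so all legs meet there; and this sum vanishes only at the apex of
  the tree factor, so the homotopies neither reach nor leave the apex.

  The number \<open>m\<close> of heavy marks is fixed during the induction and may exceed the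
  current number \<open>n\<close> of marks. The pair \<open>{i, j}\<close> with
  \<open>j = n + 1\<close> is admissible iff \<open>i\<close> or \<open>j\<close> is heavy; together
  with the leg of \<open>1\<close> this gives \<open>min n m\<close> legs. Three marks give a
  one-point cone, so the numbers of legs are \<open>min (j + 3) m\<close> for
  \<open>j < m + k - 3\<close>, and the number of spheres is the product of these numbers, each
  diminished by one.

  Smallness of \<open>\<epsilon>\<close> enters only as \<open>n * \<epsilon> \<le> 1\<close>: light
  marks alone never weigh more than \<open>1\<close>, so admissible sets can be described without
  \<open>\<epsilon>\<close>.\<close>

text \<open>Maps and homotopies that preserve both the apex and its complement: unlike homotopy equivalences
  of the complements, they can be multiplied with a further cone.\<close>

definition cone_map ::
    "'a::topological_space set \<Rightarrow> 'a \<Rightarrow> 'b::topological_space set \<Rightarrow> 'b \<Rightarrow> ('a \<Rightarrow> 'b) \<Rightarrow> bool" where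
  "cone_map S a T b f \<longleftrightarrow> continuous_on S f \<and> f \<in> S \<rightarrow> T \<and> (\<forall>x\<in>S. f x = b \<longleftrightarrow> x = a)"

abbreviation cone_homotopic ::
    "'a::topological_space set \<Rightarrow> 'a \<Rightarrow> ('a \<Rightarrow> 'a) \<Rightarrow> ('a \<Rightarrow> 'a) \<Rightarrow> bool" where
  "cone_homotopic S a \<equiv> homotopic_with_canon (\<lambda>h. \<forall>x\<in>S. h x = a \<longleftrightarrow> x = a) S S"

definition cone_equiv ::
    "'a::topological_space set \<Rightarrow> 'a \<Rightarrow> 'b::topological_space set \<Rightarrow> 'b \<Rightarrow> bool" where
  "cone_equiv S a T b \<longleftrightarrow> (\<exists>f g. cone_map S a T b f \<and> cone_map T b S a g \<and>
     cone_homotopic S a (g \<circ> f) id \<and> cone_homotopic T b (f \<circ> g) id)"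

lemma cone_map_compose:
  assumes "cone_map S a T b f" "cone_map T b U c g"
  shows "cone_map S a U c (g \<circ> f)"
  using assms continuous_on_compose2[of T g S f]
  by (auto simp: cone_map_def Pi_iff o_def image_subset_iff)

lemma cone_homotopicI:
  assumes "continuous_on ({0..1} \<times> S) H"
    and "\<And>t x. t \<in> {0..1} \<Longrightarrow> x \<in> S \<Longrightarrow> H (t, x) \<in> S"
    and "\<And>t x. t \<in> {0..1} \<Longrightarrow> x \<in> S \<Longrightarrow> H (t, x) = a \<longleftrightarrow> x = a"
    and "\<And>x. x \<in> S \<Longrightarrow> H (0, x) = f x" "\<And>x. x \<in> S \<Longrightarrow> H (1::real, x) = g x"
  shows "cone_homotopic S a f g"
proof (subst homotopic_with)
  show "\<exists>h. continuous_map (prod_topology (top_of_set {0..1::real}) (top_of_set S)) (top_of_set S) h \<and>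
       (\<forall>x\<in>topspace (top_of_set S). h (0, x) = f x) \<and>
       (\<forall>x\<in>topspace (top_of_set S). h (1, x) = g x) \<and>
       (\<forall>t\<in>{0..1}. \<forall>x\<in>S. h (t, x) = a \<longleftrightarrow> x = a)"
    by (rule exI[of _ H]) (use assms in auto)
qed simp

lemma cone_homotopicE:
  assumes "cone_homotopic S a f g"
  obtains h where "continuous_on ({0..1} \<times> S) h" "h \<in> {0..1} \<times> S \<rightarrow> S"
      "\<And>x. h (0, x) = f x" "\<And>x. h (1, x) = g x"
      "\<And>t x. t \<in> {0..1::real} \<Longrightarrow> x \<in> S \<Longrightarrow> h (t, x) = a \<longleftrightarrow> x = a"
proof -
  obtain h where "continuous_map (prod_topology (top_of_set {0..1::real}) (top_of_set S)) (top_of_set S) h"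
      "\<forall>x. h (0, x) = f x" "\<forall>x. h (1, x) = g x"
      "\<forall>t\<in>{0..1}. \<forall>x\<in>S. h (t, x) = a \<longleftrightarrow> x = a"
    using assms unfolding homotopic_with_def by blast
  then show thesis by (intro that[of h]) auto
qed

text \<open>The side condition of \<open>cone_homotopic\<close> keeps the track of every point other
  than \<open>a\<close> away from \<open>a\<close>, so the homotopy restricts to the
  complement.\<close>

lemma homotopic_from_complement:
  assumes "cone_homotopic S a f id"
  shows "homotopic_with_canon (\<lambda>_. True) (S - {a}) (S - {a}) f id"
proof -
  obtain h where h: "continuous_on ({0..1} \<times> S) h" "h \<in> {0..1} \<times> S \<rightarrow> S"
      "\<And>x. h (0, x) = f x" "\<And>x. h (1, x) = id x"
      "\<And>t x. t \<in> {0..1::real} \<Longrightarrow> x \<in> S \<Longrightarrow> h (t, x) = a \<longleftrightarrow> x = a"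
    by (rule cone_homotopicE[OF assms], rule that)
  then show ?thesis
    unfolding homotopic_with_def
    by (intro exI[of _ h]) (auto intro: continuous_on_subset simp: Pi_iff)
qed

lemma cone_equiv_imp_homotopy_equivalent:
  assumes "cone_equiv S a T b"
  shows "top_of_set (S - {a}) homotopy_equivalent_space top_of_set (T - {b})"
proof -
  obtain f g where fg: "cone_map S a T b f" "cone_map T b S a g"
     "cone_homotopic S a (g \<circ> f) id" "cone_homotopic T b (f \<circ> g) id"
    using assms unfolding cone_equiv_def by blast
  show ?thesis
    unfolding homotopy_equivalent_space_def
    using fg homotopic_from_complement[OF fg(3)] homotopic_from_complement[OF fg(4)]
    by (intro exI[of _ f] exI[of _ g])
       (auto simp: cone_map_def Pi_iff intro: continuous_on_subset)
qed

lemma cone_equiv_trans: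
  assumes "cone_equiv S a T b" "cone_equiv T b U c"
  shows "cone_equiv S a U c"
proof -
  obtain f g where fg: "cone_map S a T b f" "cone_map T b S a g"
     "cone_homotopic S a (g \<circ> f) id" "cone_homotopic T b (f \<circ> g) id"
    using assms unfolding cone_equiv_def by blast
  obtain f' g' where fg': "cone_map T b U c f'" "cone_map U c T b g'"
     "cone_homotopic T b (g' \<circ> f') id" "cone_homotopic U c (f' \<circ> g') id"
    using assms unfolding cone_equiv_def by blast
  \<comment> \<open>The homotopy in the middle space is conjugated by the outer maps. The types are
    kept general because the fact is applied in both directions, with the outer spaces
    exchanged.\<close>
  have *: "cone_homotopic S a (g \<circ> (g' \<circ> f') \<circ> f) id"
    if fg: "cone_map S a T b f" "cone_map T b S a g"
     "cone_homotopic S a (g \<circ> f) id" and h: "cone_homotopic T b h id" and "h = g' \<circ> f'"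
    for S :: "'x::topological_space set" and a and T :: "'y::topological_space set" and b f g h
    and f' :: "'y \<Rightarrow> 'z" and g'
  proof -
    obtain k where k: "continuous_on ({0..1} \<times> T) k" "k \<in> {0..1} \<times> T \<rightarrow> T"
      "\<And>x. k (0, x) = h x" "\<And>x. k (1, x) = id x"
      "\<And>t x. t \<in> {0..1::real} \<Longrightarrow> x \<in> T \<Longrightarrow> k (t, x) = b \<longleftrightarrow> x = b"
      by (rule cone_homotopicE[OF h], rule that)
    have "cone_homotopic S a (g \<circ> h \<circ> f) (g \<circ> f)"
    proof (rule cone_homotopicI[where H = "\<lambda>p. g (k (fst p, f (snd p)))"])
      have cf: "continuous_on S f" using fg(1) by (simp add: cone_map_def)
      have "continuous_on ({0..1} \<times> S) (\<lambda>p. k (fst p, f (snd p)))"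
        using fg(1) by (intro continuous_on_compose2[OF k(1)] continuous_intros
            continuous_on_compose2[OF cf continuous_on_snd[OF continuous_on_id]]) (auto simp: cone_map_def Pi_iff)
      then show "continuous_on ({0..1} \<times> S) (\<lambda>p. g (k (fst p, f (snd p))))"
        using fg(1,2) k(2) by (elim continuous_on_compose2[of T g, rotated]) (auto simp: cone_map_def Pi_iff)
    qed (use fg k in \<open>auto simp: cone_map_def Pi_iff\<close>)
    then show ?thesis using fg(3) that(5) homotopic_with_trans by blast
  qed
  have 1: "cone_homotopic S a (g \<circ> (g' \<circ> f') \<circ> f) id"
    by (rule *[OF fg(1-3) fg'(3)]) simp
  have 2: "cone_homotopic U c (f' \<circ> (f \<circ> g) \<circ> g') id"
    by (rule *[OF fg'(2,1,4) fg(4)]) simp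
  show ?thesis
    unfolding cone_equiv_def
    using cone_map_compose[OF fg(1) fg'(1)] cone_map_compose[OF fg'(2) fg(2)] 1 2
    by (intro exI[of _ "f' \<circ> f"] exI[of _ "g \<circ> g'"]) (simp add: comp_assoc)
qed

text \<open>A pair is the apex only if both components are. The homotopy moves the first component
  alone, so its apex condition carries over to the product.\<close>

lemma cone_equiv_Times:
  assumes "cone_equiv S a T b"
  shows "cone_equiv (S \<times> C) (a, c) (T \<times> C) (b, c)"
proof -
  obtain f g where fg: "cone_map S a T b f" "cone_map T b S a g"
     "cone_homotopic S a (g \<circ> f) id" "cone_homotopic T b (f \<circ> g) id"
    using assms unfolding cone_equiv_def by blast
  have m: "cone_map (S \<times> C) (a, c) (T \<times> C) (b, c) (map_prod f id)"
    if "cone_map S a T b f"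
    for S :: "'x::topological_space set" and a and T :: "'y::topological_space set" and b f
  proof -
    have "continuous_on S f" using that by (simp add: cone_map_def)
    then have "continuous_on (S \<times> C) (\<lambda>p. (f (fst p), snd p))"
      by (intro continuous_intros continuous_on_compose2[OF _ continuous_on_fst[OF continuous_on_id]]) auto
    then show ?thesis
      using that by (auto simp: cone_map_def map_prod_def case_prod_unfold Pi_iff)
  qed
  have *: "cone_homotopic (S \<times> C) (a, c) (map_prod h id) id"
    if hid: "cone_homotopic S a h id" for S :: "'x::topological_space set" and a h
  proof -
    obtain k where k: "continuous_on ({0..1} \<times> S) k" "k \<in> {0..1} \<times> S \<rightarrow> S"
      "\<And>x. k (0, x) = h x" "\<And>x. k (1, x) = id x"
      "\<And>t x. t \<in> {0..1::real} \<Longrightarrow> x \<in> S \<Longrightarrow> k (t, x) = a \<longleftrightarrow> x = a"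
      by (rule cone_homotopicE[OF hid], rule that)
    show ?thesis
    proof (rule cone_homotopicI[where H = "\<lambda>p. (k (fst p, fst (snd p)), snd (snd p))"])
      show "continuous_on ({0..1} \<times> S \<times> C) (\<lambda>p. (k (fst p, fst (snd p)), snd (snd p)))"
        by (intro continuous_intros continuous_on_compose2[OF k(1)]) auto
    qed (use k in \<open>simp_all add: Pi_iff mem_Times_iff prod_eq_iff\<close>)
  qed
  show ?thesis
    unfolding cone_equiv_def
    using m[OF fg(1)] m[OF fg(2)] *[OF fg(3)] *[OF fg(4)]
    by (intro exI[of _ "map_prod f id"] exI[of _ "map_prod g id"]) (simp only: map_prod.comp id_comp simp_thms)
qed

lemma cone_equiv_homeomorphism:
  assumes "cone_map S a T b f" "cone_map T b S a g"
    and "\<And>x. x \<in> S \<Longrightarrow> g (f x) = x" "\<And>y. y \<in> T \<Longrightarrow> f (g y) = y"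
  shows "cone_equiv S a T b"
proof -
  have *: "cone_homotopic S a h id" if "\<And>x. x \<in> S \<Longrightarrow> h x = x" for S :: "'x::topological_space set" and a h
  proof (rule cone_homotopicI[where H = snd])
    show "continuous_on ({0..1} \<times> S) snd" by (intro continuous_intros)
  qed (use that in auto)
  show ?thesis
    unfolding cone_equiv_def using assms
    by (intro exI[of _ f] exI[of _ g] conjI *) auto
qed

section \<open>Attaching a mark to a tree\<close>

text \<open>Stability without \<open>\<epsilon>\<close>: a heavy mark and a second mark make the
  side avoiding \<open>1\<close> heavier than \<open>1\<close>; the condition
  \<open>A \<noteq> {2..n}\<close> leaves a second mark on the side of the heavy mark
  \<open>1\<close>.\<close>

definition splits :: "nat \<Rightarrow> nat \<Rightarrow> nat set set" where
  "splits n m = {A. A \<subseteq> {2..n} \<and> 2 \<le> card A \<and> A \<noteq> {2..n} \<and> (\<exists>i\<in>A. i \<le> m)}"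

definition laminar :: "'a set set \<Rightarrow> bool" where
  "laminar S \<longleftrightarrow> (\<forall>A\<in>S. \<forall>B\<in>S. A \<inter> B = {} \<or> A \<subseteq> B \<or> B \<subseteq> A)"

text \<open>The functions live on all sets and vanish off \<open>splits n m\<close>, so the cones
  for \<open>n\<close> and \<open>n + 1\<close> marks share one type and one topology.\<close>

definition tree_cone :: "nat \<Rightarrow> nat \<Rightarrow> (nat set \<Rightarrow> real) set" where
  "tree_cone n m = {l. (\<forall>A. 0 \<le> l A) \<and> {A. l A \<noteq> 0} \<subseteq> splits n m \<and> laminar {A. l A \<noteq> 0}}"

text \<open>A point of the cone over \<open>a\<close> points. The leg \<open>1\<close> belongs to the split \<open>{1, j}\<close>, whose
  side avoiding \<open>1\<close> is \<open>{2..n}\<close>.\<close>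

definition spider :: "nat \<Rightarrow> (nat \<Rightarrow> real) set" where
  "spider a = {y. (\<forall>i. 0 \<le> y i) \<and> (\<forall>i. y i \<noteq> 0 \<longrightarrow> i \<in> {1..a}) \<and>
     (\<forall>i k. y i \<noteq> 0 \<longrightarrow> y k \<noteq> 0 \<longrightarrow> i = k)}"

lemma finite_splits [simp]: "finite (splits n m)"
  by (rule finite_subset[of _ "Pow {2..n}"]) (auto simp: splits_def)

lemma tree_cone_nonneg: "l \<in> tree_cone n m \<Longrightarrow> 0 \<le> l A"
  and tree_cone_splits: "l \<in> tree_cone n m \<Longrightarrow> l A \<noteq> 0 \<Longrightarrow> A \<in> splits n m"
  and tree_cone_laminar: "l \<in> tree_cone n m \<Longrightarrow> l A \<noteq> 0 \<Longrightarrow> l B \<noteq> 0 \<Longrightarrow>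
    A \<inter> B = {} \<or> A \<subseteq> B \<or> B \<subseteq> A"
  by (auto simp: tree_cone_def laminar_def)

section \<open>Sliding a mark along nested edges\<close>

definition below :: "'a set set \<Rightarrow> 'a \<Rightarrow> ('a set \<Rightarrow> real) \<Rightarrow> 'a set \<Rightarrow> real" where
  "below F i l A = (\<Sum>B | B \<in> F \<and> i \<in> B \<and> B \<subset> A. l B)"

text \<open>The length moved to \<open>A - {i}\<close> when \<open>i\<close> has slid the distance \<open>s\<close> along the
  edges above it: the edges \<open>B \<subset> A\<close> containing \<open>i\<close> are passed first.\<close>

definition moved :: "'a set set \<Rightarrow> 'a \<Rightarrow> real \<Rightarrow> ('a set \<Rightarrow> real) \<Rightarrow> 'a set \<Rightarrow> real" where
  "moved F i s l A = min (l A) (max 0 (s - below F i l A))"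

lemma below_nonneg: "(\<And>A. 0 \<le> l A) \<Longrightarrow> 0 \<le> below F i l A"
  unfolding below_def by (simp add: sum_nonneg)

lemma moved_nonneg: "(\<And>A. 0 \<le> l A) \<Longrightarrow> 0 \<le> moved F i s l A"
  and moved_le: "moved F i s l A \<le> l A"
  unfolding moved_def by (simp_all add: min_le_iff_disj)

lemma moved_zero: "l A = 0 \<Longrightarrow> moved F i s l A = 0"
  unfolding moved_def by simp

lemma moved_nonpos: "(\<And>A. 0 \<le> l A) \<Longrightarrow> s \<le> 0 \<Longrightarrow> moved F i s l A = 0"
  using below_nonneg[of l F i A] unfolding moved_def by (simp add: min_absorb2)

lemma below_add_le:
  assumes "finite F" "\<And>A. 0 \<le> l A" "A \<in> F" "i \<in> A" "A \<subset> B"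
  shows "below F i l A + l A \<le> below F i l B"
proof -
  have "below F i l A + l A = sum l (insert A {C. C \<in> F \<and> i \<in> C \<and> C \<subset> A})"
    using assms(1) unfolding below_def by (subst sum.insert) auto
  also have "\<dots> \<le> below F i l B"
    unfolding below_def using assms by (intro sum_mono2) auto
  finally show ?thesis .
qed

text \<open>Edges are crossed from the inside out: while \<open>A\<close> is not completely crossed,
  no distance is left for a strictly larger \<open>B\<close>. This is what keeps supports laminar
  during a slide.\<close>

lemma moved_nested:
  assumes "finite F" "\<And>A. 0 \<le> l A" "A \<in> F" "i \<in> A" "A \<subseteq> B \<or> B \<subseteq> A"
    and "0 < moved F i s l B" "moved F i s l A < l A"
  shows "B \<subseteq> A"
proof (rule ccontr)
  assume "\<not> B \<subseteq> A"
  then have "A \<subset> B" using assms(5) by auto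
  then have "below F i l A + l A \<le> below F i l B"
    using assms by (intro below_add_le) auto
  then show False
    using assms(6,7) unfolding moved_def by (auto simp: min_def max_def split: if_splits)
qed

lemma moved_all:
  assumes "below F i l A + l A \<le> s" "\<And>A. 0 \<le> l A"
  shows "moved F i s l A = l A"
  using assms(1) assms(2)[of A] unfolding moved_def by auto

lemma continuous_app:
  "continuous_on X (\<lambda>p. snd p i)" "continuous_on Y (\<lambda>p. fst p k)"
  "continuous_on Z (\<lambda>p. snd (snd p) i')" "continuous_on W (\<lambda>p. fst (snd p) k')"
  by (rule continuous_on_product_then_coordinatewise,
      (rule continuous_on_fst continuous_on_snd continuous_on_id)+)+

lemma continuous_on_apply: "continuous_on X (\<lambda>f. f i)"
  by (rule continuous_on_subset[OF continuous_on_product_coordinates]) simp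

text \<open>The maps of the induction step branch only on indices, never on the point; their
  continuity thus reduces to sums, products, minima and maxima of coordinates.\<close>

lemma continuous_on_if_const:
  assumes "P \<Longrightarrow> continuous_on X f" "\<not> P \<Longrightarrow> continuous_on X g"
  shows "continuous_on X (\<lambda>x. if P then f x else g x)"
  using assms by (cases P) auto

lemmas cont_intros = continuous_on_if_const continuous_app continuous_on_apply
  continuous_on_sum continuous_on_min continuous_on_max continuous_on_add continuous_on_diff
  continuous_on_mult continuous_on_const continuous_on_fst continuous_on_snd continuous_on_id

section \<open>Splits after adding one mark\<close>

locale add_mark =
  fixes n m :: nat
  assumes n: "3 \<le> n" and m: "2 \<le> m"
begin

abbreviation j :: nat where "j \<equiv> Suc n"
abbreviation old :: "nat set set" where "old \<equiv> splits n m"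
abbreviation new :: "nat set set" where "new \<equiv> splits (Suc n) m"
abbreviation legs :: "nat set" where "legs \<equiv> {2..min n m}"

lemma oldD: assumes "A \<in> old"
  shows "j \<notin> A" "A \<in> new" "insert j A \<in> new" "A \<noteq> {2..n}" "A \<subseteq> {2..n}" "finite A"
    "A \<noteq> {i}" "insert j A \<noteq> {i, j}" "\<not> A \<subseteq> {i, j}" "\<not> A \<subseteq> {i}" "\<not> insert j A \<subseteq> {i, j}" "A \<noteq> {}"
proof -
  have A: "A \<subseteq> {2..n}" "2 \<le> card A" "A \<noteq> {2..n}" "\<exists>i\<in>A. i \<le> m"
    using assms by (auto simp: splits_def)
  show j: "j \<notin> A" using A by auto
  show fin: "finite A" using A finite_subset by blast
  show "A \<in> new" using A j by (auto simp: splits_def)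
  have "insert j A \<noteq> {2..Suc n}"
  proof
    assume "insert j A = {2..Suc n}"
    then have "insert j A - {j} = {2..Suc n} - {j}" by simp
    also have "\<dots> = {2..n}" by auto
    finally show False using j A(3) by auto
  qed
  then show "insert j A \<in> new" using A j n fin by (auto simp: splits_def)
  show "A \<noteq> {2..n}" "A \<subseteq> {2..n}" using A by auto
  show s: "\<not> A \<subseteq> {i}" using A(2) card_mono[of "{i}" A] by auto
  then show "A \<noteq> {i}" by auto
  show "A \<noteq> {}" using A by auto
  show "\<not> A \<subseteq> {i, j}" "insert j A \<noteq> {i, j}" "\<not> insert j A \<subseteq> {i, j}" using s j by auto
qed

text \<open>Removing \<open>j\<close> leaves an old set unless only one mark \<open>i\<close>
  remains. In that case \<open>{i, j}\<close> contains a heavy mark, which forces \<open>i\<close>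
  to be among the legs.\<close>

lemma newD_in:
  assumes "A \<in> new" "j \<in> A"
  obtains i where "i \<in> legs" "A = {i, j}" | B where "B \<in> old" "A = insert j B"
proof -
  have A: "A \<subseteq> {2..Suc n}" "2 \<le> card A" "A \<noteq> {2..Suc n}" "\<exists>i\<in>A. i \<le> m"
    using assms by (auto simp: splits_def)
  have fin: "finite A" using A finite_subset by blast
  define B where "B = A - {j}"
  have B: "A = insert j B" "j \<notin> B" "B \<subseteq> {2..n}" "finite B" using A(1) assms(2) fin by (auto simp: B_def)
  have nR: "B \<noteq> {2..n}" using A(3) B(1) n by auto
  have "B \<noteq> {}" using A(2) B(1) by auto
  have h: "\<exists>i\<in>B. i \<le> m"
  \<comment> \<open>Heavy marks come first: if \<open>j\<close> is heavy, then so is every other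
    mark.\<close>
  proof (cases "j \<le> m")
    case True
    then show ?thesis using \<open>B \<noteq> {}\<close> B(3) by fastforce
  next
    case False
    then show ?thesis using A(4) B(1) by auto
  qed
  show thesis
  proof (cases "2 \<le> card B")
    case True
    then show thesis using B h nR by (intro that(2)[of B]) (auto simp: splits_def)
  next
    case False
    then have "card B = 1" using \<open>B \<noteq> {}\<close> B(4) by (simp add: Suc_leI le_antisym not_less_eq_eq numeral_2_eq_2 card_gt_0_iff)
    then obtain i where "B = {i}" using card_1_singletonE by blast
    then show thesis using B h by (intro that(1)[of i]) auto
  qed
qed

lemma newD_notin:
  assumes "A \<in> new" "j \<notin> A"
  shows "A \<in> old \<or> A = {2..n}"
proof -
  have "A \<subseteq> {2..n}"
  proof
    fix x assume "x \<in> A"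
    then have "x \<in> {2..Suc n}" "x \<noteq> j" using assms by (auto simp: splits_def)
    then show "x \<in> {2..n}" by auto
  qed
  then show ?thesis using assms by (auto simp: splits_def)
qed

lemma root_split: "{2..n} \<in> new" "{2..n} \<notin> old" "j \<notin> {2..n}"
  using n m by (auto simp: splits_def intro!: bexI[of _ 2])

lemma cherry: assumes "i \<in> legs"
  shows "{i, j} \<in> new" "i \<noteq> j" "i \<in> {2..n}" "{i, j} - {j} \<notin> old" "{i} \<notin> old" "{i, j} \<notin> old"
proof -
  have i: "i \<noteq> j" "2 \<le> i" "i \<le> n" "i \<le> m" using assms by auto
  then show "i \<noteq> j" "i \<in> {2..n}" by auto
  have "{i, j} \<noteq> {2..Suc n}"
  proof
    assume "{i, j} = {2..Suc n}"
    then have "card {i, j} = card {2..Suc n}" by simp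
    then show False using i n by simp
  qed
  then show "{i, j} \<in> new" using i by (auto simp: splits_def)
  show "{i} \<notin> old" "{i, j} \<notin> old" using oldD(1,7) by blast+
  then show "{i, j} - {j} \<notin> old" using i by (simp add: insert_Diff_if)
qed

text \<open>Crossing an edge takes \<open>j\<close> out of the side avoiding \<open>1\<close>, so
  length passes from \<open>insert j A\<close> to \<open>A\<close>. For a cherry
  \<open>{i, j}\<close> the remaining \<open>{i}\<close> is no split, and the crossed length is
  dropped.\<close>

definition slide :: "real \<Rightarrow> (nat set \<Rightarrow> real) \<Rightarrow> nat set \<Rightarrow> real" where
  "slide s l A = (if j \<in> A then l A - moved new j s l A
     else if A \<in> old then l A + moved new j s l (insert j A) else l A)"

text \<open>A set in the new support is an edge not yet fully crossed (\<open>P\<close>), or has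
  received length (\<open>Q\<close>), or avoids \<open>j\<close> and carried length before. Only
  \<open>Q\<close> against \<open>P\<close> is not immediate; there the order of crossing forces
  inclusion.\<close>

lemma slide_tree_cone:
  assumes l: "l \<in> tree_cone (Suc n) m"
  shows "slide s l \<in> tree_cone (Suc n) m"
proof -
  note nn = tree_cone_nonneg[OF l]
  have nonneg: "0 \<le> slide s l A" for A
    unfolding slide_def using nn moved_le[of new j s l A] moved_nonneg[of l, OF nn] by auto
  define P where "P A \<longleftrightarrow> (j \<in> A \<and> moved new j s l A < l A)" for A
  define Q where "Q A \<longleftrightarrow> (A \<in> old \<and> 0 < moved new j s l (insert j A))" for A
  have cases: "P A \<or> Q A \<or> (j \<notin> A \<and> l A \<noteq> 0)" if "slide s l A \<noteq> 0" for A
  proof -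
    have "moved new j s l A \<noteq> l A \<Longrightarrow> moved new j s l A < l A"
      using moved_le[of new j s l A] by simp
    moreover have "moved new j s l (insert j A) \<noteq> 0 \<Longrightarrow> moved new j s l (insert j A) > 0"
      using moved_nonneg[of l, OF nn, of new j s "insert j A"] by simp
    ultimately show ?thesis
      using that unfolding slide_def P_def Q_def by (auto split: if_splits)
  qed
  have P: "l A \<noteq> 0" "j \<in> A" if "P A" for A
    using that moved_zero[of l A] by (auto simp: P_def)
  have Q: "l (insert j A) \<noteq> 0" "j \<notin> A" "A \<in> old" if "Q A" for A
    using that moved_zero[of l "insert j A"] oldD(1) by (auto simp: Q_def)
  have sub: "{A. slide s l A \<noteq> 0} \<subseteq> new"
  proof
    fix A assume "A \<in> {A. slide s l A \<noteq> 0}"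
    then show "A \<in> new"
      using cases[of A] P(1)[of A] Q(3)[of A] tree_cone_splits[OF l, of A] oldD(2)[of A] by auto
  qed
  have PQ: "A \<subseteq> B" if "Q A" "P B" for A B
  proof -
    have "insert j A \<subseteq> B \<or> B \<subseteq> insert j A"
      using tree_cone_laminar[OF l Q(1)[OF that(1)] P(1)[OF that(2)]] P(2)[OF that(2)] by auto
    then have "insert j A \<subseteq> B"
      using that P tree_cone_splits[OF l] nn unfolding P_def Q_def
      by (intro moved_nested[of new l B j "insert j A" s]) auto
    then show ?thesis by auto
  qed
  have QR: "A \<inter> B = {} \<or> A \<subseteq> B \<or> B \<subseteq> A" if "Q A" "j \<notin> B" "l B \<noteq> 0" for A B
    using tree_cone_laminar[OF l Q(1)[OF that(1)] that(3)] that(2) by auto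
  have QQ: "A \<inter> B = {} \<or> A \<subseteq> B \<or> B \<subseteq> A" if "Q A" "Q B" for A B
    using tree_cone_laminar[OF l Q(1)[OF that(1)] Q(1)[OF that(2)]] Q(2)[OF that(1)] Q(2)[OF that(2)]
    by (auto simp: subset_insert)
  have "A \<inter> B = {} \<or> A \<subseteq> B \<or> B \<subseteq> A" if "slide s l A \<noteq> 0" "slide s l B \<noteq> 0" for A B
    using cases[OF that(1)] cases[OF that(2)] P(1) tree_cone_laminar[OF l, of A B] PQ[of A B] PQ[of B A]
      QR[of A B] QR[of B A] QQ[of A B] by blast
  then show ?thesis
    using nonneg sub by (auto simp: tree_cone_def laminar_def)
qed

section \<open>Forgetting and attaching the mark\<close>

definition total :: "(nat set \<Rightarrow> real) \<Rightarrow> real" where "total l = sum l old"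

text \<open>If \<open>A\<close> and \<open>insert j A\<close> both carry length, these two edges
  become a single one once \<open>j\<close> is gone; hence the sum.\<close>

definition forget :: "(nat set \<Rightarrow> real) \<Rightarrow> (nat set \<Rightarrow> real) \<times> (nat \<Rightarrow> real)" where
  "forget l = (\<lambda>A. if A \<in> old then l A + l (insert j A) else 0,
     \<lambda>i. if i = 1 then l {2..n} else if i \<in> legs then l {i, j} else 0)"

lemma total_nonneg: "(\<And>A. 0 \<le> l A) \<Longrightarrow> 0 \<le> total l"
  unfolding total_def by (simp add: sum_nonneg)

text \<open>The cherry edge is the first one that \<open>j\<close> crosses: a smaller split
  containing \<open>j\<close> would be \<open>{j}\<close>, which is too small.\<close>

lemma below_cherry: "below new j l {i, j} = 0"
proof -
  have "\<not> B \<subset> {i, j}" if "B \<in> new" "j \<in> B" for B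
    using that
  proof (cases rule: newD_in)
    case (1 k) show ?thesis using cherry(2)[OF 1(1)] 1(2) by (auto simp: psubset_eq)
  next
    case (2 C) show ?thesis using oldD(9)[OF 2(1), of i] unfolding 2(2) psubset_eq by simp
  qed
  then have "{B. B \<in> new \<and> j \<in> B \<and> B \<subset> {i, j}} = {}" by blast
  then show ?thesis unfolding below_def by (simp only: sum.empty)
qed

text \<open>The path of \<open>j\<close> consists of cherry edges followed by edges
  \<open>insert j B\<close>. This expresses distances for \<open>j\<close> through old sets, as
  needed to compare them with distances after \<open>forget\<close>.\<close>

lemma below_insert:
  assumes A: "A \<in> old"
  shows "below new j l (insert j A) =
    (\<Sum>i\<in>legs \<inter> A. l {i, j}) + (\<Sum>B | B \<in> old \<and> B \<subset> A. l (insert j B))"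
proof -
  have "{B. B \<in> new \<and> j \<in> B \<and> B \<subset> insert j A} =
      (\<lambda>i. {i, j}) ` (legs \<inter> A) \<union> insert j ` {B. B \<in> old \<and> B \<subset> A}" (is "?L = ?R")
  proof
    show "?L \<subseteq> ?R"
    proof
      fix B assume B: "B \<in> ?L"
      then have "B \<in> new" "j \<in> B" by auto
      then show "B \<in> ?R"
      proof (cases rule: newD_in)
        case (1 i) then show ?thesis using B cherry(2)[of i] by auto
      next
        case (2 C)
        then have "C \<subset> A" using B oldD(1)[OF A] oldD(1)[of C] by (auto simp: psubset_eq)
        then show ?thesis using 2 by auto
      qed
    qed
    show "?R \<subseteq> ?L"
    proof
      fix B assume "B \<in> ?R"
      then consider i where "i \<in> legs" "i \<in> A" "B = {i, j}" | C where "C \<in> old" "C \<subset> A" "B = insert j C"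
        by blast
      then show "B \<in> ?L"
      proof cases
        case 1
        then have "{i, j} \<subset> insert j A" using oldD(8)[OF A, of i] by auto
        then show ?thesis using 1 cherry(1) by auto
      next
        case 2
        then have "insert j C \<subset> insert j A"
          using oldD(1)[OF A] oldD(1)[of C] by (auto simp: insert_ident psubset_eq)
        then show ?thesis using 2 oldD(3) by auto
      qed
    qed
  qed
  then have "below new j l (insert j A) =
    sum l ((\<lambda>i. {i, j}) ` (legs \<inter> A) \<union> insert j ` {B. B \<in> old \<and> B \<subset> A})"
    unfolding below_def by simp
  also have "\<dots> = sum l ((\<lambda>i. {i, j}) ` (legs \<inter> A)) + sum l (insert j ` {B. B \<in> old \<and> B \<subset> A})"
  proof (rule sum.union_disjoint)
    show "(\<lambda>i. {i, j}) ` (legs \<inter> A) \<inter> insert j ` {B. B \<in> old \<and> B \<subset> A} = {}"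
    proof (rule equals0I)
      fix X assume "X \<in> (\<lambda>i. {i, j}) ` (legs \<inter> A) \<inter> insert j ` {B. B \<in> old \<and> B \<subset> A}"
      then obtain i B where "X = {i, j}" "X = insert j B" "B \<in> old" by blast
      then show False using oldD(8)[of B i] by simp
    qed
  qed auto
  also have "sum l ((\<lambda>i. {i, j}) ` (legs \<inter> A)) = (\<Sum>i\<in>legs \<inter> A. l {i, j})"
    by (subst sum.reindex) (auto simp: inj_on_def doubleton_eq_iff)
  also have "sum l (insert j ` {B. B \<in> old \<and> B \<subset> A}) = (\<Sum>B | B \<in> old \<and> B \<subset> A. l (insert j B))"
    using oldD(1) by (subst sum.reindex) (auto simp: inj_on_def insert_ident)
  finally show ?thesis .
qed

lemma forget_in:
  assumes l: "l \<in> tree_cone (Suc n) m"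
  shows "fst (forget l) \<in> tree_cone n m" "snd (forget l) \<in> spider (min n m)"
proof -
  note nn = tree_cone_nonneg[OF l]
  have 0: "l A \<noteq> 0 \<or> l (insert j A) \<noteq> 0" "A \<in> old" if "fst (forget l) A \<noteq> 0" for A
    using that by (auto simp: forget_def split: if_splits)
  have "A \<inter> B = {} \<or> A \<subseteq> B \<or> B \<subseteq> A" if A: "fst (forget l) A \<noteq> 0" and B: "fst (forget l) B \<noteq> 0" for A B
  proof -
    have "j \<notin> A" "j \<notin> B" using 0(2) A B oldD(1) by auto
    then have 1: "x \<inter> y = {} \<or> x \<subseteq> y \<or> y \<subseteq> x \<Longrightarrow> A \<inter> B = {} \<or> A \<subseteq> B \<or> B \<subseteq> A"
      if "x = A \<or> x = insert j A" "y = B \<or> y = insert j B" for x y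
      using that by (auto simp: subset_insert)
    obtain x where x: "l x \<noteq> 0" "x = A \<or> x = insert j A" using 0[OF A] by auto
    obtain y where y: "l y \<noteq> 0" "y = B \<or> y = insert j B" using 0[OF B] by auto
    show ?thesis by (rule 1[OF x(2) y(2) tree_cone_laminar[OF l x(1) y(1)]])
  qed
  moreover have "0 \<le> fst (forget l) A" for A using nn by (simp add: forget_def)
  ultimately show "fst (forget l) \<in> tree_cone n m"
    using 0 by (auto simp: tree_cone_def laminar_def)
  \<comment> \<open>The sets read off by different legs are incompatible: two cherries share only
    \<open>j\<close>, and \<open>{2..n}\<close> meets a cherry only in its old mark.\<close>
  have uniq: "i = k" if "snd (forget l) i \<noteq> 0" "snd (forget l) k \<noteq> 0" for i k
  proof -
    define S where "S i = (if i = 1 then {2..n} else {i, j})" for i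
    have S: "l (S i) \<noteq> 0" "i = 1 \<or> i \<in> legs" if "snd (forget l) i \<noteq> 0" for i
      using that by (auto simp: forget_def S_def split: if_splits)
    have "S i \<inter> S k = {} \<or> S i \<subseteq> S k \<or> S k \<subseteq> S i"
      using tree_cone_laminar[OF l] S(1) that by blast
    moreover have "\<not> {2..n} \<subseteq> {k, j}" for k
    proof
      assume "{2..n} \<subseteq> {k, j}"
      moreover have "2 \<in> {2..n}" "3 \<in> {2..n}" using n by auto
      ultimately have "2 \<in> {k, j}" "3 \<in> {k, j}" by blast+
      then show False using n by auto
    qed
    ultimately show ?thesis
      using S(2)[OF that(1)] S(2)[OF that(2)] by (auto simp: S_def split: if_splits)
  qed
  have "1 \<le> i \<and> i \<le> min n m" if "snd (forget l) i \<noteq> 0" for i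
    using that n m by (auto simp: forget_def split: if_splits)
  moreover have "0 \<le> snd (forget l) i" for i using nn by (simp add: forget_def)
  ultimately show "snd (forget l) \<in> spider (min n m)"
    unfolding spider_def using uniq by (simp add: atLeastAtMost_iff)
qed

lemma forget_zero:
  assumes l: "l \<in> tree_cone (Suc n) m"
  shows "forget l = (\<lambda>_. 0, \<lambda>_. 0) \<longleftrightarrow> l = (\<lambda>_. 0)"
proof
  assume f: "forget l = (\<lambda>_. 0, \<lambda>_. 0)"
  note nn = tree_cone_nonneg[OF l]
  have 1: "l A = 0 \<and> l (insert j A) = 0" if "A \<in> old" for A
    using fun_cong[OF arg_cong[OF f, of fst], of A] that nn[of A] nn[of "insert j A"]
    by (simp add: forget_def add_nonneg_eq_0_iff)
  have 2: "l {2..n} = 0" using fun_cong[OF arg_cong[OF f, of snd], of 1] by (simp add: forget_def)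
  have 3: "l {i, j} = 0" if "i \<in> legs" for i
    using fun_cong[OF arg_cong[OF f, of snd], of i] that by (auto simp: forget_def split: if_splits)
  have "l A = 0" for A
  proof (rule ccontr)
    assume "l A \<noteq> 0"
    then have A: "A \<in> new" using tree_cone_splits[OF l] by blast
    show False
    proof (cases "j \<in> A")
      case True
      with A show ?thesis by (cases rule: newD_in) (use 1 3 \<open>l A \<noteq> 0\<close> in auto)
    next
      case False
      with A show ?thesis using newD_notin 1 2 \<open>l A \<noteq> 0\<close> by blast
    qed
  qed
  then show "l = (\<lambda>_. 0)" by auto
qed (auto simp: forget_def)

text \<open>A point on the leg \<open>i\<close> at height \<open>y i\<close> attaches \<open>j\<close> to the mark \<open>i\<close> and slides it
  the distance \<open>total l\<close>. For \<open>y i = 0\<close> the mark \<open>j\<close> arrives at \<open>1\<close>, whatever \<open>i\<close>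
  was, so the definition is consistent and continuous where the legs meet.\<close>

definition unslid :: "(nat set \<Rightarrow> real) \<Rightarrow> (nat \<Rightarrow> real) \<Rightarrow> nat set \<Rightarrow> real" where
  "unslid l y A = (\<Sum>i\<in>legs. if i \<in> A then l A - moved old i (total l - y i) l A else 0)"

text \<open>The slide uses up the cherry edge first, leaving \<open>max 0 (y i - total l)\<close> of
  it; the rest \<open>total l - y i\<close> of the distance is spent on the edges above
  \<open>i\<close>, and \<open>unslid\<close> is the part of these that stays uncrossed.\<close>

definition attach :: "(nat set \<Rightarrow> real) \<Rightarrow> (nat \<Rightarrow> real) \<Rightarrow> nat set \<Rightarrow> real" where
  "attach l y A =
    (if j \<in> A then
       if A - {j} \<in> old then unslid l y (A - {j})
       else (\<Sum>i\<in>legs. if A = {i, j} then max 0 (y i - total l) else 0)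
     else if A \<in> old then l A - unslid l y A
     else if A = {2..n} then y 1 else 0)"

lemma attach_simps:
  "A \<in> old \<Longrightarrow> attach l y (insert j A) = unslid l y A"
  "A \<in> old \<Longrightarrow> attach l y A = l A - unslid l y A"
  "attach l y {2..n} = y 1"
  "i \<in> legs \<Longrightarrow> attach l y {i, j} = max 0 (y i - total l)"
  "A \<notin> new \<Longrightarrow> attach l y A = 0"
proof -
  show "attach l y (insert j A) = unslid l y A" if "A \<in> old"
    using that oldD(1)[OF that] by (simp add: attach_def)
  show "attach l y A = l A - unslid l y A" if "A \<in> old"
    using that oldD(1)[OF that] by (simp add: attach_def)
  show "attach l y {2..n} = y 1" using root_split by (simp add: attach_def)
  show "attach l y {i, j} = max 0 (y i - total l)" if "i \<in> legs"
  proof -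
    have "(\<Sum>k\<in>legs. if {i, j} = {k, j} then max 0 (y k - total l) else 0)
      = (\<Sum>k\<in>legs. if k = i then max 0 (y k - total l) else 0)"
      by (intro sum.cong) (auto simp: doubleton_eq_iff)
    also have "\<dots> = max 0 (y i - total l)" using that by (subst sum.delta) auto
    finally show ?thesis using cherry(4)[OF that] by (simp add: attach_def)
  qed
  show "attach l y A = 0" if A: "A \<notin> new"
  proof (cases "j \<in> A")
    case True
    have "A - {j} \<notin> old" using oldD(3)[of "A - {j}"] True A by (auto simp: insert_absorb)
    moreover have "A \<noteq> {i, j}" if "i \<in> legs" for i using cherry(1)[OF that] A by auto
    ultimately show ?thesis using True by (auto simp: attach_def intro!: sum.neutral)
  next
    case False
    then show ?thesis using A oldD(2) root_split by (auto simp: attach_def)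
  qed
qed

text \<open>The edges above \<open>i\<close> up to \<open>A\<close> are distinct members of
  \<open>old\<close>, so a slide by \<open>total l\<close> crosses all of them.\<close>

lemma le_total:
  assumes "\<And>A. 0 \<le> l A" "A \<in> old"
  shows "below old i l A + l A \<le> total l"
proof -
  have "below old i l A + l A = sum l (insert A {B. B \<in> old \<and> i \<in> B \<and> B \<subset> A})"
    unfolding below_def by (subst sum.insert) auto
  also have "\<dots> \<le> total l"
    unfolding total_def using assms by (intro sum_mono2) auto
  finally show ?thesis .
qed

lemma unslid_zero:
  assumes "\<And>A. 0 \<le> l A" "\<And>i. i \<in> legs \<Longrightarrow> y i = 0" "A \<in> old"
  shows "unslid l y A = 0"
  unfolding unslid_def using assms moved_all[OF le_total[OF assms(1,3)]] by (intro sum.neutral) auto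

text \<open>Every other leg has coordinate \<open>0\<close>, slides the full distance and crosses
  everything, so its term vanishes. This is why \<open>unslid\<close> can sum over all legs without
  selecting the active one.\<close>

lemma unslid_leg:
  assumes "\<And>A. 0 \<le> l A" "y \<in> spider (min n m)" "i \<in> legs" "y i \<noteq> 0" "A \<in> old"
  shows "unslid l y A = (if i \<in> A then l A - moved old i (total l - y i) l A else 0)"
proof -
  have "y k = 0" if "k \<noteq> i" for k using assms(2,4) that by (auto simp: spider_def)
  then have "unslid l y A =
     (\<Sum>k\<in>legs. if k = i then (if i \<in> A then l A - moved old i (total l - y i) l A else 0) else 0)"
    unfolding unslid_def using moved_all[OF le_total[OF assms(1,5)]] assms(1)
    by (intro sum.cong) auto
  then show ?thesis using assms(3) by (simp add: sum.delta)
qed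

lemma unslid_bounds:
  assumes "\<And>A. 0 \<le> l A" "y \<in> spider (min n m)" "A \<in> old"
  shows "0 \<le> unslid l y A" "unslid l y A \<le> l A"
proof -
  have "0 \<le> unslid l y A \<and> unslid l y A \<le> l A"
  proof (cases "\<exists>i\<in>legs. y i \<noteq> 0")
    case True
    then obtain i where "i \<in> legs" "y i \<noteq> 0" by blast
    then show ?thesis
      using unslid_leg[OF assms(1,2) _ _ assms(3)] moved_le[of old i _ l A] moved_nonneg[of l old i _ A] assms(1)
      by auto
  next
    case False
    then show ?thesis using unslid_zero[OF assms(1) _ assms(3)] assms(1) by auto
  qed
  then show "0 \<le> unslid l y A" "unslid l y A \<le> l A" by auto
qed

lemma attach_in:
  assumes l: "l \<in> tree_cone n m" and y: "y \<in> spider (min n m)"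
  shows "attach l y \<in> tree_cone (Suc n) m"
proof -
  note nn = tree_cone_nonneg[OF l]
  have ynn: "0 \<le> y i" for i using y by (simp add: spider_def)
  have supp: "A \<in> new" if "attach l y A \<noteq> 0" for A using attach_simps(5) that by blast
  \<comment> \<open>The four ways to carry length: an uncrossed part with \<open>j\<close> still
    inside, a part without \<open>j\<close>, the rest of the cherry edge, and the edge of the leg
    \<open>1\<close>.\<close>
  have elim: P if "attach l y A \<noteq> 0"
      and "\<And>B. B \<in> old \<Longrightarrow> A = insert j B \<Longrightarrow> 0 < unslid l y B \<Longrightarrow> P"
      and "A \<in> old \<Longrightarrow> unslid l y A < l A \<Longrightarrow> P"
      and "\<And>i. i \<in> legs \<Longrightarrow> A = {i, j} \<Longrightarrow> y i > total l \<Longrightarrow> P"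
      and "A = {2..n} \<Longrightarrow> y 1 \<noteq> 0 \<Longrightarrow> P" for A P
  proof -
    note hyps = that
    show P
  proof (cases "j \<in> A")
    case True
    with supp[OF hyps(1)] show P
    proof (cases rule: newD_in)
      case (1 i) then show P using hyps(1,4) attach_simps(4)[OF 1(1), of l y] by auto
    next
      case (2 B) then show P
        using hyps(1,2) attach_simps(1)[OF 2(1), of l y] unslid_bounds(1)[of l, OF nn y 2(1)] by auto
    qed
  next
    case False
    then consider "A \<in> old" | "A = {2..n}" using newD_notin supp[OF hyps(1)] by blast
    then show P
    proof cases
      case 1 then show P
        using hyps(1,3) attach_simps(2)[OF 1, of l y] unslid_bounds(2)[of l, OF nn y 1] by auto
    next
      case 2 then show P using hyps(1,5) attach_simps(3)[of l y] by auto
    qed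
  qed
  qed
  have nonneg: "0 \<le> attach l y A" for A
  proof (rule ccontr)
    assume neg: "\<not> 0 \<le> attach l y A"
    then have "attach l y A \<noteq> 0" by auto
    then show False
      by (rule elim)
         (use neg in \<open>auto simp: attach_simps ynn\<close>)
  qed
  have lam: "A \<inter> B = {} \<or> A \<subseteq> B \<or> B \<subseteq> A" if A: "A \<in> old" "l A \<noteq> 0" and B: "B \<in> old" "l B \<noteq> 0" for A B
    using tree_cone_laminar[OF l] that by blast
  have pos: "l B \<noteq> 0" if "B \<in> old" "0 < unslid l y B" for B
    using unslid_bounds[of l, OF nn y that(1)] that(2) by auto
  have pos': "l B \<noteq> 0" if "B \<in> old" "unslid l y B < l B" for B
    using unslid_bounds[of l, OF nn y that(1)] that(2) by auto
  have "A \<inter> B = {} \<or> A \<subseteq> B \<or> B \<subseteq> A" if A: "attach l y A \<noteq> 0" and B: "attach l y B \<noteq> 0" for A B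
  proof (cases "\<exists>i\<in>legs. y i \<noteq> 0")
    case True
    then obtain i where i: "i \<in> legs" "y i \<noteq> 0" by blast
    have yk: "y k = 0" if "k \<noteq> i" for k using y i that by (auto simp: spider_def)
    have y1: "y 1 = 0" using yk[of 1] i by auto
    note u = unslid_leg[of l, OF nn y i]
    have un: "i \<in> C" "moved old i (total l - y i) l C < l C" if "C \<in> old" "0 < unslid l y C" for C
      using u[OF that(1)] that(2) by (auto split: if_splits)
    have sl: "i \<in> C \<Longrightarrow> 0 < moved old i (total l - y i) l C" if "C \<in> old" "unslid l y C < l C" for C
      using u[OF that(1)] that(2) by (auto split: if_splits)
    \<comment> \<open>While \<open>j\<close> is still on its cherry edge, no edge above
      \<open>i\<close> has been crossed.\<close>
    have far: "i \<notin> C" if "C \<in> old" "unslid l y C < l C" "y i > total l" for C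
      using sl[OF that(1,2)] moved_nonpos[of l "total l - y i" old i C] nn that(3) by auto
    have ch: "k = i" if "y k > total l" for k
      using yk[of k] that total_nonneg[of l] nn by (metis not_less)
    \<comment> \<open>If \<open>i \<in> C\<close>, both edges lie above \<open>i\<close>, and the
      order of crossing puts the crossed one inside. If \<open>i \<notin> C\<close>, the set
      \<open>D\<close>, which contains \<open>i\<close>, cannot lie in \<open>C\<close>.\<close>
    have old_new: "C \<inter> insert j D = {} \<or> C \<subseteq> insert j D \<or> insert j D \<subseteq> C"
      if C: "C \<in> old" "unslid l y C < l C" and D: "D \<in> old" "0 < unslid l y D" for C D
    proof (cases "i \<in> C")
      case True
      have "C \<subseteq> D \<or> D \<subseteq> C"
        using lam[OF C(1) pos'[OF C] D(1) pos[OF D]] True un(1)[OF D] by auto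
      then have "C \<subseteq> D"
        using moved_nested[of old l D i C "total l - y i"] nn D(1) un[OF D] sl[OF C True] by auto
      then show ?thesis by auto
    next
      case False
      have "\<not> D \<subseteq> C" using un(1)[OF D] False by auto
      then have "C \<inter> D = {} \<or> C \<subseteq> D" using lam[OF C(1) pos'[OF C] D(1) pos[OF D]] by auto
      then show ?thesis using oldD(1)[OF C(1)] by auto
    qed
    have cherry_new: "{i, j} \<subseteq> insert j D" if "D \<in> old" "0 < unslid l y D" for D
      using un(1)[OF that] by auto
    have cherry_old: "C \<inter> {i, j} = {}" if "C \<in> old" "unslid l y C < l C" "y i > total l" for C
      using far[OF that] oldD(1)[OF that(1)] by auto
    have new_new: "insert j C \<inter> insert j D = {} \<or> insert j C \<subseteq> insert j D \<or> insert j D \<subseteq> insert j C"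
      if C: "C \<in> old" "0 < unslid l y C" and D: "D \<in> old" "0 < unslid l y D" for C D
      using lam[OF C(1) pos[OF C] D(1) pos[OF D]] un(1)[OF C] un(1)[OF D] by auto
    have old_old: "C \<inter> D = {} \<or> C \<subseteq> D \<or> D \<subseteq> C"
      if C: "C \<in> old" "unslid l y C < l C" and D: "D \<in> old" "unslid l y D < l D" for C D
      using lam[OF C(1) pos'[OF C] D(1) pos'[OF D]] .
    from A show ?thesis
    proof (rule elim)
      fix C assume C: "C \<in> old" "A = insert j C" "0 < unslid l y C"
      from B show ?thesis
      proof (rule elim)
        fix D assume D: "D \<in> old" "B = insert j D" "0 < unslid l y D"
        show ?thesis using new_new[OF C(1,3) D(1,3)] unfolding C(2) D(2) .
      next
        assume D: "B \<in> old" "unslid l y B < l B"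
        show ?thesis using old_new[OF D C(1,3)] unfolding C(2) by blast
      next
        fix k assume k: "k \<in> legs" "B = {k, j}" "y k > total l"
        show ?thesis using cherry_new[OF C(1,3)] ch[OF k(3)] unfolding C(2) k(2) by blast
      qed (use y1 in simp)
    next
      assume C: "A \<in> old" "unslid l y A < l A"
      from B show ?thesis
      proof (rule elim)
        fix D assume D: "D \<in> old" "B = insert j D" "0 < unslid l y D"
        show ?thesis using old_new[OF C D(1,3)] unfolding D(2) .
      next
        assume D: "B \<in> old" "unslid l y B < l B"
        show ?thesis using old_old[OF C D] .
      next
        fix k assume k: "k \<in> legs" "B = {k, j}" "y k > total l"
        show ?thesis using cherry_old[OF C] k ch[OF k(3)] by blast
      qed (use y1 in simp)
    next
      fix k assume k: "k \<in> legs" "A = {k, j}" "y k > total l"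
      note ki = ch[OF k(3)]
      from B show ?thesis
      proof (rule elim)
        fix D assume D: "D \<in> old" "B = insert j D" "0 < unslid l y D"
        show ?thesis using cherry_new[OF D(1,3)] unfolding D(2) k(2) ki by blast
      next
        assume D: "B \<in> old" "unslid l y B < l B"
        show ?thesis using cherry_old[OF D] k ki by blast
      next
        fix k' assume k': "k' \<in> legs" "B = {k', j}" "y k' > total l"
        show ?thesis using ch[OF k'(3)] unfolding k'(2) k(2) ki by blast
      qed (use y1 in simp)
    qed (use y1 in simp)
  next
    \<comment> \<open>Now \<open>j\<close> has arrived at the mark \<open>1\<close>: only old sets
      and \<open>{2..n}\<close> occur, and the latter contains all the former.\<close>
    case False
    then have y0: "y i = 0" if "i \<in> legs" for i using that by blast
    have 1: "A = {2..n} \<or> A \<in> old \<and> l A \<noteq> 0" if "attach l y A \<noteq> 0" for A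
      using that by (rule elim) (use unslid_zero[of l, OF nn y0] y0 total_nonneg[of l, OF nn] in \<open>auto simp: not_less\<close>)
    show ?thesis using 1[OF A] 1[OF B] lam oldD(5) by blast
  qed
  then show ?thesis using nonneg supp by (auto simp: tree_cone_def laminar_def)
qed

lemma attach_zero:
  assumes l: "l \<in> tree_cone n m" and y: "y \<in> spider (min n m)"
  shows "attach l y = (\<lambda>_. 0) \<longleftrightarrow> l = (\<lambda>_. 0) \<and> y = (\<lambda>_. 0)"
proof
  assume f: "attach l y = (\<lambda>_. 0)"
  note nn = tree_cone_nonneg[OF l]
  have "l A = 0" for A
    using attach_simps(1,2)[of A l y] f tree_cone_splits[OF l, of A] by (cases "A \<in> old") auto
  then have l0: "l = (\<lambda>_. 0)" by auto
  have "y i = 0" for i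
  proof (cases "i \<in> legs")
    case True
    then show ?thesis
      using attach_simps(4)[OF True, of l y] f y l0 by (auto simp: total_def spider_def max_def split: if_splits)
  next
    case False
    have "y 1 = 0" using attach_simps(3)[of l y] f by simp
    moreover have "y i \<noteq> 0 \<Longrightarrow> 1 \<le> i \<and> i \<le> min n m" using y unfolding spider_def by force
    ultimately show ?thesis using False by (cases "i = 1"; cases "y i = 0") auto
  qed
  then show "l = (\<lambda>_. 0) \<and> y = (\<lambda>_. 0)" using l0 by auto
next
  assume "l = (\<lambda>_. 0) \<and> y = (\<lambda>_. 0)"
  then show "attach l y = (\<lambda>_. 0)"
    by (auto simp: attach_def total_def unslid_def moved_def fun_eq_iff intro!: sum.neutral)
qed

text \<open>A cherry fixes the place of \<open>j\<close>: of the two lengths \<open>l A\<close> and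
  \<open>l (insert j A)\<close> that \<open>forget\<close> adds, only the second can be nonzero if
  \<open>i \<in> A\<close>, and only the first otherwise.\<close>

lemma cherry_incompatible:
  assumes l: "l \<in> tree_cone (Suc n) m" and "i \<in> legs" "l {i, j} \<noteq> 0"
  shows "k \<noteq> i \<Longrightarrow> k \<in> legs \<Longrightarrow> l {k, j} = 0" "l {2..n} = 0"
    "A \<in> old \<Longrightarrow> i \<in> A \<Longrightarrow> l A = 0" "A \<in> old \<Longrightarrow> i \<notin> A \<Longrightarrow> l (insert j A) = 0"
proof -
  have i: "i \<noteq> j" "i \<in> {2..n}" using cherry[OF assms(2)] by auto
  note lam = tree_cone_laminar[OF l assms(3)]
  have R: "\<not> {2..n} \<subseteq> {i, j}"
  proof
    assume "{2..n} \<subseteq> {i, j}"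
    moreover have "2 \<in> {2..n}" "3 \<in> {2..n}" using n by auto
    ultimately have "2 \<in> {i, j}" "3 \<in> {i, j}" by blast+
    then show False using n by auto
  qed
  show "l {k, j} = 0" if "k \<noteq> i" "k \<in> legs" using lam[of "{k, j}"] that i cherry(2)[OF that(2)] by auto
  show "l {2..n} = 0" using lam[of "{2..n}"] i R by auto
  show "l A = 0" if "A \<in> old" "i \<in> A"
    using lam[of A] oldD(1,9)[OF that(1)] that(2) by auto
  show "l (insert j A) = 0" if "A \<in> old" "i \<notin> A"
    using lam[of "insert j A"] oldD(11)[OF that(1), of i] that(2) i by auto
qed

text \<open>Without a cherry, \<open>forget\<close> loses the place of \<open>j\<close>, but a slide
  by the total length erases that information as well: \<open>j\<close> crosses every edge up to
  \<open>1\<close>.\<close>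

lemma attach_forget:
  assumes l: "l \<in> tree_cone (Suc n) m"
  shows "attach (fst (forget l)) (snd (forget l)) = slide (total (fst (forget l))) l"
proof
  fix A
  define l' where "l' = fst (forget l)"
  define y where "y = snd (forget l)"
  note nn = tree_cone_nonneg[OF l]
  have l'in: "l' \<in> tree_cone n m" and yin: "y \<in> spider (min n m)"
    using forget_in[OF l] by (auto simp: l'_def y_def)
  note nn' = tree_cone_nonneg[OF l'in]
  have l': "l' A = l A + l (insert j A)" if "A \<in> old" for A using that by (simp add: l'_def forget_def)
  have y: "y i = l {i, j}" if "i \<in> legs" for i using that by (auto simp: y_def forget_def)
  have y1: "y 1 = l {2..n}" by (simp add: y_def forget_def)
  have tn: "0 \<le> total l'" using total_nonneg nn' by blast
  have key: "unslid l' y A = l (insert j A) - moved new j (total l') l (insert j A)" if A: "A \<in> old" for A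
  proof (cases "\<exists>i\<in>legs. y i \<noteq> 0")
    case True
    then obtain i where i: "i \<in> legs" "y i \<noteq> 0" by blast
    note c = cherry_incompatible[OF l i(1)] 
    have li: "l {i, j} \<noteq> 0" using i y by auto
    note c = c[OF li]
    show ?thesis
    proof (cases "i \<in> A")
      case iA: True
      have "(\<Sum>k\<in>legs \<inter> A. l {k, j}) = (\<Sum>k\<in>legs \<inter> A. if k = i then l {i, j} else 0)"
        using c(1) by (intro sum.cong) auto
      also have "\<dots> = y i" using i iA y by (subst sum.delta) auto
      finally have 1: "(\<Sum>k\<in>legs \<inter> A. l {k, j}) = y i" .
      have 2: "(\<Sum>B | B \<in> old \<and> B \<subset> A. l (insert j B)) = below old i l' A"
        unfolding below_def using c(3,4) l' by (intro sum.mono_neutral_cong_right) auto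
      \<comment> \<open>The path of \<open>j\<close> is the cherry edge, of length
        \<open>y i\<close>, followed by the path of \<open>i\<close>; so the distance left on
        reaching \<open>A\<close> is the same on both sides.\<close>
      have "below new j l (insert j A) = y i + below old i l' A"
        unfolding below_insert[OF A] 1 2 ..
      then show ?thesis
        using unslid_leg[of l', OF nn' yin i A] iA l'[OF A] c(3)[OF A iA] by (simp add: moved_def algebra_simps)
    next
      case False
      then show ?thesis
        using unslid_leg[of l', OF nn' yin i A] c(4)[OF A False] by (simp add: moved_zero)
    qed
  next
    case False
    have 1: "(\<Sum>k\<in>legs \<inter> A. l {k, j}) = 0" using False y by (intro sum.neutral) auto
    have "below new j l (insert j A) + l (insert j A) = (\<Sum>B \<in> insert A {B. B \<in> old \<and> B \<subset> A}. l (insert j B))"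
      unfolding below_insert[OF A] 1 by (subst sum.insert) auto
    also have "\<dots> \<le> (\<Sum>B \<in> old. l (insert j B))"
      using A nn by (intro sum_mono2) auto
    also have "\<dots> \<le> total l'"
      unfolding total_def using l' nn by (intro sum_mono) auto
    finally have "moved new j (total l') l (insert j A) = l (insert j A)"
      by (intro moved_all nn)
    then show ?thesis using unslid_zero[of l', OF nn' _ A] False by auto
  qed
  have "attach l' y A = slide (total l') l A"
  proof (cases "A \<in> new")
    case new: True
    show ?thesis
    proof (cases "j \<in> A")
      case True
      with new show ?thesis
      proof (cases rule: newD_in)
        case (1 i)
        have "moved new j (total l') l {i, j} = min (l {i, j}) (total l')"
          using tn unfolding moved_def below_cherry by auto
        then show ?thesis
          unfolding 1(2) attach_simps(4)[OF 1(1)] y[OF 1(1)] by (auto simp: slide_def)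
      next
        case (2 B)
        then show ?thesis using attach_simps(1)[OF 2(1)] key[OF 2(1)] by (simp add: slide_def)
      qed
    next
      case False
      with new consider "A \<in> old" | "A = {2..n}" using newD_notin by blast
      then show ?thesis
      proof cases
        case 1
        then show ?thesis using attach_simps(2)[OF 1] key[OF 1] l'[OF 1] False by (simp add: slide_def)
      next
        case 2
        then show ?thesis using attach_simps(3) y1 root_split by (simp add: slide_def)
      qed
    qed
  next
    case False
    then have "A \<notin> old" "l A = 0" using oldD(2) tree_cone_splits[OF l] by blast+
    then show ?thesis using attach_simps(5)[OF False] by (simp add: slide_def moved_zero)
  qed
  then show "attach (fst (forget l)) (snd (forget l)) A = slide (total (fst (forget l))) l A"
    by (simp add: l'_def y_def)
qed

text \<open>The trace of a slide on the spider coordinate. Only cherry edges get shorter: on the leg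
  \<open>1\<close> the mark \<open>j\<close> already sits with \<open>1\<close> and has nothing to
  cross.\<close>

definition shorten :: "real \<Rightarrow> (nat set \<Rightarrow> real) \<times> (nat \<Rightarrow> real) \<Rightarrow> (nat set \<Rightarrow> real) \<times> (nat \<Rightarrow> real)" where
  "shorten t p = (fst p, \<lambda>i. if i \<in> legs then max 0 (snd p i - t * total (fst p)) else snd p i)"

lemma forget_attach:
  assumes l: "l \<in> tree_cone n m" and y: "y \<in> spider (min n m)"
  shows "forget (attach l y) = shorten 1 (l, y)"
proof -
  have "fst (forget (attach l y)) A = l A" for A
    using tree_cone_splits[OF l, of A] by (auto simp: forget_def attach_simps)
  moreover have "snd (forget (attach l y)) i = snd (shorten 1 (l, y)) i" for i
    using y by (auto simp: forget_def shorten_def attach_simps spider_def)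
  ultimately show ?thesis by (auto simp: prod_eq_iff shorten_def fun_eq_iff)
qed

lemma shorten_in:
  assumes "p \<in> tree_cone n m \<times> spider (min n m)" "0 \<le> t"
  shows "shorten t p \<in> tree_cone n m \<times> spider (min n m)"
proof -
  have t: "0 \<le> t * total (fst p)"
    using assms tree_cone_nonneg total_nonneg by (metis mem_Times_iff mult_nonneg_nonneg)
  have y: "fst p \<in> tree_cone n m" "snd p \<in> spider (min n m)" using assms by (auto simp: mem_Times_iff)
  have y0: "0 \<le> snd p i" for i using y by (simp add: spider_def)
  have 1: "0 \<le> snd (shorten t p) i" for i using y0 by (simp add: shorten_def)
  have 2: "snd p i \<noteq> 0" if "snd (shorten t p) i \<noteq> 0" for i
    using t that by (auto simp: shorten_def max_def split: if_splits)
  have "snd (shorten t p) \<in> spider (min n m)"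
    using 1 2 y(2) unfolding spider_def by blast
  then show ?thesis
    using y(1) by (simp add: shorten_def mem_Times_iff)
qed

text \<open>The tree coordinate is unchanged, and where it is zero nothing is subtracted from the
  other one.\<close>

lemma shorten_zero:
  assumes "p \<in> tree_cone n m \<times> spider (min n m)"
  shows "shorten t p = (\<lambda>_. 0, \<lambda>_. 0) \<longleftrightarrow> p = (\<lambda>_. 0, \<lambda>_. 0)"
proof -
  have y0: "0 \<le> snd p i" for i using assms by (auto simp: spider_def mem_Times_iff)
  have "shorten t p = p" if "fst p = (\<lambda>_. 0)"
    unfolding shorten_def using that y0 by (simp add: total_def prod_eq_iff fun_eq_iff)
  moreover have "fst (shorten t p) = fst p" by (simp add: shorten_def)
  ultimately show ?thesis by (metis fst_conv)
qed

text \<open>A slide preserves each sum \<open>l A + l (insert j A)\<close> with \<open>A\<close>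
  old. If the result is zero, these sums vanish; then the distance \<open>t * total\<close> was zero
  and the slide changed nothing.\<close>

lemma slide_zero:
  assumes l: "l \<in> tree_cone (Suc n) m"
  shows "slide (t * total (fst (forget l))) l = (\<lambda>_. 0) \<longleftrightarrow> l = (\<lambda>_. 0)"
proof
  assume s: "slide (t * total (fst (forget l))) l = (\<lambda>_. 0)"
  note nn = tree_cone_nonneg[OF l]
  have sl: "slide (t * total (fst (forget l))) l A = 0" for A using s by simp
  have "l A = 0 \<and> l (insert j A) = 0" if A: "A \<in> old" for A
    using sl[of A] sl[of "insert j A"] nn[of A] moved_nonneg[of l new j "t * total (fst (forget l))" "insert j A"] nn
      oldD(1)[OF A] A by (auto simp: slide_def add_nonneg_eq_0_iff)
  then have "fst (forget l) = (\<lambda>_. 0)" by (auto simp: forget_def)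
  then have 0: "t * total (fst (forget l)) = 0" by (simp add: total_def)
  have "moved new j 0 l A = 0" for A using nn by (intro moved_nonpos) auto
  then have "slide 0 l = l" by (auto simp: slide_def fun_eq_iff)
  then show "l = (\<lambda>_. 0)" using s 0 by simp
qed (auto simp: slide_def moved_zero)

lemma total_forget: "total (fst (forget l)) = (\<Sum>A\<in>old. l A + l (insert j A))"
  by (simp add: total_def forget_def)

text \<open>Both composites are the time-\<open>1\<close> maps of explicit homotopies from the
  identity: the slide by \<open>t * total\<close> on trees, and \<open>shorten t\<close> on the
  product.\<close>

lemma cone_equiv_add_mark:
  "cone_equiv (tree_cone (Suc n) m) (\<lambda>_. 0) (tree_cone n m \<times> spider (min n m)) (\<lambda>_. 0, \<lambda>_. 0)"
  unfolding cone_equiv_def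
proof (intro exI conjI)
  let ?f = "forget" and ?g = "\<lambda>p. attach (fst p) (snd p)"
  show "cone_map (tree_cone (Suc n) m) (\<lambda>_. 0) (tree_cone n m \<times> spider (min n m)) (\<lambda>_. 0, \<lambda>_. 0) ?f"
    unfolding cone_map_def
  proof (intro conjI ballI)
    show "continuous_on (tree_cone (Suc n) m) forget"
      unfolding forget_def
      by (intro continuous_on_Pair continuous_on_coordinatewise_then_product cont_intros)
  qed (use forget_in forget_zero in \<open>auto simp: mem_Times_iff\<close>)
  show "cone_map (tree_cone n m \<times> spider (min n m)) (\<lambda>_. 0, \<lambda>_. 0) (tree_cone (Suc n) m) (\<lambda>_. 0) ?g"
    unfolding cone_map_def
  proof (intro conjI ballI)
    have 1: "continuous_on X (\<lambda>p. unslid (fst p) (snd p) A)" for X A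
      unfolding unslid_def moved_def below_def total_def
      by (intro cont_intros)
    show "continuous_on (tree_cone n m \<times> spider (min n m)) ?g"
      unfolding attach_def total_def
      by (intro continuous_on_coordinatewise_then_product 1 cont_intros)
  qed (use attach_in attach_zero in auto)
  show "cone_homotopic (tree_cone (Suc n) m) (\<lambda>_. 0) (?g \<circ> ?f) id"
  proof (rule homotopic_with_symD, rule cone_homotopicI[where H = "\<lambda>p. slide (fst p * total (fst (forget (snd p)))) (snd p)"])
    have "continuous_on X (\<lambda>p. moved new j (fst p * total (fst (forget (snd p)))) (snd p) A)"
      for X :: "(real \<times> (nat set \<Rightarrow> real)) set" and A
      unfolding moved_def below_def total_forget by (intro cont_intros)
    note 1 = this
    show "continuous_on ({0..1} \<times> tree_cone (Suc n) m) (\<lambda>p. slide (fst p * total (fst (forget (snd p)))) (snd p))"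
      unfolding slide_def
      by (intro continuous_on_coordinatewise_then_product 1 cont_intros)
    show "slide (fst (0, l) * total (fst (forget (snd (0, l))))) (snd (0, l)) = id l"
      if "l \<in> tree_cone (Suc n) m" for l
      using moved_nonpos[of l 0 new j] tree_cone_nonneg[OF that] by (auto simp: slide_def fun_eq_iff)
  qed (use slide_tree_cone slide_zero attach_forget in auto)
  show "cone_homotopic (tree_cone n m \<times> spider (min n m)) (\<lambda>_. 0, \<lambda>_. 0) (?f \<circ> ?g) id"
  proof (rule homotopic_with_symD, rule cone_homotopicI[where H = "\<lambda>p. shorten (fst p) (snd p)"])
    show "continuous_on ({0..1} \<times> tree_cone n m \<times> spider (min n m)) (\<lambda>p. shorten (fst p) (snd p))"
      unfolding shorten_def total_def
      by (intro continuous_on_Pair continuous_on_coordinatewise_then_product cont_intros)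
    show "shorten (fst (0, p)) (snd (0, p)) = id p" if "p \<in> tree_cone n m \<times> spider (min n m)" for p
      using that by (auto simp: shorten_def prod_eq_iff spider_def fun_eq_iff)
  qed (use shorten_in shorten_zero forget_attach in \<open>auto simp: mem_Times_iff\<close>)
qed

end

section \<open>Gluing and sums\<close>

lemma glue_class_eqI:
  assumes "x \<in> topspace X" "y \<in> topspace X" "r x y"
  shows "glue_class X r x = glue_class X r y"
proof -
  let ?R = "\<lambda>y z. y \<in> topspace X \<and> z \<in> topspace X \<and> r y z"
  have "equivclp ?R x y" using assms by blast
  then have "equivclp ?R x = equivclp ?R y"
    by (intro ext) (meson equivclp_sym equivclp_trans)
  then show ?thesis by (simp add: glue_class_def)
qed

lemma glue_class_respects:
  assumes "\<And>x y. x \<in> topspace X \<Longrightarrow> y \<in> topspace X \<Longrightarrow> r x y \<Longrightarrow> h x = h y"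
    and "glue_class X r x = glue_class X r y"
  shows "h x = h y"
proof -
  let ?R = "\<lambda>y z. y \<in> topspace X \<and> z \<in> topspace X \<and> r y z"
  have "y \<in> glue_class X r x" unfolding assms(2) by (simp add: glue_class_def)
  then have "equivclp ?R x y" by (simp add: glue_class_def)
  then show ?thesis
    by (induction rule: equivclp_induct) (use assms(1) in metis)+
qed

lemma continuous_map_from_sum_topology:
  assumes "\<And>i. i \<in> I \<Longrightarrow> continuous_map (X i) Y (\<lambda>x. f (i, x))"
  shows "continuous_map (sum_topology X I) Y f"
proof -
  have "openin (sum_topology X I) {p \<in> topspace (sum_topology X I). f p \<in> U}" if "openin Y U" for U
  proof -
    have "{x. (i, x) \<in> {p \<in> topspace (sum_topology X I). f p \<in> U}} = {x \<in> topspace (X i). f (i, x) \<in> U}"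
      if "i \<in> I" for i using that by auto
    then show ?thesis
      using assms that by (auto simp: openin_sum_topology continuous_map_def)
  qed
  then show ?thesis
    using assms by (auto simp: continuous_map_def Pi_iff)
qed

text \<open>In product form, a homotopy on copies of one sphere can be assembled from projections,
  with the time parameter as a further factor.\<close>

lemma sum_topology_const: "sum_topology (\<lambda>_. X) I = prod_topology (discrete_topology I) X"
  unfolding topology_eq
proof (intro allI iffI)
  fix U assume U: "openin (sum_topology (\<lambda>_. X) I) U"
  show "openin (prod_topology (discrete_topology I) X) U"
    unfolding openin_prod_topology_alt
  proof (intro allI impI)
    fix i x assume "(i, x) \<in> U"
    with U show "\<exists>V W. openin (discrete_topology I) V \<and> openin X W \<and> i \<in> V \<and> x \<in> W \<and> V \<times> W \<subseteq> U"
      by (intro exI[of _ "{i}"] exI[of _ "{x. (i, x) \<in> U}"]) (auto simp: openin_sum_topology)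
  qed
next
  fix U assume U: "openin (prod_topology (discrete_topology I) X) U"
  have sub: "U \<subseteq> I \<times> topspace X" using openin_subset[OF U] by simp
  have "openin X {x. (i, x) \<in> U}" if "i \<in> I" for i
  proof -
    have "continuous_map X (prod_topology (discrete_topology I) X) (\<lambda>x. (i, x))"
      using that by (intro continuous_map_pairedI) auto
    then have "openin X {x \<in> topspace X. (i, x) \<in> U}"
      using U openin_continuous_map_preimage by blast
    moreover have "{x \<in> topspace X. (i, x) \<in> U} = {x. (i, x) \<in> U}" using sub by auto
    ultimately show ?thesis by simp
  qed
  then show "openin (sum_topology (\<lambda>_. X) I) U"
    using sub by (auto simp: openin_sum_topology)
qed

section \<open>Products of spiders\<close>

text \<open>Coordinates from \<open>r\<close> on are set to zero, so that the products for all
  \<open>r\<close> share one type.\<close>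

definition spiders :: "nat \<Rightarrow> (nat \<Rightarrow> nat) \<Rightarrow> (nat \<Rightarrow> nat \<Rightarrow> real) set" where
  "spiders r a = {y. (\<forall>j<r. y j \<in> spider (a j)) \<and> (\<forall>j\<ge>r. y j = (\<lambda>_. 0))}"

lemma continuous_on_apply2: "continuous_on X (\<lambda>f. f i k)"
  by (rule continuous_on_product_then_coordinatewise[OF continuous_on_apply])

lemma continuous_on_snd_apply2: "continuous_on X (\<lambda>p. snd p i k)"
  by (rule continuous_on_product_then_coordinatewise[OF continuous_app(1)])

lemma cone_equiv_spiders_Suc:
  "cone_equiv (spiders r a \<times> spider (a r)) (\<lambda>_ _. 0, \<lambda>_. 0) (spiders (Suc r) a) (\<lambda>_ _. 0)"
proof (rule cone_equiv_homeomorphism)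
  let ?f = "\<lambda>p j. if j = r then snd p else fst p j"
  let ?g = "\<lambda>y. (\<lambda>j k. if j = r then 0 else y j k, y r) :: (nat \<Rightarrow> nat \<Rightarrow> real) \<times> (nat \<Rightarrow> real)"
  show "cone_map (spiders r a \<times> spider (a r)) (\<lambda>_ _. 0, \<lambda>_. 0) (spiders (Suc r) a) (\<lambda>_ _. 0) ?f"
    unfolding cone_map_def
  proof (intro conjI ballI)
    have "continuous_on (spiders r a \<times> spider (a r)) (\<lambda>p. ?f p j)" for j
      by (intro continuous_on_if_const continuous_app continuous_on_snd continuous_on_id)
    then show "continuous_on (spiders r a \<times> spider (a r)) ?f"
      by (rule continuous_on_coordinatewise_then_product)
    show "?f \<in> spiders r a \<times> spider (a r) \<rightarrow> spiders (Suc r) a"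
      by (auto simp: spiders_def less_Suc_eq)
    fix p assume p: "p \<in> spiders r a \<times> spider (a r)"
    have "?f p = (\<lambda>_ _. 0) \<Longrightarrow> fst p j = (\<lambda>_. 0)" for j
      using fun_cong[of "?f p" "\<lambda>_ _. 0" j] p by (cases "j = r") (auto simp: spiders_def)
    moreover have "?f p = (\<lambda>_ _. 0) \<Longrightarrow> snd p = (\<lambda>_. 0)"
      using fun_cong[of "?f p" "\<lambda>_ _. 0" r] by simp
    ultimately show "?f p = (\<lambda>_ _. 0) \<longleftrightarrow> p = (\<lambda>_ _. 0, \<lambda>_. 0)"
      by (auto simp: prod_eq_iff)
  qed
  show "cone_map (spiders (Suc r) a) (\<lambda>_ _. 0) (spiders r a \<times> spider (a r)) (\<lambda>_ _. 0, \<lambda>_. 0) ?g"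
    unfolding cone_map_def
  proof (intro conjI ballI)
    show "continuous_on (spiders (Suc r) a) ?g"
      by (intro continuous_on_Pair continuous_on_coordinatewise_then_product continuous_on_if_const
          continuous_on_apply2 continuous_on_const)
    show "?g \<in> spiders (Suc r) a \<rightarrow> spiders r a \<times> spider (a r)"
      by (auto simp: spiders_def)
    fix y assume "y \<in> spiders (Suc r) a"
    show "?g y = (\<lambda>_ _. 0, \<lambda>_. 0) \<longleftrightarrow> y = (\<lambda>_ _. 0)"
      by (auto simp: fun_eq_iff split: if_splits)
  qed
  show "?g (?f p) = p" if "p \<in> spiders r a \<times> spider (a r)" for p
    using that by (auto simp: prod_eq_iff spiders_def fun_eq_iff)
qed auto

text \<open>The only two-element subset of \<open>{2..3}\<close> is the excluded
  \<open>{2..n}\<close>. So a cone for three marks is just its apex, the start of the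
  induction.\<close>

lemma splits_3: "splits 3 m = {}"
proof -
  have *: "card A \<le> 1" if "A \<subseteq> {2..3::nat}" "A \<noteq> {2..3}" for A
  proof -
    have "A \<subset> {2..3}" using that by blast
    then have "card A < card {2..3::nat}" by (intro psubset_card_mono) auto
    then show ?thesis by simp
  qed
  show ?thesis
  proof (rule equals0I)
    fix A assume "A \<in> splits 3 m"
    then have "A \<subseteq> {2..3}" "A \<noteq> {2..3}" "2 \<le> card A" by (auto simp: splits_def)
    then show False using *[of A] by simp
  qed
qed

theorem cone_equiv_tree_cone:
  assumes "2 \<le> m"
  shows "cone_equiv (tree_cone (3 + r) m) (\<lambda>_. 0) (spiders r (\<lambda>j. min (j + 3) m)) (\<lambda>_ _. 0)"
proof (induction r)
  case 0
  have 1: "tree_cone 3 m = {\<lambda>_. 0}"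
    by (auto simp: tree_cone_def splits_3 laminar_def fun_eq_iff)
  have 2: "spiders 0 (\<lambda>j. min (j + 3) m) = {\<lambda>_ _. 0}"
    by (auto simp: spiders_def)
  show ?case unfolding add_0_right 1 2
    by (rule cone_equiv_homeomorphism[of _ _ _ _ "\<lambda>_ _ _. 0" "\<lambda>_ _. 0"]) (auto simp: cone_map_def)
next
  case (Suc r)
  interpret add_mark "3 + r" m using assms by unfold_locales auto
  show ?case
    using cone_equiv_trans[OF cone_equiv_trans[OF cone_equiv_add_mark cone_equiv_Times[OF Suc.IH]]
        cone_equiv_spiders_Suc[of r "\<lambda>j. min (j + 3) m", simplified add.commute[of r 3]]]
    by simp
qed

section \<open>From a product of spiders to a wedge of spheres\<close>

locale spider_product =
  fixes r :: nat and a :: "nat \<Rightarrow> nat"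
  assumes r: "0 < r" and a: "\<And>j. j < r \<Longrightarrow> 2 \<le> a j"
begin

text \<open>Each spider is folded to a line: the leg \<open>1\<close> becomes the negative half, all
  other legs lie over the positive half.\<close>

definition signed :: "(nat \<Rightarrow> nat \<Rightarrow> real) \<Rightarrow> nat \<Rightarrow> real" where
  "signed y j = (if j < r then (\<Sum>i\<in>{2..a j}. y j i) - y j 1 else 0)"

text \<open>The path from \<open>z\<close> to \<open>shrink z * z - shift z * (1, \<dots>, 1)\<close> avoids the origin, since \<open>shift\<close>
  vanishes only on nonnegative multiples of \<open>(1, \<dots>, 1)\<close>; if some coordinate of \<open>z\<close> is not
  positive, then \<open>shrink z = 0\<close> and its end point has the direction of the base point.\<close>

definition shrink :: "(nat \<Rightarrow> real) \<Rightarrow> real" where "shrink z = (\<Prod>j<r. max 0 (z j))"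

definition shift :: "(nat \<Rightarrow> real) \<Rightarrow> real" where
  "shift z = (\<Sum>j<r. \<bar>z j - z 0\<bar> + max 0 (- z j))"

definition path :: "real \<Rightarrow> (nat \<Rightarrow> real) \<Rightarrow> nat \<Rightarrow> real" where
  "path t z j = (if j < r then (1 - t + t * shrink z) * z j - t * shift z else 0)"

lemma shrink_nonneg: "0 \<le> shrink z" unfolding shrink_def by (simp add: prod_nonneg)
lemma shift_nonneg: "0 \<le> shift z" unfolding shift_def by (simp add: sum_nonneg)

text \<open>At a zero of the path, \<open>\<alpha> * z\<close> is the constant vector
  \<open>\<beta>\<close>. If \<open>\<alpha> > 0\<close>, then \<open>z\<close> is a nonnegative
  multiple of \<open>(1, ..., 1)\<close>, so \<open>shift z\<close>, \<open>\<beta>\<close> and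
  finally \<open>z\<close> vanish. If \<open>\<alpha> = 0\<close>, then \<open>t = 1\<close> and
  both \<open>shrink z\<close> and \<open>shift z\<close> are zero: \<open>z\<close> is such a
  multiple with a coordinate that is not positive, hence zero.\<close>

lemma path_nonzero:
  assumes "k < r" "z k \<noteq> 0" "0 \<le> t" "t \<le> 1"
  shows "\<exists>j<r. path t z j \<noteq> 0"
proof (rule ccontr)
  define \<alpha> where "\<alpha> = 1 - t + t * shrink z"
  define \<beta> where "\<beta> = t * shift z"
  assume "\<not> ?thesis"
  then have eq: "\<alpha> * z j = \<beta>" if "j < r" for j using that by (simp add: path_def \<alpha>_def \<beta>_def)
  have ts: "0 \<le> t * shrink z" using assms shrink_nonneg by simp
  then have \<alpha>: "0 \<le> \<alpha>" using assms unfolding \<alpha>_def by linarith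
  have \<beta>: "0 \<le> \<beta>" using assms shift_nonneg unfolding \<beta>_def by simp
  show False
  proof (cases "\<alpha> = 0")
    case True
    then have "t = 1" using ts assms unfolding \<alpha>_def by linarith
    then have "shrink z = 0" using True by (simp add: \<alpha>_def)
    have "shift z = 0" using eq[OF r] True \<open>t = 1\<close> unfolding \<beta>_def by simp
    then have "\<forall>j\<in>{..<r}. \<bar>z j - z 0\<bar> + max 0 (- z j) = 0"
      unfolding shift_def by (subst (asm) sum_nonneg_eq_0_iff) auto
    then have 1: "z j = z 0 \<and> 0 \<le> z j" if "j < r" for j
      using that by (smt (verit) lessThan_iff)
    obtain j where "j < r" "max 0 (z j) = 0"
      using \<open>shrink z = 0\<close> unfolding shrink_def by auto
    then show False using 1[of j] 1[of k] assms by auto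
  next
    case False
    then have z: "z j = \<beta> / \<alpha>" if "j < r" for j using eq[OF that] by (simp add: field_simps)
    then have "\<bar>z j - z 0\<bar> + max 0 (- z j) = 0" if "j < r" for j
      using z[OF r] z[OF that] \<alpha> \<beta> by simp
    then have "shift z = 0" unfolding shift_def by simp
    then have "\<beta> = 0" by (simp add: \<beta>_def)
    then show False using z[OF assms(1)] assms by simp
  qed
qed

text \<open>A linear involution taking the direction \<open>(-1, \<dots>, -1)\<close>, where the collapse happens, to
  the base point.\<close>

definition flip :: "(nat \<Rightarrow> real) \<Rightarrow> nat \<Rightarrow> real" where
  "flip z j = (if j < r then if j = 0 then - z 0 else z j - z 0 else 0)"

section \<open>Directions and the unit sphere\<close>

definition radius :: "(nat \<Rightarrow> real) \<Rightarrow> real" where "radius z = sqrt (\<Sum>j<r. (z j)\<^sup>2)"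

definition nrm :: "(nat \<Rightarrow> real) \<Rightarrow> nat \<Rightarrow> real" where "nrm z j = z j / radius z"

definition vecs :: "(nat \<Rightarrow> real) set" where "vecs = {z. (\<forall>j\<ge>r. z j = 0) \<and> (\<exists>j<r. z j \<noteq> 0)}"

definition sph :: "(nat \<Rightarrow> real) set" where
  "sph = {w. (\<Sum>i<r. (w i)\<^sup>2) = 1 \<and> (\<forall>i\<ge>r. w i = 0)}"

lemma radius_pos: assumes "z \<in> vecs" shows "0 < radius z"
proof -
  obtain j where "j < r" "z j \<noteq> 0" using assms by (auto simp: vecs_def)
  then have "0 < (\<Sum>j<r. (z j)\<^sup>2)" by (intro sum_pos2[of _ j]) auto
  then show ?thesis by (simp add: radius_def)
qed

lemma nrm_sph: assumes "z \<in> vecs" shows "nrm z \<in> sph"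
proof -
  have "(\<Sum>j<r. (nrm z j)\<^sup>2) = (\<Sum>j<r. (z j)\<^sup>2) / (radius z)\<^sup>2"
    by (simp add: nrm_def power_divide sum_divide_distrib)
  also have "\<dots> = 1" using radius_pos[OF assms] by (simp add: radius_def sum_nonneg)
  finally show ?thesis using assms by (auto simp: sph_def nrm_def vecs_def)
qed

lemma sph_vecs: assumes "w \<in> sph" shows "w \<in> vecs"
proof -
  have "\<exists>j<r. w j \<noteq> 0"
  proof (rule ccontr)
    assume "\<not> ?thesis"
    then have "(\<Sum>i<r. (w i)\<^sup>2) = 0" by simp
    then show False using assms by (simp add: sph_def)
  qed
  then show ?thesis using assms by (simp add: sph_def vecs_def)
qed

lemma nrm_id: "w \<in> sph \<Longrightarrow> nrm w = w"
  by (simp add: nrm_def sph_def radius_def fun_eq_iff)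

lemma flip_flip: "z \<in> vecs \<Longrightarrow> flip (flip z) = z"
  using r by (auto simp: flip_def fun_eq_iff vecs_def)

lemma flip_vecs: assumes "z \<in> vecs" shows "flip z \<in> vecs"
proof -
  have "\<exists>j<r. flip z j \<noteq> 0"
  proof (rule ccontr)
    assume "\<not> ?thesis"
    then have 0: "flip z j = 0" if "j < r" for j using that by auto
    then have "z 0 = 0" using r 0[of 0] by (simp add: flip_def)
    then have "z j = 0" if "j < r" for j using 0[OF that] that by (auto simp: flip_def split: if_splits)
    then show False using assms by (auto simp: vecs_def)
  qed
  then show ?thesis by (auto simp: vecs_def flip_def)
qed

lemma path_vecs: assumes "z \<in> vecs" "t \<in> {0..1}" shows "path t z \<in> vecs"
proof -
  obtain k where "k < r" "z k \<noteq> 0" using assms(1) by (auto simp: vecs_def)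
  then have "\<exists>j<r. path t z j \<noteq> 0" using path_nonzero assms(2) by simp
  then show ?thesis by (simp add: vecs_def path_def)
qed

lemma path_0: "z \<in> vecs \<Longrightarrow> path 0 z = z"
  by (auto simp: path_def vecs_def fun_eq_iff)

lemma nrm_scale: "0 < c \<Longrightarrow> nrm (\<lambda>j. c * z j) = nrm z"
  by (simp add: nrm_def radius_def fun_eq_iff power_mult_distrib sum_distrib_left[symmetric] real_sqrt_mult)

lemma sphere_basepoint_sph: "sphere_basepoint \<in> sph"
proof -
  have "(\<Sum>i<r. (sphere_basepoint i)\<^sup>2) = (\<Sum>i<r. if i = 0 then 1 else 0)"
    by (intro sum.cong) (auto simp: sphere_basepoint_def)
  then show ?thesis using r by (simp add: sph_def sphere_basepoint_def)
qed

lemma base_vec: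
  assumes "z \<in> vecs" "\<And>j. j < r \<Longrightarrow> z j = - c" "0 \<le> c"
  shows "nrm (flip z) = sphere_basepoint"
proof -
  have "0 < c" using assms by (auto simp: vecs_def)
  have "flip z = (\<lambda>j. c * sphere_basepoint j)"
    using assms(2) r by (auto simp: flip_def sphere_basepoint_def fun_eq_iff)
  then show ?thesis using nrm_scale[OF \<open>0 < c\<close>] nrm_id[OF sphere_basepoint_sph] by simp
qed

lemma flip_basepoint: "flip sphere_basepoint = (\<lambda>j. if j < r then -1 else 0)"
  by (auto simp: flip_def sphere_basepoint_def)

text \<open>A coordinate that is not positive kills the product \<open>shrink z\<close> and leaves
  only the shift. This is the collapse of everything lying on a first leg.\<close>

lemma shrink_zero_base:
  assumes "z \<in> vecs" "j < r" "z j \<le> 0"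
  shows "nrm (flip (path 1 z)) = sphere_basepoint"
proof (rule base_vec)
  show "path 1 z \<in> vecs" using assms path_vecs by simp
  have "shrink z = 0" unfolding shrink_def using assms by (intro prod_zero bexI[of _ j]) auto
  then show "path 1 z k = - shift z" if "k < r" for k using that by (simp add: path_def)
qed (rule shift_nonneg)

text \<open>A homotopy of the sphere from the identity to the map by which collapse after inclusion
  acts on each sphere. It fixes the base point and so descends to the wedge.\<close>

definition rot :: "real \<Rightarrow> (nat \<Rightarrow> real) \<Rightarrow> nat \<Rightarrow> real" where
  "rot t w = nrm (flip (path t (flip w)))"

lemma rot_sph: "w \<in> sph \<Longrightarrow> t \<in> {0..1} \<Longrightarrow> rot t w \<in> sph"
  unfolding rot_def by (intro nrm_sph flip_vecs path_vecs sph_vecs)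

lemma rot_0: "w \<in> sph \<Longrightarrow> rot 0 w = w"
  using flip_vecs[OF sph_vecs] path_0 flip_flip sph_vecs nrm_id by (simp add: rot_def)

text \<open>The path of \<open>(-1, ..., -1)\<close> stays on its own ray.\<close>

lemma rot_base: assumes "t \<in> {0..1}" shows "rot t sphere_basepoint = sphere_basepoint"
  unfolding rot_def
proof (rule base_vec)
  let ?z = "flip sphere_basepoint"
  show "path t ?z \<in> vecs" by (intro path_vecs flip_vecs sph_vecs sphere_basepoint_sph assms)
  show "path t ?z j = - (1 - t + t * shrink ?z + t * shift ?z)" if "j < r" for j
    using that by (simp add: path_def flip_basepoint)
  have "0 \<le> t * shrink ?z" "0 \<le> t * shift ?z" using assms shrink_nonneg shift_nonneg by auto
  then show "0 \<le> 1 - t + t * shrink ?z + t * shift ?z" using assms by auto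
qed

section \<open>The product as a union of copies of Euclidean space\<close>

definition emb :: "(nat \<Rightarrow> nat) \<Rightarrow> (nat \<Rightarrow> real) \<Rightarrow> nat \<Rightarrow> nat \<Rightarrow> real" where
  "emb i z j k = (if j < r then if k = 1 then max 0 (- z j) else if k = i j then max 0 (z j) else 0 else 0)"

definition multi :: "(nat \<Rightarrow> nat) set" where "multi = (\<Pi>\<^sub>E j\<in>{..<r}. {2..a j})"

text \<open>For \<open>i \<in> multi\<close>, one leg beyond the first is selected in each factor.
  The piece is then a copy of Euclidean space of dimension \<open>r\<close>, with
  \<open>signed\<close> and \<open>emb i\<close> as inverse coordinates.\<close>

definition piece :: "(nat \<Rightarrow> nat) \<Rightarrow> (nat \<Rightarrow> nat \<Rightarrow> real) set" where
  "piece i = {y \<in> spiders r a. \<forall>j k. j < r \<and> k \<noteq> 1 \<and> k \<noteq> i j \<longrightarrow> y j k = 0}"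

lemma multiD: "i \<in> multi \<Longrightarrow> j < r \<Longrightarrow> i j \<in> {2..a j}"
  using PiE_mem[of i "{..<r}" "\<lambda>j. {2..a j}" j] unfolding multi_def by simp

lemma emb_piece: assumes "i \<in> multi" shows "emb i z \<in> piece i"
proof -
  have "emb i z j \<in> spider (a j)" if "j < r" for j
    using multiD[OF assms that] that a[OF that] by (auto simp: spider_def emb_def split: if_splits)
  then show ?thesis by (auto simp: piece_def spiders_def emb_def)
qed

lemma signed_piece:
  assumes "i \<in> multi" "y \<in> piece i" "j < r"
  shows "signed y j = y j (i j) - y j 1"
proof -
  have "(\<Sum>k\<in>{2..a j}. y j k) = (\<Sum>k\<in>{2..a j}. if k = i j then y j k else 0)"
    using assms by (intro sum.cong) (auto simp: piece_def)
  also have "\<dots> = y j (i j)" using multiD[OF assms(1,3)] by (simp add: sum.delta)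
  finally show ?thesis using assms by (simp add: signed_def)
qed

lemma emb_signed:
  assumes i: "i \<in> multi" and y: "y \<in> piece i"
  shows "emb i (signed y) = y"
proof (intro ext)
  fix j k
  show "emb i (signed y) j k = y j k"
  proof (cases "j < r")
    case True
    have s: "y j \<in> spider (a j)" using y True by (auto simp: piece_def spiders_def)
    have "i j \<noteq> 1" using multiD[OF i True] by auto
    then have "y j (i j) = 0 \<or> y j 1 = 0" "0 \<le> y j (i j)" "0 \<le> y j 1"
      using s unfolding spider_def by auto
    then show ?thesis using True y signed_piece[OF i y True] by (auto simp: emb_def piece_def)
  next
    case False
    then show ?thesis using y by (auto simp: emb_def piece_def spiders_def)
  qed
qed

lemma ex_piece:
  assumes y: "y \<in> spiders r a"
  obtains i where "i \<in> multi" "y \<in> piece i"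
proof -
  have "\<exists>k\<in>{2..a j}. \<forall>k'. k' \<noteq> 1 \<and> k' \<noteq> k \<longrightarrow> y j k' = 0" if "j < r" for j
  proof -
    have s: "y j \<in> spider (a j)" using y that by (auto simp: spiders_def)
    show ?thesis
    proof (cases "\<exists>k. k \<noteq> 1 \<and> y j k \<noteq> 0")
      case True
      then obtain k where k: "k \<noteq> 1" "y j k \<noteq> 0" by blast
      then have "k \<in> {1..a j}" using s by (simp add: spider_def)
      then have "k \<in> {2..a j}" using k(1) by auto
      moreover have "\<forall>k'. k' \<noteq> 1 \<and> k' \<noteq> k \<longrightarrow> y j k' = 0" using s k unfolding spider_def by blast
      ultimately show ?thesis by blast
    next
      case False
      \<comment> \<open>Here \<open>y j\<close> lies on the leg \<open>1\<close> or at the centre,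
        so any further leg will do; \<open>2\<close> is one because
        \<open>2 \<le> a j\<close>.\<close>
      then show ?thesis using a[OF that] by (intro bexI[of _ 2]) auto
    qed
  qed
  then obtain i where "\<And>j. j < r \<Longrightarrow> i j \<in> {2..a j} \<and> (\<forall>k'. k' \<noteq> 1 \<and> k' \<noteq> i j \<longrightarrow> y j k' = 0)"
    by metis
  then show thesis using y
    by (intro that[of "restrict i {..<r}"]) (auto simp: multi_def piece_def)
qed

lemma signed_vecs:
  assumes "y \<in> spiders r a" "y \<noteq> (\<lambda>_ _. 0)"
  shows "signed y \<in> vecs"
proof -
  obtain i where i: "i \<in> multi" "y \<in> piece i" using ex_piece assms(1) by blast
  have "\<exists>j<r. signed y j \<noteq> 0"
  proof (rule ccontr)
    assume "\<not> ?thesis"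
    then have "emb i (signed y) = (\<lambda>_ _. 0)" by (auto simp: emb_def fun_eq_iff)
    then show False using emb_signed[OF i] assms by simp
  qed
  then show ?thesis by (auto simp: vecs_def signed_def)
qed

lemma signed_emb: assumes "i \<in> multi" "z \<in> vecs" shows "signed (emb i z) = z"
proof
  fix j
  show "signed (emb i z) j = z j"
  proof (cases "j < r")
    case True
    then show ?thesis using signed_piece[OF assms(1) emb_piece[OF assms(1)] True] multiD[OF assms(1) True]
      by (auto simp: emb_def)
  next
    case False
    then show ?thesis using assms by (simp add: signed_def vecs_def)
  qed
qed

lemma emb_nonzero: assumes "i \<in> multi" "z \<in> vecs" shows "emb i z \<noteq> (\<lambda>_ _. 0)"
proof
  assume "emb i z = (\<lambda>_ _. 0)"
  then have "signed (emb i z) = (\<lambda>_. 0)" by (simp add: signed_def fun_eq_iff)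
  then show False using signed_emb[OF assms] assms(2) by (auto simp: vecs_def)
qed

text \<open>In a factor where the two choices differ, the point lies on the leg \<open>1\<close> or
  at the centre. Its signed coordinate is not positive there, so it collapses to the base point: the
  map to the wedge is well defined.\<close>

lemma piece_overlap:
  assumes "i \<in> multi" "i' \<in> multi" "i \<noteq> i'" "y \<in> piece i" "y \<in> piece i'" "y \<noteq> (\<lambda>_ _. 0)"
  shows "nrm (flip (path 1 (signed y))) = sphere_basepoint"
proof -
  obtain j where j: "j < r" "i j \<noteq> i' j"
    using assms(1-3) unfolding multi_def by (metis PiE_ext lessThan_iff)
  have "i j \<noteq> 1" using multiD[OF assms(1) j(1)] by auto
  then have "y j (i j) = 0" using assms(5) j unfolding piece_def by blast
  moreover have "0 \<le> y j 1" using assms(4) j by (auto simp: piece_def spiders_def spider_def)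
  ultimately have "signed y j \<le> 0" using signed_piece[OF assms(1,4) j(1)] by simp
  then show ?thesis using shrink_zero_base signed_vecs assms j by (auto simp: piece_def)
qed

lemma continuous_path:
  assumes "continuous_on X f" "\<And>j. continuous_on X (\<lambda>x. g x j)"
  shows "continuous_on X (\<lambda>x. path (f x) (g x) j)"
  unfolding path_def shrink_def shift_def
  by (intro continuous_on_if_const continuous_intros assms)

lemma continuous_flip:
  assumes "\<And>j. continuous_on X (\<lambda>x. g x j)"
  shows "continuous_on X (\<lambda>x. flip (g x) j)"
  unfolding flip_def by (intro continuous_on_if_const continuous_intros assms)

lemma continuous_radius:
  assumes "\<And>j. continuous_on X (\<lambda>x. g x j)"
  shows "continuous_on X (\<lambda>x. radius (g x))"
  unfolding radius_def by (intro continuous_intros assms)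

lemma continuous_nrm:
  assumes "\<And>j. continuous_on X (\<lambda>x. g x j)" "\<And>x. x \<in> X \<Longrightarrow> g x \<in> vecs"
  shows "continuous_on X (\<lambda>x. nrm (g x) j)"
  unfolding nrm_def using radius_pos[OF assms(2)]
  by (intro continuous_on_divide continuous_radius assms(1)) force

lemma continuous_signed: "continuous_on X (\<lambda>y. signed y j)"
  unfolding signed_def by (intro continuous_on_if_const continuous_on_diff continuous_on_sum
      continuous_on_const continuous_on_apply2)

lemma continuous_signed_snd: "continuous_on X (\<lambda>p. signed (snd p) j)"
  unfolding signed_def by (intro continuous_on_if_const continuous_on_diff continuous_on_sum
      continuous_on_const continuous_on_snd_apply2)

lemma nsphere_sph: "nsphere (r - 1) = top_of_set sph"
proof -
  have "{..r - 1} = {..<r}" using r by auto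
  moreover have "(\<forall>i>r - 1. x i = 0) \<longleftrightarrow> (\<forall>i\<ge>r. x i = 0)" for x :: "nat \<Rightarrow> real" using r by auto
  ultimately show ?thesis by (simp add: nsphere sph_def euclidean_product_topology)
qed

text \<open>No rescaling at \<open>t = 0\<close>; at \<open>t = 1\<close> the factor that makes the
  flipped end point a unit vector, so that the homotopy ends exactly in the image of the
  wedge.\<close>

definition gauge :: "real \<Rightarrow> (nat \<Rightarrow> nat \<Rightarrow> real) \<Rightarrow> real" where
  "gauge t y = 1 - t + t / radius (flip (path 1 (signed y)))"

text \<open>The rescaled path, written without naming a piece: on legs \<open>k \<noteq> 1\<close>
  with \<open>y j k = 0\<close> the maximum is \<open>0\<close> by itself. Continuity is thus
  visible from the formula and needs no pasting.\<close>

definition push :: "real \<Rightarrow> (nat \<Rightarrow> nat \<Rightarrow> real) \<Rightarrow> nat \<Rightarrow> nat \<Rightarrow> real" where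
  "push t y j k = (if j < r then
     if k = 1 then max 0 (- (gauge t y * path t (signed y) j))
     else max 0 (gauge t y * ((1 - t + t * shrink (signed y)) * y j k - t * shift (signed y)))
   else 0)"

lemma gauge_pos:
  assumes "y \<in> spiders r a" "y \<noteq> (\<lambda>_ _. 0)" "t \<in> {0..1}"
  shows "0 < gauge t y"
proof -
  have "0 < radius (flip (path 1 (signed y)))"
    using assms by (intro radius_pos flip_vecs path_vecs signed_vecs) auto
  then have "0 < 1 / radius (flip (path 1 (signed y)))" by simp
  then have "0 < (1 - t) * 1 + t * (1 / radius (flip (path 1 (signed y))))"
    using assms(3) by (cases "t = 0") (auto intro!: add_nonneg_pos)
  then show ?thesis by (simp add: gauge_def)
qed

lemma push_emb:
  assumes i: "i \<in> multi" and y: "y \<in> piece i" "y \<noteq> (\<lambda>_ _. 0)" and t: "t \<in> {0..1}"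
  shows "push t y = emb i (\<lambda>j. gauge t y * path t (signed y) j)"
proof (intro ext)
  fix j k
  define \<alpha> where "\<alpha> = 1 - t + t * shrink (signed y)"
  define \<beta> where "\<beta> = t * shift (signed y)"
  have \<alpha>: "0 \<le> \<alpha>" unfolding \<alpha>_def using t shrink_nonneg[of "signed y"] by (simp add: add_nonneg_nonneg)
  have \<beta>: "0 \<le> \<beta>" unfolding \<beta>_def using t shift_nonneg[of "signed y"] by simp
  have g: "0 < gauge t y" using gauge_pos y t by (auto simp: piece_def)
  have push: "push t y j k = (if j < r then if k = 1 then max 0 (- (gauge t y * path t (signed y) j))
     else max 0 (gauge t y * (\<alpha> * y j k - \<beta>)) else 0)"
    by (simp add: push_def \<alpha>_def \<beta>_def)
  have neg: "max 0 (gauge t y * (\<alpha> * x - \<beta>)) = 0" if "x \<le> 0" for x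
  proof -
    have "\<alpha> * x \<le> 0" using \<alpha> that by (simp add: mult_nonneg_nonpos)
    then have "gauge t y * (\<alpha> * x - \<beta>) \<le> 0" using \<beta> g by (intro mult_nonneg_nonpos) auto
    then show ?thesis by simp
  qed
  show "push t y j k = emb i (\<lambda>j. gauge t y * path t (signed y) j) j k"
  proof (cases "j < r \<and> k \<noteq> 1")
    case True
    then have s: "y j \<in> spider (a j)" using y by (auto simp: piece_def spiders_def)
    have i1: "i j \<noteq> 1" using multiD[OF i, of j] True by auto
    show ?thesis
    proof (cases "k = i j")
      case k: True
      have p: "path t (signed y) j = \<alpha> * (y j k - y j 1) - \<beta>"
        using True signed_piece[OF i y(1), of j] k by (simp add: path_def \<alpha>_def \<beta>_def)
      show ?thesis
      proof (cases "y j 1 = 0")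
        case True
        then show ?thesis using p push \<open>j < r \<and> k \<noteq> 1\<close> k i1 by (simp add: emb_def)
      next
        case False
        then have "y j k = 0" "0 \<le> y j 1" using s i1 k by (auto simp: spider_def)
        then show ?thesis using p push True k i1 neg[of 0] neg[of "- y j 1"] by (simp add: emb_def)
      qed
    next
      case False
      then have "y j k = 0" using True y by (simp add: piece_def)
      then show ?thesis using push neg[of 0] True False by (simp add: emb_def)
    qed
  qed (auto simp: push emb_def)
qed

text \<open>The map \<open>e\<close> puts each sphere into its own piece; \<open>q\<close> sends a
  point to the direction in which its path ends, on the sphere of a piece containing it. The
  homotopies from the identity to \<open>e \<circ> q\<close> and \<open>q \<circ> e\<close> are
  \<open>push\<close> and \<open>rot\<close>.\<close>

theorem spiders_wedge:
  "top_of_set (spiders r a - {\<lambda>_ _. 0}) homotopy_equivalent_space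
     wedge_of_spheres (\<Prod>j<r. a j - 1) (int r - 1)"
proof -
  define N where "N = (\<Prod>j<r. a j - 1)"
  define P where "P = spiders r a - {\<lambda>_ _. 0}"
  have fin: "finite multi" unfolding multi_def by (intro finite_PiE) auto
  have "card multi = (\<Prod>j<r. card {2..a j})" unfolding multi_def by (subst card_PiE) auto
  also have "\<dots> = N" unfolding N_def by (intro prod.cong) auto
  finally have "card multi = N" .
  then obtain b where b: "bij_betw b {..<N} multi"
    using ex_bij_betw_nat_finite[OF fin] by (auto simp: atLeast0LessThan)
  have bm: "b n \<in> multi" if "n < N" for n using b that by (auto simp: bij_betw_def)
  define R where "R = (\<lambda>(i::nat, x) (k::nat, y). x = sphere_basepoint \<and> y = sphere_basepoint)"
  define X where "X = sum_topology (\<lambda>_. top_of_set sph) {..<N}"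
  define W where "W = quotient_space X R"
  define pt where "pt = glue_class X R"
  have W: "wedge_of_spheres N (int r - 1) = W"
  proof -
    have "sphere_space (int r - 1) = top_of_set sph"
      using r nsphere_sph by (simp add: sphere_space_def nat_diff_distrib)
    then show ?thesis by (simp add: wedge_of_spheres_def wedge_def W_def X_def R_def)
  qed
  have tX: "topspace X = {..<N} \<times> sph" by (auto simp: X_def)
  have qm: "quotient_map X W pt" unfolding W_def pt_def by (rule quotient_map_glue_class)
  have pt_base: "pt (n, sphere_basepoint) = pt (n', sphere_basepoint)" if "n < N" "n' < N" for n n'
    unfolding pt_def using that sphere_basepoint_sph by (intro glue_class_eqI) (auto simp: tX R_def)
  have inj: "continuous_map (top_of_set sph) X (\<lambda>w. (n, w))" if "n < N" for n
    unfolding X_def using that by (intro continuous_map_component_injection) auto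

  have embP: "emb (b n) z \<in> P" "emb (b n) z \<in> piece (b n)" if "n < N" "z \<in> vecs" for n z
    using emb_piece[OF bm[OF that(1)], of z] emb_nonzero[OF bm[OF that(1)] that(2)]
    by (simp_all add: P_def piece_def)

  define e0 where "e0 = (\<lambda>(n, w). emb (b n) (flip w))"
  have e0: "continuous_map X (top_of_set P) e0"
    unfolding X_def
  proof (rule continuous_map_from_sum_topology)
    fix n assume n: "n \<in> {..<N}"
    have "continuous_on sph (\<lambda>w. emb (b n) (flip w))"
      unfolding emb_def
      by (intro continuous_on_coordinatewise_then_product continuous_on_if_const continuous_on_max
          continuous_on_minus continuous_on_const continuous_flip continuous_on_apply)
    moreover have "emb (b n) (flip w) \<in> P" if "w \<in> sph" for w
      using n by (intro embP flip_vecs sph_vecs that) simp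
    ultimately show "continuous_map (top_of_set sph) (top_of_set P) (\<lambda>x. e0 (n, x))"
      by (auto simp: e0_def)
  qed
  have e0R: "e0 x = e0 y" if "x \<in> topspace X" "y \<in> topspace X" "R x y" for x y
  proof -
    \<comment> \<open>The flipped base point is \<open>(-1, ..., -1)\<close>: all coordinates lie on
      the leg \<open>1\<close>, where the multi-index has no influence.\<close>
    have "emb i (flip sphere_basepoint) = (\<lambda>j k. if j < r \<and> k = 1 then 1 else 0)" for i
      by (auto simp: emb_def flip_basepoint fun_eq_iff)
    then show ?thesis using that by (auto simp: R_def e0_def split: prod.splits)
  qed
  obtain e where e: "continuous_map W (top_of_set P) e" "\<And>x. x \<in> topspace X \<Longrightarrow> e (pt x) = e0 x"
  proof (rule quotient_map_lift_exists[OF qm e0])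
    show "e0 x = e0 y" if "pt x = pt y" for x y
      using glue_class_respects[of X R e0, OF e0R] that unfolding pt_def by blast
  qed (use that in blast)

  define f where "f n y = pt (n, nrm (flip (path 1 (signed y))))" for n y
  \<comment> \<open>An arbitrary choice, harmless because overlaps of pieces are sent to the base
    point.\<close>
  define leg where "leg y = (SOME n. n < N \<and> y \<in> piece (b n))" for y
  have leg: "leg y < N" "y \<in> piece (b (leg y))" if "y \<in> P" for y
  proof -
    have "y \<in> spiders r a" using that by (simp add: P_def)
    then obtain i where "i \<in> multi" "y \<in> piece i" by (rule ex_piece)
    moreover from this have "i \<in> b ` {..<N}" using b by (simp add: bij_betw_def)
    ultimately obtain n where "n < N" "y \<in> piece (b n)" by blast
    then have "leg y < N \<and> y \<in> piece (b (leg y))" 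
      unfolding leg_def by (intro someI[of "\<lambda>n. n < N \<and> y \<in> piece (b n)" n]) simp
    then show "leg y < N" "y \<in> piece (b (leg y))" by auto
  qed
  have dir: "nrm (flip (path 1 (signed y))) \<in> sph" if "y \<in> P" for y
    using that by (intro nrm_sph flip_vecs path_vecs signed_vecs) (auto simp: P_def)
  define q where "q y = f (leg y) y" for y
  have q: "continuous_map (top_of_set P) W q"
  proof (rule pasting_lemma_closed[where I = "{..<N}" and T = "\<lambda>n. piece (b n) \<inter> P" and f = f])
    show "finite {..<N}" by simp
    fix n assume n: "n \<in> {..<N}"
    have "closed {y :: nat \<Rightarrow> nat \<Rightarrow> real. \<forall>j k. j < r \<and> k \<noteq> 1 \<and> k \<noteq> b n j \<longrightarrow> y j k = 0}"
      by (intro closed_Collect_all closed_Collect_imp closed_Collect_eq continuous_on_apply2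
          continuous_on_const) simp
    then have "closedin (top_of_set P) (P \<inter> {y. \<forall>j k. j < r \<and> k \<noteq> 1 \<and> k \<noteq> b n j \<longrightarrow> y j k = 0})"
      by (rule closedin_closed_Int)
    also have "P \<inter> {y. \<forall>j k. j < r \<and> k \<noteq> 1 \<and> k \<noteq> b n j \<longrightarrow> y j k = 0} = piece (b n) \<inter> P"
      by (auto simp: P_def piece_def)
    finally show "closedin (top_of_set P) (piece (b n) \<inter> P)" .
    have "continuous_on (piece (b n) \<inter> P) (\<lambda>y. nrm (flip (path 1 (signed y))))"
    proof (intro continuous_on_coordinatewise_then_product continuous_nrm continuous_flip continuous_path
          continuous_signed continuous_on_const)
      show "flip (path 1 (signed y)) \<in> vecs" if "y \<in> piece (b n) \<inter> P" for y
        using that by (intro flip_vecs path_vecs signed_vecs) (auto simp: P_def)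
    qed
    then have "continuous_map (top_of_set (piece (b n) \<inter> P)) (top_of_set sph) (\<lambda>y. nrm (flip (path 1 (signed y))))"
      using dir by auto
    then have "continuous_map (top_of_set (piece (b n) \<inter> P)) W (pt \<circ> ((\<lambda>w. (n, w)) \<circ> (\<lambda>y. nrm (flip (path 1 (signed y))))))"
      using n by (intro continuous_map_compose[OF _ quotient_imp_continuous_map[OF qm]]
          continuous_map_compose[OF _ inj]) auto
    then show "continuous_map (subtopology (top_of_set P) (piece (b n) \<inter> P)) W (f n)"
      by (simp add: f_def[abs_def] o_def subtopology_subtopology Int_absorb1)
  next
    fix n n' y assume n: "n \<in> {..<N}" "n' \<in> {..<N}"
      and y: "y \<in> topspace (top_of_set P) \<inter> (piece (b n) \<inter> P) \<inter> (piece (b n') \<inter> P)"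
    show "f n y = f n' y"
    proof (cases "n = n'")
      case False
      then have "b n \<noteq> b n'" using b n by (auto simp: bij_betw_def inj_on_def)
      then have "nrm (flip (path 1 (signed y))) = sphere_basepoint"
        using piece_overlap[of "b n" "b n'" y] bm n y by (auto simp: P_def)
      then show ?thesis using pt_base[of n n'] n by (simp add: f_def)
    qed simp
  next
    fix y assume "y \<in> topspace (top_of_set P)"
    then show "\<exists>n. n \<in> {..<N} \<and> y \<in> piece (b n) \<inter> P \<and> q y = f n y"
      using leg by (intro exI[of _ "leg y"]) (auto simp: q_def)
  qed

  have eq: "homotopic_with_canon (\<lambda>_. True) P P id (e \<circ> q)"
  proof (subst homotopic_with)
    have nz: "\<forall>p\<in>{0..1::real} \<times> P. radius (flip (path 1 (signed (snd p)))) \<noteq> 0"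
    proof
      fix p :: "real \<times> (nat \<Rightarrow> nat \<Rightarrow> real)" assume "p \<in> {0..1} \<times> P"
      then have "flip (path 1 (signed (snd p))) \<in> vecs"
        by (intro flip_vecs path_vecs signed_vecs) (auto simp: P_def)
      then show "radius (flip (path 1 (signed (snd p)))) \<noteq> 0" using radius_pos by force
    qed
    have cp: "continuous_on ({0..1} \<times> P) (\<lambda>p. push (fst p) (snd p))"
      unfolding push_def gauge_def shrink_def shift_def
      by (intro continuous_on_coordinatewise_then_product continuous_on_if_const continuous_on_max
          continuous_on_const continuous_on_minus continuous_on_mult continuous_on_add continuous_on_diff
          continuous_on_divide continuous_on_fst continuous_on_id continuous_radius continuous_flip
          continuous_path continuous_signed_snd continuous_on_sum continuous_on_prod continuous_on_rabs
          continuous_on_snd_apply2 nz)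
    have in_P: "push t y \<in> P" if "t \<in> {0..1}" "y \<in> P" for t y
    proof -
      have y: "y \<in> spiders r a" "y \<noteq> (\<lambda>_ _. 0)" using that by (auto simp: P_def)
      then have v: "path t (signed y) \<in> vecs" using path_vecs signed_vecs that by blast
      have "(\<lambda>j. gauge t y * path t (signed y) j) \<in> vecs"
        using v gauge_pos[OF y that(1)] unfolding vecs_def by auto
      then show ?thesis
        using push_emb[OF bm[OF leg(1)[OF that(2)]] leg(2)[OF that(2)] y(2) that(1)]
          embP(1)[OF leg(1)[OF that(2)]] by simp
    qed
    have at0: "push 0 y = y" if "y \<in> P" for y
    proof -
      have y: "y \<in> spiders r a" "y \<noteq> (\<lambda>_ _. 0)" using that by (auto simp: P_def)
      show ?thesis
        using push_emb[OF bm[OF leg(1)[OF that]] leg(2)[OF that] y(2), of 0] path_0[OF signed_vecs[OF y]]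
          emb_signed[OF bm[OF leg(1)[OF that]] leg(2)[OF that]] by (simp add: gauge_def)
    qed
    have at1: "push 1 y = e (q y)" if "y \<in> P" for y
    proof -
      have y: "y \<in> spiders r a" "y \<noteq> (\<lambda>_ _. 0)" using that by (auto simp: P_def)
      let ?u = "path 1 (signed y)"
      have "?u \<in> vecs" using path_vecs[OF signed_vecs[OF y]] by simp
      \<comment> \<open>Linearity of \<open>flip\<close> moves the normalising factor outside, where
        it is \<open>gauge 1 y\<close>.\<close>
      then have "flip (nrm (flip ?u)) = (\<lambda>j. flip (flip ?u) j / radius (flip ?u))"
        by (auto simp: flip_def nrm_def fun_eq_iff diff_divide_distrib)
      then have *: "flip (nrm (flip ?u)) = (\<lambda>j. ?u j / radius (flip ?u))"
        using flip_flip[OF \<open>?u \<in> vecs\<close>] by simp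
      have "e (q y) = e0 (leg y, nrm (flip ?u))"
        unfolding q_def f_def using leg[OF that] dir[OF that] by (intro e(2)) (auto simp: tX)
      also have "\<dots> = emb (b (leg y)) (\<lambda>j. ?u j / radius (flip ?u))"
        by (simp add: e0_def *)
      also have "\<dots> = push 1 y"
        using push_emb[OF bm[OF leg(1)[OF that]] leg(2)[OF that] y(2), of 1] by (simp add: gauge_def)
      finally show ?thesis ..
    qed
    show "\<exists>h. continuous_map (prod_topology (top_of_set {0..1::real}) (top_of_set P)) (top_of_set P) h \<and>
        (\<forall>x\<in>topspace (top_of_set P). h (0, x) = id x) \<and>
        (\<forall>x\<in>topspace (top_of_set P). h (1, x) = (e \<circ> q) x) \<and> (\<forall>t\<in>{0..1::real}. True)"
      by (rule exI[of _ "\<lambda>p. push (fst p) (snd p)"]) (use cp in_P at0 at1 in auto)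
  qed simp

  have qe: "homotopic_with (\<lambda>_. True) W W id (q \<circ> e)"
  proof (subst homotopic_with)
    let ?I = "top_of_set {0..1::real}"
    define k0 where "k0 = (\<lambda>(t, n, w). pt (n, rot t w))"
    \<comment> \<open>Because the interval is locally compact, the product with it preserves the
      quotient map; a homotopy on \<open>X\<close> that respects the gluing then descends to the
      wedge.\<close>
    have "locally_compact_space ?I" "Hausdorff_space ?I"
      by (simp_all add: compact_imp_locally_compact_space compact_space_subtopology Hausdorff_space_subtopology)
    then have qm2: "quotient_map (prod_topology ?I X) (prod_topology ?I W) (\<lambda>(t, x). (t, pt x))"
      by (intro quotient_map_prod_right qm) auto
    have "continuous_on ({0..1} \<times> sph) (\<lambda>p. rot (fst p) (snd p))"
      unfolding rot_def
    proof (intro continuous_on_coordinatewise_then_product continuous_nrm continuous_flip continuous_path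
          continuous_on_fst continuous_on_id continuous_app)
      show "flip (path (fst p) (flip (snd p))) \<in> vecs" if "p \<in> {0..1} \<times> sph" for p
        using that by (intro flip_vecs path_vecs sph_vecs) (auto simp: mem_Times_iff)
    qed
    then have rot: "continuous_map (prod_topology ?I (top_of_set sph)) (top_of_set sph) (\<lambda>p. rot (fst p) (snd p))"
      using rot_sph by auto
    have X: "X = prod_topology (discrete_topology {..<N}) (top_of_set sph)"
      unfolding X_def by (rule sum_topology_const)
    have "continuous_map (prod_topology ?I X) X (\<lambda>p. (fst (snd p), rot (fst p) (snd (snd p))))"
      unfolding X
    proof (rule continuous_map_pairedI)
      show "continuous_map (prod_topology ?I (prod_topology (discrete_topology {..<N}) (top_of_set sph)))
          (discrete_topology {..<N}) (\<lambda>p. fst (snd p))"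
        by (rule continuous_map_compose[OF continuous_map_snd continuous_map_fst, unfolded o_def])
      have "continuous_map (prod_topology ?I (prod_topology (discrete_topology {..<N}) (top_of_set sph)))
          (prod_topology ?I (top_of_set sph)) (\<lambda>p. (fst p, snd (snd p)))"
        by (intro continuous_map_pairedI continuous_map_fst
            continuous_map_compose[OF continuous_map_snd continuous_map_snd, unfolded o_def])
      from continuous_map_compose[OF this rot]
      show "continuous_map (prod_topology ?I (prod_topology (discrete_topology {..<N}) (top_of_set sph)))
          (top_of_set sph) (\<lambda>p. rot (fst p) (snd (snd p)))" by (simp add: o_def)
    qed
    from continuous_map_compose[OF this quotient_imp_continuous_map[OF qm]]
    have k0: "continuous_map (prod_topology ?I X) W k0"
      by (simp add: k0_def o_def case_prod_unfold)
    obtain k where k: "continuous_map (prod_topology ?I W) W k"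
        "\<And>p. p \<in> topspace (prod_topology ?I X) \<Longrightarrow> k (case p of (t, x) \<Rightarrow> (t, pt x)) = k0 p"
    proof (rule quotient_map_lift_exists[OF qm2 k0])
      fix p p' assume p: "p \<in> topspace (prod_topology ?I X)" "p' \<in> topspace (prod_topology ?I X)"
        and eq: "(case p of (t, x) \<Rightarrow> (t, pt x)) = (case p' of (t, x) \<Rightarrow> (t, pt x))"
      obtain t x x' where pp: "p = (t, x)" "p' = (t, x')" "pt x = pt x'" "t \<in> {0..1}"
        using eq p by (cases p; cases p') auto
      have "k0 (t, x) = k0 (t, x')"
      proof (rule glue_class_respects[where X = X and r = R])
        show "glue_class X R x = glue_class X R x'" using pp by (simp add: pt_def)
        show "k0 (t, x) = k0 (t, y)" if xy: "x \<in> topspace X" "y \<in> topspace X" "R x y" for x y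
        proof -
          obtain n n' where "x = (n, sphere_basepoint)" "y = (n', sphere_basepoint)" "n < N" "n' < N"
            using xy by (auto simp: R_def tX)
          then show ?thesis using rot_base[OF pp(4)] pt_base[of n n'] by (simp add: k0_def)
        qed
      qed
      then show "k0 p = k0 p'" using pp by simp
    qed (use that in blast)
    have surj: "\<exists>n w. n < N \<and> w \<in> sph \<and> c = pt (n, w)" if "c \<in> topspace W" for c
    proof -
      have "c \<in> pt ` ({..<N} \<times> sph)" using that quotient_imp_surjective_map[OF qm] by (simp add: tX)
      then show ?thesis by blast
    qed
    have k': "k (t, pt (n, w)) = pt (n, rot t w)" if "t \<in> {0..1}" "n < N" "w \<in> sph" for t n w
      using k(2)[of "(t, n, w)"] that by (auto simp: tX k0_def)
    have at1: "q (e (pt (n, w))) = pt (n, rot 1 w)" if n: "n < N" "w \<in> sph" for n w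
    proof -
      let ?y = "emb (b n) (flip w)"
      have ee: "e (pt (n, w)) = ?y" using e(2)[of "(n, w)"] n by (simp add: tX e0_def)
      have fv: "flip w \<in> vecs" using flip_vecs sph_vecs n by blast
      have yP: "?y \<in> P" and yp: "?y \<in> piece (b n)"
        using embP[OF n(1) fv] by auto
      have sy: "signed ?y = flip w" using signed_emb[OF bm[OF n(1)] fv] .
      \<comment> \<open>The point may lie in several pieces, and \<open>leg\<close> need not select
        the one it came from.\<close>
      have "f (leg ?y) ?y = f n ?y"
      proof (cases "leg ?y = n")
        case False
        then have "b n \<noteq> b (leg ?y)" using b n leg[OF yP] by (auto simp: bij_betw_def inj_on_def)
        then have "nrm (flip (path 1 (signed ?y))) = sphere_basepoint"
          using piece_overlap[of "b n" "b (leg ?y)" ?y] bm n leg[OF yP] yp yP by (auto simp: P_def)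
        then show ?thesis using pt_base[of "leg ?y" n] n leg(1)[OF yP] by (simp add: f_def)
      qed simp
      then show ?thesis by (simp add: ee q_def f_def sy rot_def)
    qed
    show "\<exists>h. continuous_map (prod_topology ?I W) W h \<and> (\<forall>x\<in>topspace W. h (0, x) = id x) \<and>
        (\<forall>x\<in>topspace W. h (1, x) = (q \<circ> e) x) \<and> (\<forall>t\<in>{0..1::real}. True)"
    proof (intro exI[of _ k] conjI ballI k(1))
      fix c assume "c \<in> topspace W"
      then obtain n w where c: "n < N" "w \<in> sph" "c = pt (n, w)" using surj by blast
      show "k (0, c) = id c" using k'[of 0] rot_0 c by simp
      show "k (1, c) = (q \<circ> e) c" using k'[of 1] at1 c by simp
    qed auto
  qed simp
  show ?thesis
    unfolding N_def[symmetric] P_def[symmetric] W homotopy_equivalent_space_def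
    using e(1) q homotopic_with_symD[OF eq] homotopic_with_symD[OF qe] by blast
qed

end

section \<open>Rooted trees\<close>

lemma adjacency_sym: "(u, v) \<in> (adjacency F)\<^sup>* \<Longrightarrow> (v, u) \<in> (adjacency F)\<^sup>*"
  by (rule symD[OF sym_rtrancl]) (auto simp: sym_def adjacency_def insert_commute)

lemma adjacency_mono: "F \<subseteq> G \<Longrightarrow> (u, v) \<in> (adjacency F)\<^sup>* \<Longrightarrow> (u, v) \<in> (adjacency G)\<^sup>*"
  by (rule rtrancl_mono[THEN subsetD]) (auto simp: adjacency_def)

lemma simple_path:
  assumes "(u, v) \<in> R\<^sup>*"
  shows "\<exists>vs. vs \<noteq> [] \<and> hd vs = u \<and> last vs = v \<and> distinct vs \<and> successively (\<lambda>x y. (x, y) \<in> R) vs"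
  using assms
proof (induction rule: converse_rtrancl_induct)
  case base
  show ?case by (rule exI[of _ "[v]"]) simp
next
  case (step u w)
  then obtain vs where vs: "vs \<noteq> []" "hd vs = w" "last vs = v" "distinct vs" "successively (\<lambda>x y. (x, y) \<in> R) vs"
    by blast
  show ?case
  proof (cases "u \<in> set vs")
    case True
    then obtain ys zs where "vs = ys @ u # zs" by (meson split_list)
    then show ?thesis using vs by (intro exI[of _ "u # zs"]) (auto simp: successively_append_iff)
  next
    case False
    then show ?thesis using vs step(1)
      by (intro exI[of _ "u # vs"]) (auto simp: successively_Cons)
  qed
qed

text \<open>A detour around the edge contains a simple path with at least three vertices, which the
  edge closes to a cycle.\<close>

lemma tree_bridge:
  assumes T: "is_tree V E" and e: "{u, v} \<in> E"
  shows "(u, v) \<notin> (adjacency (E - {{u, v}}))\<^sup>*"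
proof
  assume c: "(u, v) \<in> (adjacency (E - {{u, v}}))\<^sup>*"
  obtain vs where vs: "vs \<noteq> []" "hd vs = u" "last vs = v" "distinct vs"
      "successively (\<lambda>x y. (x, y) \<in> adjacency (E - {{u, v}})) vs"
    using simple_path[OF c] by blast
  have ne: "u \<noteq> v" using T e by (auto simp: is_tree_def doubleton_eq_iff)
  have step: "{vs ! i, vs ! Suc i} \<in> E - {{u, v}}" if "Suc i < length vs" for i
    using vs(5) that by (auto simp: successively_conv_nth adjacency_def)
  have hd: "vs ! 0 = u" using vs by (simp add: hd_conv_nth)
  have last: "vs ! (length vs - 1) = v" using vs by (simp add: last_conv_nth)
  have "length vs \<noteq> 1" using hd last ne by auto
  moreover have "length vs \<noteq> 2" using hd last step[of 0] by auto
  moreover have "length vs \<noteq> 0" using vs by auto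
  ultimately have len: "3 \<le> length vs" by linarith
  have "{vs ! i, vs ! (Suc i mod length vs)} \<in> E" if "i < length vs" for i
  proof (cases "Suc i < length vs")
    case True
    then show ?thesis using step[OF True] by simp
  next
    case False
    then have "Suc i = length vs" using that by simp
    then have "i = length vs - 1" "Suc i mod length vs = 0" by auto
    then show ?thesis using hd last e by (simp add: insert_commute)
  qed
  then show False using T len vs(4) unfolding is_tree_def by blast
qed

text \<open>Each edge is indexed by its lower end point. The function \<open>d\<close> need only
  drop along \<open>par\<close>: it is the distance from the root for a given tree, and
  \<open>n - card\<close> for a tree built from sets.\<close>

locale rooted =
  fixes V :: "nat set" and E :: "nat set set" and r :: nat
    and par :: "nat \<Rightarrow> nat" and d :: "nat \<Rightarrow> nat"
  assumes finV: "finite V" and rV: "r \<in> V"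
    and parV: "v \<in> V \<Longrightarrow> v \<noteq> r \<Longrightarrow> par v \<in> V"
    and depth: "v \<in> V \<Longrightarrow> v \<noteq> r \<Longrightarrow> d (par v) < d v"
    and E: "E = (\<lambda>v. {v, par v}) ` (V - {r})"
begin

lemma edge_inj: "inj_on (\<lambda>v. {v, par v}) (V - {r})"
proof (rule inj_onI)
  fix v w assume vw: "v \<in> V - {r}" "w \<in> V - {r}" "{v, par v} = {w, par w}"
  then have "d (par v) < d v" "d (par w) < d w" using depth by auto
  then show "v = w" using vw(3) by (auto simp: doubleton_eq_iff)
qed

definition up :: "(nat \<times> nat) set" where "up = {(v, par v) | v. v \<in> V \<and> v \<noteq> r}"

lemma up_edge: "(u, v) \<in> up \<Longrightarrow> u \<in> V \<and> v \<in> V \<and> u \<noteq> r \<and> v = par u \<and> {u, v} \<in> E"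
  using parV by (auto simp: up_def E)

lemma up_single: "single_valued up"
  by (auto simp: up_def single_valued_def)

lemma up_linear: "(v, x) \<in> up\<^sup>* \<Longrightarrow> (v, y) \<in> up\<^sup>* \<Longrightarrow> (x, y) \<in> up\<^sup>* \<or> (y, x) \<in> up\<^sup>*"
  using single_valued_confluent[OF up_single] .

lemma up_depth: "(v, x) \<in> up\<^sup>* \<Longrightarrow> v = x \<or> d x < d v"
  by (induction rule: rtrancl_induct) (use up_edge depth in \<open>force+\<close>)

lemma up_antisym: "(v, x) \<in> up\<^sup>* \<Longrightarrow> (x, v) \<in> up\<^sup>* \<Longrightarrow> v = x"
  using up_depth[of v x] up_depth[of x v] by auto

lemma up_root: "(r, v) \<in> up\<^sup>* \<Longrightarrow> v = r"
  by (erule converse_rtranclE) (auto dest: up_edge)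

lemma up_par: "(v, x) \<in> up\<^sup>* \<Longrightarrow> v \<noteq> x \<Longrightarrow> v \<in> V \<and> v \<noteq> r \<and> (par v, x) \<in> up\<^sup>*"
  by (erule converse_rtranclE) (auto dest: up_edge)

lemma par_up: "v \<in> V \<Longrightarrow> v \<noteq> r \<Longrightarrow> (v, par v) \<in> up"
  by (auto simp: up_def)

lemma to_root: "v \<in> V \<Longrightarrow> (v, r) \<in> up\<^sup>*"
proof (induction "d v" arbitrary: v rule: less_induct)
  case less
  show ?case
  proof (cases "v = r")
    case False
    then show ?thesis
      using less.hyps[of "par v"] depth parV less.prems par_up[of v] by (meson converse_rtrancl_into_rtrancl)
  qed simp
qed

lemma up_adjacency:
  assumes "(v, x) \<in> up\<^sup>*" "\<And>u. (v, u) \<in> up\<^sup>* \<Longrightarrow> (u, x) \<in> up\<^sup>* \<Longrightarrow> u \<noteq> x \<Longrightarrow> {u, par u} \<in> F"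
  shows "(v, x) \<in> (adjacency F)\<^sup>*"
  using assms
proof (induction rule: converse_rtrancl_induct)
  case (step v w)
  have w: "w = par v" "v \<in> V" "v \<noteq> r" using up_edge[OF step(1)] by auto
  have "v \<noteq> x" using up_depth[OF step(2)] depth w by force
  then have "(v, w) \<in> adjacency F"
    using step(4)[of v] converse_rtrancl_into_rtrancl[OF step(1,2)] w by (simp add: adjacency_def)
  moreover have "(w, x) \<in> (adjacency F)\<^sup>*"
    by (rule step.IH) (use step in \<open>auto intro: converse_rtrancl_into_rtrancl\<close>)
  ultimately show ?case by (rule converse_rtrancl_into_rtrancl)
qed simp

text \<open>On a cycle, a vertex of largest \<open>d\<close> would have its parent as both
  neighbours, but these are distinct when the length is at least three.\<close>

lemma is_tree: "is_tree V E"
  unfolding is_tree_def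
proof (intro conjI ballI)
  show "finite V" "V \<noteq> {} " using finV rV by auto
  show "E \<subseteq> {{u, v} | u v. u \<in> V \<and> v \<in> V \<and> u \<noteq> v}"
  proof
    fix e assume "e \<in> E"
    then obtain v where v: "v \<in> V" "v \<noteq> r" "e = {v, par v}" using E by auto
    then have "par v \<in> V" "par v \<noteq> v" using parV depth by force+
    then show "e \<in> {{u, v} | u v. u \<in> V \<and> v \<in> V \<and> u \<noteq> v}" using v by blast
  qed
  fix u v assume "u \<in> V" "v \<in> V"
  then have "(u, r) \<in> (adjacency E)\<^sup>*" "(v, r) \<in> (adjacency E)\<^sup>*"
    using up_adjacency[OF to_root, of _ E] up_par up_edge[OF par_up] by metis+
  then show "(u, v) \<in> (adjacency E)\<^sup>*" using adjacency_sym rtrancl_trans by metis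
next
  show "\<not> (\<exists>vs. 3 \<le> length vs \<and> distinct vs \<and> (\<forall>i<length vs. {vs ! i, vs ! (Suc i mod length vs)} \<in> E))"
  proof
  assume "\<exists>vs. 3 \<le> length vs \<and> distinct vs \<and> (\<forall>i<length vs. {vs ! i, vs ! (Suc i mod length vs)} \<in> E)"
  then obtain vs where len: "3 \<le> length vs" and dist: "distinct vs"
    and cyc: "\<And>i. i < length vs \<Longrightarrow> {vs ! i, vs ! (Suc i mod length vs)} \<in> E" by blast
  let ?L = "length vs"
  have "\<exists>i. i < ?L \<and> (\<forall>j<?L. d (vs ! j) \<le> d (vs ! i))"
  proof -
    have "finite ((\<lambda>i. d (vs ! i)) ` {..<?L})" "(\<lambda>i. d (vs ! i)) ` {..<?L} \<noteq> {}"
      using len by (auto simp: lessThan_empty_iff)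
    then have "Max ((\<lambda>i. d (vs ! i)) ` {..<?L}) \<in> (\<lambda>i. d (vs ! i)) ` {..<?L}" by (rule Max_in)
    then obtain i where i: "i < ?L" "Max ((\<lambda>i. d (vs ! i)) ` {..<?L}) = d (vs ! i)" by auto
    have "d (vs ! j) \<le> d (vs ! i)" if "j < ?L" for j
      unfolding i(2)[symmetric] using that by (intro Max_ge) auto
    then show ?thesis using i by blast
  qed
  then obtain i where i: "i < ?L" "\<And>j. j < ?L \<Longrightarrow> d (vs ! j) \<le> d (vs ! i)" by blast
  have nb: "vs ! j = par (vs ! i)" if j: "j < ?L" "{vs ! i, vs ! j} \<in> E" for j
  proof -
    obtain v where v: "v \<in> V - {r}" "{vs ! i, vs ! j} = {v, par v}" using j E by auto
    then have "d (par v) < d v" using depth by auto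
    then show ?thesis using v(2) i(2)[OF j(1)] by (auto simp: doubleton_eq_iff)
  qed
  define s where "s = Suc i mod ?L"
  define p where "p = (if i = 0 then ?L - 1 else i - 1)"
  have s: "s < ?L" "{vs ! i, vs ! s} \<in> E" using cyc[OF i(1)] len by (auto simp: s_def intro: mod_less_divisor)
  have p: "p < ?L" "Suc p mod ?L = i" using i(1) len by (auto simp: p_def)
  then have "{vs ! i, vs ! p} \<in> E" using cyc[OF p(1)] by (simp add: insert_commute)
  then have "vs ! s = vs ! p" using nb s p by metis
  then have "s = p" using dist s(1) p(1) by (simp add: nth_eq_iff_index_eq)
  moreover have "s = (if Suc i = ?L then 0 else Suc i)" using i(1) by (auto simp: s_def)
  ultimately show False using len i(1) by (auto simp: p_def split: if_splits)
  qed
qed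

definition children :: "nat \<Rightarrow> nat set" where "children v = {c \<in> V. c \<noteq> r \<and> par c = v}"

lemma finite_children: "finite (children v)" using finV by (simp add: children_def)

lemma degree:
  assumes "v \<in> V"
  shows "card {e \<in> E. v \<in> e} = card (children v) + (if v = r then 0 else 1)"
proof -
  have "{e \<in> E. v \<in> e} = (\<lambda>c. {c, par c}) ` (children v \<union> (if v = r then {} else {v}))"
    using assms by (auto simp: E children_def)
  moreover have "inj_on (\<lambda>c. {c, par c}) (children v \<union> (if v = r then {} else {v}))"
    using assms by (intro inj_on_subset[OF edge_inj]) (auto simp: children_def)
  moreover have "v \<notin> children v" using depth[of v] by (auto simp: children_def)
  ultimately show ?thesis using finite_children by (simp add: card_image)
qed

end

text \<open>The edges from each vertex to a chosen neighbour closer to \<open>r\<close> already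
  connect everything. A further edge would therefore fail to be a bridge.\<close>

lemma tree_rooted:
  assumes T: "is_tree V E" and r: "r \<in> V"
  obtains par d where "rooted V E r par d"
proof -
  let ?R = "adjacency E"
  have EV: "u \<in> V \<and> v \<in> V" if e: "{u, v} \<in> E" for u v
  proof -
    have "E \<subseteq> {{x, y} | x y. x \<in> V \<and> y \<in> V \<and> x \<noteq> y}" using T by (simp add: is_tree_def)
    then obtain x y where "{u, v} = {x, y}" "x \<in> V" "y \<in> V" using e by blast
    then show ?thesis by (auto simp: doubleton_eq_iff)
  qed
  define d where "d v = (LEAST k. (r, v) \<in> ?R ^^ k)" for v
  have reach: "(r, v) \<in> ?R ^^ d v" if "v \<in> V" for v
  proof -
    have "(r, v) \<in> ?R\<^sup>*" using T r that by (auto simp: is_tree_def)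
    then obtain k where "(r, v) \<in> ?R ^^ k" using rtrancl_power by blast
    then show ?thesis unfolding d_def by (rule LeastI)
  qed
  have ex: "\<exists>w. w \<in> V \<and> d w < d v \<and> {v, w} \<in> E" if v: "v \<in> V" "v \<noteq> r" for v
  proof (cases "d v")
    case 0
    then show ?thesis using reach[OF v(1)] v(2) by simp
  next
    case (Suc k)
    then obtain w where w: "(r, w) \<in> ?R ^^ k" "(w, v) \<in> ?R" using reach[OF v(1)] by auto
    then have "d w \<le> k" unfolding d_def by (intro Least_le)
    moreover have "{v, w} \<in> E" using w by (simp add: adjacency_def insert_commute)
    ultimately show ?thesis using Suc EV[of v w] by (intro exI[of _ w]) auto
  qed
  define par where "par v = (SOME w. w \<in> V \<and> d w < d v \<and> {v, w} \<in> E)" for v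
  have par: "par v \<in> V \<and> d (par v) < d v \<and> {v, par v} \<in> E" if "v \<in> V" "v \<noteq> r" for v
    unfolding par_def using someI_ex[OF ex[OF that]] .
  define E0 where "E0 = (\<lambda>v. {v, par v}) ` (V - {r})"
  have finV: "finite V" using T by (simp add: is_tree_def)
  interpret R: rooted V E0 r par d
    by unfold_locales (use finV r par E0_def in auto)
  have "E \<subseteq> E0"
  proof
    fix e assume e: "e \<in> E"
    then obtain u v where uv: "e = {u, v}" "u \<in> V" "v \<in> V" using T unfolding is_tree_def by blast
    show "e \<in> E0"
    proof (rule ccontr)
      assume "e \<notin> E0"
      then have "E0 \<subseteq> E - {{u, v}}" using par uv by (auto simp: E0_def)
      moreover have "(u, v) \<in> (adjacency E0)\<^sup>*" using R.is_tree uv by (simp add: is_tree_def)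
      ultimately show False using tree_bridge[OF T, of u v] e uv adjacency_mono by blast
    qed
  qed
  then have "E = E0" using par by (auto simp: E0_def)
  then show thesis using that R.rooted_axioms by simp
qed

section \<open>Splits of stable trees\<close>

definition split_of :: "nat \<Rightarrow> marked_tree \<Rightarrow> nat set \<Rightarrow> nat set" where
  "split_of n T e = {i \<in> {1..n}. (mark T 1, mark T i) \<notin> (adjacency (edges T - {e}))\<^sup>*}"

text \<open>The bound on \<open>\<epsilon>\<close> says that all light marks together never outweigh
  a single heavy one.\<close>

locale weights =
  fixes n m :: nat and \<epsilon> :: real
  assumes n: "3 \<le> n" and m: "2 \<le> m" and mn: "m \<le> n"
    and \<epsilon>: "0 < \<epsilon>" and n\<epsilon>: "real n * \<epsilon> \<le> 1"
begin

abbreviation w :: "nat \<Rightarrow> real" where "w \<equiv> heavy_light m \<epsilon>"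

lemma \<epsilon>_le_1: "\<epsilon> \<le> 1"
proof -
  have "1 * \<epsilon> \<le> real n * \<epsilon>" using n \<epsilon> by (intro mult_right_mono) auto
  then show ?thesis using n\<epsilon> by simp
qed

lemma w_pos: "0 < w i" and w_le_1: "w i \<le> 1" and w_heavy: "i \<le> m \<Longrightarrow> w i = 1"
  using \<epsilon> \<epsilon>_le_1 by (auto simp: heavy_light_def)

lemma sum_w_gt_1:
  assumes M: "M \<subseteq> {1..n}" and "1 < sum w M"
  shows "\<exists>i\<in>M. i \<le> m" "2 \<le> card M"
proof -
  have fin: "finite M" using M finite_subset by blast
  show "\<exists>i\<in>M. i \<le> m"
  proof (rule ccontr)
    assume "\<not> ?thesis"
    then have "sum w M = (\<Sum>i\<in>M. \<epsilon>)" by (intro sum.cong) (auto simp: heavy_light_def)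
    also have "\<dots> = real (card M) * \<epsilon>" by simp
    also have "\<dots> \<le> real n * \<epsilon>" using card_mono[OF _ M] \<epsilon> by (intro mult_right_mono) auto
    finally show False using n\<epsilon> assms(2) by simp
  qed
  have "sum w M \<le> (\<Sum>i\<in>M. 1)" using w_le_1 by (intro sum_mono)
  then have "1 < real (card M)" using assms(2) by simp
  then show "2 \<le> card M" by simp
qed

lemma sum_w_ge:
  assumes "M \<subseteq> {1..n}" "i \<in> M"
  shows "w i \<le> sum w M" "k \<in> M \<Longrightarrow> k \<noteq> i \<Longrightarrow> w i + w k \<le> sum w M"
proof -
  have fin: "finite M" using assms finite_subset by blast
  have w0: "0 \<le> w x" for x using w_pos[of x] by simp
  show "w i \<le> sum w M" using assms w0 fin by (intro member_le_sum) auto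
  show "w i + w k \<le> sum w M" if "k \<in> M" "k \<noteq> i"
  proof -
    have "w i + w k = sum w {i, k}" using that by simp
    also have "\<dots> \<le> sum w M" using that assms w0 fin by (intro sum_mono2) auto
    finally show ?thesis .
  qed
qed

end

section \<open>Marks below a vertex of a stable tree\<close>

locale stable = weights n m \<epsilon> + rooted "verts T" "edges T" r par d
  for n m \<epsilon> and T :: marked_tree and r par d +
  assumes root: "mark T 1 = r" and stable: "is_stable_tree n w T"
begin

abbreviation V where "V \<equiv> verts T"

definition marks :: "nat \<Rightarrow> nat set" where "marks v = {i \<in> {1..n}. mark T i = v}"

definition desc :: "nat \<Rightarrow> nat set" where "desc v = {i \<in> {1..n}. (mark T i, v) \<in> up\<^sup>*}"

lemma mark_V: "i \<in> {1..n} \<Longrightarrow> mark T i \<in> V"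
  using stable by (auto simp: is_stable_tree_def)

lemma stable_vertex:
  assumes "v \<in> V"
  shows "2 < real (card (children v)) + (if v = r then 0 else 1) + sum w (marks v)"
proof -
  have "2 < real (card {e \<in> edges T. v \<in> e}) + (\<Sum>i | i \<in> {1..n} \<and> mark T i = v. w i)"
    using stable assms by (simp add: is_stable_tree_def)
  also have "(\<Sum>i | i \<in> {1..n} \<and> mark T i = v. w i) = sum w (marks v)" by (simp add: marks_def)
  finally show ?thesis unfolding degree[OF assms] by (auto split: if_splits)
qed

lemma marks_sub: "marks v \<subseteq> {1..n}" by (auto simp: marks_def)

lemma marks_desc: "marks v \<subseteq> desc v" by (auto simp: marks_def desc_def)

lemma desc_mono: "(v, x) \<in> up\<^sup>* \<Longrightarrow> desc v \<subseteq> desc x"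
  by (auto simp: desc_def)

lemma desc_root: "desc r = {1..n}"
  using to_root mark_V by (auto simp: desc_def)

lemma one_in_desc: "1 \<in> desc v \<longleftrightarrow> v = r"
  using n up_root root by (auto simp: desc_def)

text \<open>A deepest vertex below \<open>v\<close> has no children and a single edge, so stability
  gives its marks a weight above \<open>1\<close>.\<close>

lemma desc_big:
  assumes v: "v \<in> V" "v \<noteq> r"
  shows "\<exists>i\<in>desc v. i \<le> m" "2 \<le> card (desc v)"
proof -
  let ?D = "{x \<in> V. (x, v) \<in> up\<^sup>*}"
  have fin: "finite (d ` ?D)" and ne: "d ` ?D \<noteq> {}" using finV v by auto
  obtain x where x: "x \<in> ?D" "Max (d ` ?D) = d x" using Max_in[OF fin ne] by auto
  have "children x = {}"
  proof (rule equals0I)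
    fix c assume c: "c \<in> children x"
    then have cx: "c \<in> V" "c \<noteq> r" "par c = x" by (auto simp: children_def)
    then have "(c, x) \<in> up" using par_up by blast
    then have "c \<in> ?D" using cx x(1) by (auto intro: converse_rtrancl_into_rtrancl)
    then have "d c \<le> d x" unfolding x(2)[symmetric] using fin by (intro Max_ge) auto
    then show False using depth[OF cx(1,2)] cx by simp
  qed
  then have "1 < sum w (marks x)" using stable_vertex[of x] x by (auto split: if_splits)
  note big = sum_w_gt_1[OF marks_sub this]
  have sub: "marks x \<subseteq> desc v" using marks_desc desc_mono x by blast
  show "\<exists>i\<in>desc v. i \<le> m" using big(1) sub by blast
  have "finite (desc v)" by (auto simp: desc_def)
  then show "2 \<le> card (desc v)" using big(2) card_mono[OF _ sub] by simp
qed

lemma desc_nonempty: "v \<in> V \<Longrightarrow> desc v \<noteq> {}"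
  using desc_big(2)[of v] desc_root n by (cases "v = r") auto

lemma desc_meet:
  assumes "desc v \<inter> desc x \<noteq> {}"
  shows "(v, x) \<in> up\<^sup>* \<or> (x, v) \<in> up\<^sup>*"
proof -
  obtain i where "(mark T i, v) \<in> up\<^sup>*" "(mark T i, x) \<in> up\<^sup>*" using assms by (auto simp: desc_def)
  then show ?thesis by (rule up_linear)
qed

text \<open>If the sets agreed, \<open>u\<close> would be the only child of its parent, and
  stability would put a mark at the parent. Such a mark is not below \<open>u\<close>.\<close>

lemma desc_child:
  assumes u: "u \<in> V" "u \<noteq> r"
  shows "desc u \<noteq> desc (par u)"
proof
  assume eq: "desc u = desc (par u)"
  let ?v = "par u"
  have v: "?v \<in> V" using parV u by blast
  have uc: "u \<in> children ?v" using u by (simp add: children_def)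
  have "children ?v \<subseteq> {u}"
  proof
    fix c assume "c \<in> children ?v"
    then have c: "c \<in> V" "c \<noteq> r" "par c = ?v" by (auto simp: children_def)
    have "desc c \<subseteq> desc ?v" using desc_mono par_up[OF c(1,2)] c(3) by auto
    then have "desc c \<inter> desc u \<noteq> {}" using eq desc_nonempty[OF c(1)] by auto
    then have "c = u \<or> (?v, u) \<in> up\<^sup>* \<or> (?v, c) \<in> up\<^sup>*"
      using desc_meet[of c u] up_par[of c u] up_par[of u c] c by metis
    then show "c \<in> {u}"
      using up_depth[of ?v u] up_depth[of ?v c] depth[OF u] depth[OF c(1,2)] c(3) by auto
  qed
  then have "children ?v = {u}" using uc by auto
  then have "0 < sum w (marks ?v)" using stable_vertex[OF v] by (auto split: if_splits)
  then have "marks ?v \<noteq> {}" by auto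
  then obtain i where i: "i \<in> marks ?v" by blast
  then have "i \<in> desc u" using eq marks_desc by auto
  then have "(?v, u) \<in> up\<^sup>*" using i by (auto simp: desc_def marks_def)
  then show False using up_depth depth[OF u] by force
qed

text \<open>Recovers the order of the tree from the sets of marks; strict growth along edges
  excludes the opposite order.\<close>

lemma desc_sub_iff:
  assumes "v \<in> V" "x \<in> V"
  shows "desc v \<subseteq> desc x \<longleftrightarrow> (v, x) \<in> up\<^sup>*"
proof
  assume sub: "desc v \<subseteq> desc x"
  show "(v, x) \<in> up\<^sup>*"
  proof (rule ccontr)
    assume n: "(v, x) \<notin> up\<^sup>*"
    have "desc v \<inter> desc x \<noteq> {}" using sub desc_nonempty[OF assms(1)] by auto
    then have xv: "(x, v) \<in> up\<^sup>*" using desc_meet n by blast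
    have "x \<noteq> v" using n by auto
    then have x: "x \<noteq> r" "(par x, v) \<in> up\<^sup>*" using up_par[OF xv] by auto
    then have "desc (par x) \<subseteq> desc x" using desc_mono sub by blast
    moreover have "desc x \<subseteq> desc (par x)" using desc_mono par_up[OF assms(2) x(1)] by blast
    ultimately show False using desc_child[OF assms(2) x(1)] by auto
  qed
qed (rule desc_mono)

lemma desc_inj: "v \<in> V \<Longrightarrow> x \<in> V \<Longrightarrow> desc v = desc x \<Longrightarrow> v = x"
  using desc_sub_iff[of v x] desc_sub_iff[of x v] up_antisym by blast

lemma desc_laminar: "desc v \<inter> desc x = {} \<or> desc v \<subseteq> desc x \<or> desc x \<subseteq> desc v"
  using desc_meet desc_mono by blast

lemma desc_sub: "v \<noteq> r \<Longrightarrow> desc v \<subseteq> {2..n}"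
proof
  fix i assume "v \<noteq> r" "i \<in> desc v"
  then have "i \<noteq> 1" "i \<in> {1..n}" using one_in_desc by (auto simp: desc_def)
  then show "i \<in> {2..n}" by auto
qed

text \<open>The set to exclude is \<open>{2..n}\<close>: then \<open>v\<close> would be the only
  child of the root, and the root would carry only the mark \<open>1\<close>. One edge and weight
  \<open>1\<close> do not exceed \<open>2\<close>.\<close>

lemma desc_splits:
  assumes v: "v \<in> V" "v \<noteq> r"
  shows "desc v \<in> splits n m"
proof -
  have "desc v \<noteq> {2..n}"
  proof
    assume dv: "desc v = {2..n}"
    have pv: "par v = r"
    proof (rule ccontr)
      assume "par v \<noteq> r"
      then have "desc (par v) \<subseteq> desc v" using desc_sub dv by simp
      moreover have "desc v \<subseteq> desc (par v)" using desc_mono par_up v by blast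
      ultimately show False using desc_child v by blast
    qed
    have "c = v" if "c \<in> children r" for c
    proof (rule ccontr)
      assume "c \<noteq> v"
      have c: "c \<in> V" "c \<noteq> r" "par c = r" using that by (auto simp: children_def)
      then have "(c, v) \<in> up\<^sup>*" using desc_sub[of c] desc_sub_iff[of c v] v dv by simp
      then have "(r, v) \<in> up\<^sup>*" using up_par[of c v] \<open>c \<noteq> v\<close> c by auto
      then show False using up_root v by blast
    qed
    then have "children r \<subseteq> {v}" by blast
    moreover have "v \<in> children r" using v pv by (simp add: children_def)
    ultimately have "children r = {v}" by blast
    then have "1 < sum w (marks r)" using stable_vertex[OF rV] by simp
    then have "2 \<le> card (marks r)" using sum_w_gt_1 marks_sub by blast
    then have "\<not> marks r \<subseteq> {1}" using card_mono[of "{1}" "marks r"] by auto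
    then obtain i where i: "i \<in> marks r" "i \<noteq> 1" by auto
    then have "i \<in> {2..n}" by (auto simp: marks_def)
    then have "i \<in> desc v" using dv by simp
    then have "(r, v) \<in> up\<^sup>*" using i by (auto simp: desc_def marks_def)
    then show False using up_root v by blast
  qed
  then show ?thesis using desc_sub desc_big[OF v] v by (simp add: splits_def)
qed

text \<open>Upward paths lose only this one edge: marks below \<open>v\<close> still reach
  \<open>v\<close>, the others still reach the root, and the edge is a bridge.\<close>

lemma split_edge:
  assumes v: "v \<in> V" "v \<noteq> r"
  shows "split_of n T {v, par v} = desc v"
proof -
  let ?F = "edges T - {{v, par v}}"
  have step: "{u, par u} \<in> ?F" if "u \<in> V" "u \<noteq> r" "u \<noteq> v" for u
    using that edge_inj v by (auto simp: E inj_on_def)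
  have climb: "(u, x) \<in> (adjacency ?F)\<^sup>*"
    if ux: "(u, x) \<in> up\<^sup>*" and "(u, v) \<notin> up\<^sup>* \<or> x = v" for u x
  proof (rule up_adjacency[OF ux])
    fix y assume y: "(u, y) \<in> up\<^sup>*" "(y, x) \<in> up\<^sup>*" "y \<noteq> x"
    have "y \<in> V" "y \<noteq> r" using up_par[OF y(2,3)] by auto
    moreover have "y \<noteq> v" using that(2) y by auto
    ultimately show "{y, par y} \<in> ?F" by (rule step)
  qed
  have rp: "(par v, r) \<in> (adjacency ?F)\<^sup>*"
  proof (rule climb)
    show "(par v, r) \<in> up\<^sup>*" using to_root parV v by blast
    show "(par v, v) \<notin> up\<^sup>* \<or> r = v" using up_depth[of "par v" v] depth[OF v] by auto
  qed
  have "(r, mark T i) \<in> (adjacency ?F)\<^sup>* \<longleftrightarrow> (mark T i, v) \<notin> up\<^sup>*" if i: "i \<in> {1..n}" for i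
  proof
    assume c: "(r, mark T i) \<in> (adjacency ?F)\<^sup>*"
    show "(mark T i, v) \<notin> up\<^sup>*"
    proof
      assume "(mark T i, v) \<in> up\<^sup>*"
      then have "(mark T i, v) \<in> (adjacency ?F)\<^sup>*" using climb by blast
      then have "(v, par v) \<in> (adjacency ?F)\<^sup>*"
        using c rp adjacency_sym rtrancl_trans by metis
      then show False using tree_bridge[OF is_tree, of v "par v"] v by (auto simp: E)
    qed
  next
    assume "(mark T i, v) \<notin> up\<^sup>*"
    then have "(mark T i, r) \<in> (adjacency ?F)\<^sup>*" using climb to_root mark_V[OF i] by blast
    then show "(r, mark T i) \<in> (adjacency ?F)\<^sup>*" by (rule adjacency_sym)
  qed
  then show ?thesis unfolding split_of_def root by (auto simp: desc_def)
qed

lemma split_inj: "inj_on (split_of n T) (edges T)"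
proof (rule inj_onI)
  fix e e' assume e: "e \<in> edges T" "e' \<in> edges T" "split_of n T e = split_of n T e'"
  obtain v where v: "v \<in> V" "v \<noteq> r" "e = {v, par v}" using e(1) E by auto
  obtain v' where v': "v' \<in> V" "v' \<noteq> r" "e' = {v', par v'}" using e(2) E by auto
  show "e = e'" using e(3) desc_inj[of v v'] split_edge v v' by simp
qed

lemma split_image: "split_of n T ` edges T = desc ` (V - {r})"
proof -
  have "split_of n T ` edges T = (\<lambda>v. split_of n T {v, par v}) ` (V - {r})" by (simp add: E image_image)
  also have "\<dots> = desc ` (V - {r})" by (intro image_cong) (auto simp: split_edge)
  finally show ?thesis .
qed

lemma finite_edges: "finite (edges T)" using finV by (simp add: E)

end

lemma stable_tree_rooted:
  assumes "weights n m \<epsilon>" "is_stable_tree n (heavy_light m \<epsilon>) T"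
  obtains r par d where "stable n m \<epsilon> T r par d"
proof -
  interpret weights n m \<epsilon> by fact
  have "is_tree (verts T) (edges T)" "mark T 1 \<in> verts T" using assms(2) n by (auto simp: is_stable_tree_def)
  then obtain par d where "rooted (verts T) (edges T) (mark T 1) par d" by (rule tree_rooted)
  then show thesis using assms by (intro that[of "mark T 1" par d]) (simp add: stable_def stable_axioms_def)
qed

section \<open>The tree of a laminar family\<close>

definition family :: "nat \<Rightarrow> nat set set \<Rightarrow> nat set set" where "family n S = insert {1..n} S"

definition smallest :: "nat \<Rightarrow> nat set set \<Rightarrow> nat set \<Rightarrow> nat set" where
  "smallest n S X = \<Inter>{C \<in> family n S. X \<subseteq> C}"

definition cover :: "nat \<Rightarrow> nat set set \<Rightarrow> nat set \<Rightarrow> nat set" where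
  "cover n S B = \<Inter>{C \<in> family n S. B \<subset> C}"

text \<open>The Hasse diagram of the family with \<open>{1..n}\<close> on top;
  \<open>set_encode\<close> turns its members into natural numbers, as vertices have to be.\<close>

definition canonical_tree :: "nat \<Rightarrow> nat set set \<Rightarrow> marked_tree" where
  "canonical_tree n S = \<lparr>verts = set_encode ` family n S,
     edges = (\<lambda>B. {set_encode B, set_encode (cover n S B)}) ` S,
     mark = restrict (\<lambda>i. set_encode (smallest n S {i})) {1..n}\<rparr>"

text \<open>In a laminar family the members containing a fixed nonempty set form a chain; hence
  \<open>smallest\<close> and \<open>cover\<close> are themselves members.\<close>

lemma chain_Inter:
  assumes "finite F" "F \<noteq> {}" "\<And>A B. A \<in> F \<Longrightarrow> B \<in> F \<Longrightarrow> A \<subseteq> B \<or> B \<subseteq> A"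
  shows "\<Inter>F \<in> F"
  using assms
proof (induction F rule: finite_ne_induct)
  case (insert A F)
  then have "\<Inter>F \<in> F" by blast
  then have "A \<subseteq> \<Inter>F \<or> \<Inter>F \<subseteq> A" using insert.prems by blast
  then have "\<Inter>(insert A F) = A \<or> \<Inter>(insert A F) = \<Inter>F" by auto
  then show ?case using \<open>\<Inter>F \<in> F\<close> by auto
qed simp

locale laminar_splits = weights +
  fixes S assumes S: "S \<subseteq> splits n m" and lam: "laminar S"
begin

abbreviation fam where "fam \<equiv> family n S"
abbreviation full where "full \<equiv> {1..n}"

lemma S_props: assumes "B \<in> S"
  shows "B \<subseteq> {2..n}" "2 \<le> card B" "B \<noteq> {2..n}" "\<exists>i\<in>B. i \<le> m" "B \<subset> full" "B \<noteq> {}"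
proof -
  show 1: "B \<subseteq> {2..n}" "2 \<le> card B" "B \<noteq> {2..n}" "\<exists>i\<in>B. i \<le> m"
    using S assms by (auto simp: splits_def)
  show "B \<noteq> {}" using 1 by auto
  have "1 \<in> full" "1 \<notin> B" "B \<subseteq> full" using 1 n by auto
  then show "B \<subset> full" by blast
qed

lemma finite_S: "finite S" by (rule finite_subset[OF S finite_splits])

lemma fam_sub: "B \<in> fam \<Longrightarrow> B \<subseteq> full" using S_props(5) by (auto simp: family_def)

lemma fam_finite: "B \<in> fam \<Longrightarrow> finite B"
  by (rule finite_subset[OF fam_sub]) auto

lemma fam_laminar: "A \<in> fam \<Longrightarrow> B \<in> fam \<Longrightarrow> A \<inter> B = {} \<or> A \<subseteq> B \<or> B \<subseteq> A"
  using lam fam_sub by (auto simp: family_def laminar_def)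

lemma fam_chain: "X \<noteq> {} \<Longrightarrow> A \<in> fam \<Longrightarrow> B \<in> fam \<Longrightarrow> X \<subseteq> A \<Longrightarrow> X \<subseteq> B \<Longrightarrow> A \<subseteq> B \<or> B \<subseteq> A"
  using fam_laminar by blast

lemma finite_fam: "finite fam" using finite_S by (simp add: family_def)

lemma full_fam: "full \<in> fam" by (simp add: family_def)

lemma smallest: assumes "X \<noteq> {}" "X \<subseteq> full"
  shows "smallest n S X \<in> fam" "X \<subseteq> smallest n S X" "C \<in> fam \<Longrightarrow> X \<subseteq> C \<Longrightarrow> smallest n S X \<subseteq> C"
proof -
  have "\<Inter>{C \<in> fam. X \<subseteq> C} \<in> {C \<in> fam. X \<subseteq> C}"
    by (rule chain_Inter) (use finite_fam full_fam assms fam_chain in auto)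
  then show "smallest n S X \<in> fam" "X \<subseteq> smallest n S X" "C \<in> fam \<Longrightarrow> X \<subseteq> C \<Longrightarrow> smallest n S X \<subseteq> C"
    by (auto simp: smallest_def)
qed

lemma smallest_fam: "B \<in> fam \<Longrightarrow> smallest n S B = B"
  by (auto simp: smallest_def)

lemma cover: assumes "B \<in> S"
  shows "cover n S B \<in> fam" "B \<subset> cover n S B" "C \<in> fam \<Longrightarrow> B \<subset> C \<Longrightarrow> cover n S B \<subseteq> C"
proof -
  have "\<Inter>{C \<in> fam. B \<subset> C} \<in> {C \<in> fam. B \<subset> C}"
    by (rule chain_Inter) (use finite_fam full_fam S_props[OF assms] fam_chain[of B] in auto)
  then show "cover n S B \<in> fam" "B \<subset> cover n S B" "C \<in> fam \<Longrightarrow> B \<subset> C \<Longrightarrow> cover n S B \<subseteq> C"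
    unfolding cover_def by auto
qed

abbreviation enc :: "nat set \<Rightarrow> nat" where "enc \<equiv> set_encode"
abbreviation canon where "canon \<equiv> canonical_tree n S"

lemma enc_inj: "A \<in> fam \<Longrightarrow> B \<in> fam \<Longrightarrow> enc A = enc B \<Longrightarrow> A = B"
  using fam_finite set_encode_inverse by metis

lemma dec_enc: "A \<in> fam \<Longrightarrow> set_decode (enc A) = A"
  using fam_finite by simp

lemma S_fam: "B \<in> S \<Longrightarrow> B \<in> fam" by (simp add: family_def)

lemma smallest_one: "smallest n S {1} = full"
proof -
  have "smallest n S {1} \<in> fam" "1 \<in> smallest n S {1}" using smallest[of "{1}"] n by auto
  then show ?thesis using S_props(1) by (force simp: family_def)
qed

lemma canon_root: "mark canon 1 = enc full"
  using n smallest_one by (simp add: canonical_tree_def)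

sublocale can: rooted "verts canon" "edges canon" "enc full"
  "\<lambda>x. enc (cover n S (set_decode x))" "\<lambda>x. n - card (set_decode x)"
proof
  show "finite (verts canon)" using finite_fam by (simp add: canonical_tree_def)
  show "enc full \<in> verts canon" using full_fam by (simp add: canonical_tree_def)
  have *: "\<exists>B\<in>S. v = enc B" if "v \<in> verts canon" "v \<noteq> enc full" for v
    using that by (auto simp: canonical_tree_def family_def)
  show "enc (cover n S (set_decode v)) \<in> verts canon" if "v \<in> verts canon" "v \<noteq> enc full" for v
    using *[OF that] cover(1) dec_enc S_fam by (auto simp: canonical_tree_def)
  show "n - card (set_decode (enc (cover n S (set_decode v)))) < n - card (set_decode v)"
    if v: "v \<in> verts canon" "v \<noteq> enc full" for v
  proof -
    obtain B where B: "B \<in> S" "v = enc B" using *[OF v] by blast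
    note c = cover(1,2)[OF B(1)]
    have "card B < card (cover n S B)" by (rule psubset_card_mono[OF fam_finite[OF c(1)] c(2)])
    moreover have "card (cover n S B) \<le> n" using card_mono[OF _ fam_sub[OF c(1)]] by simp
    ultimately show ?thesis using B dec_enc[OF S_fam[OF B(1)]] dec_enc[OF c(1)] by simp
  qed
  have "verts canon - {enc full} = enc ` S"
  proof -
    have "enc B \<noteq> enc full" if "B \<in> S" for B using enc_inj[of B full] S_fam full_fam S_props(5) that by blast
    then show ?thesis by (auto simp: canonical_tree_def family_def)
  qed
  then show "edges canon = (\<lambda>v. {v, enc (cover n S (set_decode v))}) ` (verts canon - {enc full})"
    using dec_enc S_fam by (simp add: canonical_tree_def image_image)
qed

lemma enc_not_root: "B \<in> S \<Longrightarrow> enc B \<in> verts canon \<and> enc B \<noteq> enc full"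
  using enc_inj[of B full] S_fam full_fam S_props(5)
  by (auto simp: canonical_tree_def)

lemma par_enc: "B \<in> S \<Longrightarrow> enc (cover n S (set_decode (enc B))) = enc (cover n S B)"
  using dec_enc S_fam by simp

text \<open>A member strictly above \<open>C\<close> contains the cover of \<open>C\<close>, so
  repeated covers reach every member above \<open>C\<close>.\<close>

lemma can_up: assumes "C \<in> fam" "B \<in> fam"
  shows "(enc C, enc B) \<in> can.up\<^sup>* \<longleftrightarrow> C \<subseteq> B"
proof
  have "(x, y) \<in> can.up\<^sup>* \<Longrightarrow> set_decode x \<subseteq> set_decode y" for x y
  proof (induction rule: rtrancl_induct)
    case (step y z)
    then have yz: "y \<in> verts canon" "y \<noteq> enc full" "z = enc (cover n S (set_decode y))"
      using can.up_edge by auto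
    then obtain B where B: "B \<in> S" "y = enc B" by (auto simp: canonical_tree_def family_def)
    then have "set_decode y \<subseteq> set_decode z"
      using yz(3) cover(1,2)[OF B(1)] dec_enc S_fam by auto
    then show ?case using step by blast
  qed simp
  then show "(enc C, enc B) \<in> can.up\<^sup>* \<Longrightarrow> C \<subseteq> B" using dec_enc assms by metis
next
  show "C \<subseteq> B \<Longrightarrow> (enc C, enc B) \<in> can.up\<^sup>*"
    using assms(1)
  proof (induction "n - card C" arbitrary: C rule: less_induct)
    case less
    show ?case
    proof (cases "C = B")
      case False
      then have "C \<in> S" using less.prems assms(2) fam_sub by (auto simp: family_def)
      note c = cover[OF this]
      have "card C < card (cover n S C)" by (rule psubset_card_mono[OF fam_finite[OF c(1)] c(2)])
      moreover have "card (cover n S C) \<le> n" using card_mono[OF _ fam_sub[OF c(1)]] by simp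
      ultimately have "n - card (cover n S C) < n - card C" by simp
      then have "(enc (cover n S C), enc B) \<in> can.up\<^sup>*"
        using less.hyps c(1) c(3)[OF assms(2)] less.prems False by blast
      moreover have "(enc C, enc (cover n S C)) \<in> can.up"
        using can.par_up enc_not_root[OF \<open>C \<in> S\<close>] par_enc[OF \<open>C \<in> S\<close>] by metis
      ultimately show ?thesis by (rule converse_rtrancl_into_rtrancl[rotated])
    qed simp
  qed
qed

lemma mark_canon: "i \<in> full \<Longrightarrow> mark canon i = enc (smallest n S {i})"
  by (simp add: canonical_tree_def)

lemma smallest_iff: "i \<in> full \<Longrightarrow> B \<in> fam \<Longrightarrow> smallest n S {i} \<subseteq> B \<longleftrightarrow> i \<in> B"
  using smallest[of "{i}"] by auto

definition below_cover :: "nat set \<Rightarrow> nat set set" where "below_cover B = {C \<in> S. cover n S C = B}"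

lemma child_above:
  assumes D: "D \<in> S" and B: "B \<in> fam" "D \<subset> B"
  shows "\<exists>C\<in>below_cover B. D \<subseteq> C"
proof -
  have "(enc D, enc B) \<in> can.up\<^sup>*" using can_up S_fam D B by blast
  moreover have "enc D \<noteq> enc B" using enc_inj S_fam D B by blast
  ultimately obtain y where y: "(enc D, y) \<in> can.up\<^sup>*" "(y, enc B) \<in> can.up"
    by (metis rtranclE)
  then have "y \<in> verts canon" "y \<noteq> enc full" "enc B = enc (cover n S (set_decode y))"
    using can.up_edge by auto
  then obtain C where C: "C \<in> S" "y = enc C" "enc B = enc (cover n S C)"
    using dec_enc S_fam by (auto simp: canonical_tree_def family_def)
  then have "cover n S C = B" using enc_inj cover(1) B by metis
  moreover have "D \<subseteq> C" using y(1) C can_up S_fam D by blast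
  ultimately show ?thesis using C by (auto simp: below_cover_def)
qed

lemma own_mark:
  assumes B: "B \<in> fam" and i: "i \<in> B" "\<And>C. C \<in> below_cover B \<Longrightarrow> i \<notin> C"
  shows "i \<in> {i \<in> full. mark canon i = enc B}"
proof -
  have it: "i \<in> full" using fam_sub B i by blast
  have h: "smallest n S {i} \<in> fam" "i \<in> smallest n S {i}" "smallest n S {i} \<subseteq> B"
    using smallest[of "{i}"] it smallest_iff[OF it B] i by auto
  have "smallest n S {i} = B"
  proof (rule ccontr)
    assume ne: "smallest n S {i} \<noteq> B"
    then have "smallest n S {i} \<in> S" using h fam_sub[OF B] by (auto simp: family_def)
    then show False using child_above[of "smallest n S {i}" B] B h ne i(2) by blast
  qed
  then show ?thesis using it mark_canon by simp
qed

text \<open>A vertex without children carries all of its set: a heavy mark and another one. With a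
  single child \<open>C\<close>, some mark of \<open>B - C\<close> sits at the vertex; at the root,
  \<open>C \<noteq> {2..n}\<close> gives a second mark besides \<open>1\<close>. With two or more
  children, the upward edge suffices, or at the root the mark \<open>1\<close>.\<close>

lemma canon_stable: "is_stable_tree n w canon"
  unfolding is_stable_tree_def
proof (intro conjI ballI)
  show "is_tree (verts canon) (edges canon)" by (rule can.is_tree)
  show "mark canon \<in> {1..n} \<rightarrow>\<^sub>E verts canon"
    using smallest(1) by (auto simp: canonical_tree_def)
  fix v assume v: "v \<in> verts canon"
  then obtain B where B: "B \<in> fam" "v = enc B" by (auto simp: canonical_tree_def)
  define M where "M = {i \<in> full. mark canon i = enc B}"
  have M: "M \<subseteq> {1..n}" by (auto simp: M_def)
  have own: "i \<in> M" if "i \<in> B" "\<And>C. C \<in> below_cover B \<Longrightarrow> i \<notin> C" for i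
    unfolding M_def by (rule own_mark[OF B(1) that])
  have ch: "can.children v = enc ` below_cover B"
  proof
    show "can.children v \<subseteq> enc ` below_cover B"
    proof
      fix x assume "x \<in> can.children v"
      then have x: "x \<in> verts canon" "x \<noteq> enc full" "enc (cover n S (set_decode x)) = enc B"
        using B unfolding can.children_def by auto
      then obtain C where C: "C \<in> S" "x = enc C"
        by (auto simp: canonical_tree_def family_def)
      then have "cover n S C = B" using x(3) par_enc enc_inj cover(1) B(1) by metis
      then show "x \<in> enc ` below_cover B" using C by (auto simp: below_cover_def)
    qed
    show "enc ` below_cover B \<subseteq> can.children v"
      using enc_not_root par_enc B unfolding below_cover_def can.children_def by auto
  qed
  have "inj_on enc (below_cover B)" using enc_inj S_fam by (auto simp: inj_on_def below_cover_def)
  then have deg: "card {e \<in> edges canon. v \<in> e} = card (below_cover B) + (if v = enc full then 0 else 1)"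
    unfolding can.degree[OF v] ch by (simp add: card_image)
  have w0: "0 \<le> sum w M" using w_pos by (intro sum_nonneg) (simp add: less_imp_le)
  have fin: "finite (below_cover B)" using finite_S by (simp add: below_cover_def)
  consider "below_cover B = {}" | C where "below_cover B = {C}" | "2 \<le> card (below_cover B)"
    using fin by (metis One_nat_def Suc_1 card_0_eq card_1_singletonE less_2_cases not_less)
  then have "2 < real (card (below_cover B)) + (if v = enc full then 0 else 1) + sum w M"
  proof cases
    case 1
    then have BM: "B \<subseteq> M" using own by auto
    show ?thesis
    proof (cases "B = full")
      case True
      \<comment> \<open>The marks \<open>1\<close> and \<open>2\<close> are heavy as
        \<open>2 \<le> m\<close>, and a third mark lifts the sum above \<open>2\<close>.\<close>
      then have "sum w M = w 1 + w 2 + sum w (full - {1, 2})"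
        using BM M n by (subst sum.subset_diff[of "{1, 2}"]) auto
      moreover have "w 3 \<le> sum w (full - {1, 2})" using n by (intro sum_w_ge) auto
      ultimately have "2 < sum w M" using w_pos[of 3] m by (simp add: w_heavy)
      then show ?thesis using 1 by auto
    next
      case False
      then have BS: "B \<in> S" using B by (simp add: family_def)
      obtain i where i: "i \<in> B" "i \<le> m" using S_props(4)[OF BS] by blast
      have "\<not> B \<subseteq> {i}" using S_props(2)[OF BS] card_mono[of "{i}" B] by auto
      then obtain k where k: "k \<in> B" "k \<noteq> i" by auto
      have "w i + w k \<le> sum w M" using sum_w_ge(2)[OF M, of i k] i k BM by auto
      then show ?thesis using enc_not_root[OF BS] B w_heavy[OF i(2)] w_pos[of k] by auto
    qed
  next
    case (2 C)
    then have C: "C \<in> S" "cover n S C = B" by (auto simp: below_cover_def)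
    have CB: "C \<subset> B" using cover(2)[OF C(1)] C(2) by simp
    have own': "i \<in> M" if "i \<in> B" "i \<notin> C" for i using own[of i] 2 that by auto
    show ?thesis
    proof (cases "B = full")
      case True
      have "1 \<in> M" using own' True S_props(1)[OF C(1)] n by force
      obtain i where i: "i \<in> {2..n}" "i \<notin> C" using S_props(1,3)[OF C(1)] by blast
      then have "i \<in> M" "i \<noteq> 1" using own' True by auto
      then have "w 1 + w i \<le> sum w M" using sum_w_ge(2)[OF M] \<open>1 \<in> M\<close> by blast
      then show ?thesis using 2 w_heavy[of 1] w_pos[of i] m by simp
    next
      case False
      then have BS: "B \<in> S" using B by (simp add: family_def)
      obtain i where "i \<in> M" using own' CB by blast
      then have "w i \<le> sum w M" using sum_w_ge(1)[OF M] by blast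
      then show ?thesis using enc_not_root[OF BS] B 2 w_pos[of i] by simp
    qed
  next
    case 3
    show ?thesis
    proof (cases "B = full")
      case True
      have "1 \<in> M" using True canon_root n by (simp add: M_def)
      then have "w 1 \<le> sum w M" using sum_w_ge(1)[OF M] by blast
      then show ?thesis using 3 w_heavy[of 1] m by (auto split: if_splits)
    next
      case False
      then have BS: "B \<in> S" using B by (simp add: family_def)
      then show ?thesis using 3 w0 enc_not_root[OF BS] B by simp
    qed
  qed
  then show "2 < real (card {e \<in> edges canon. v \<in> e}) + (\<Sum>i | i \<in> {1..n} \<and> mark canon i = v. w i)"
  proof -
    assume "2 < real (card (below_cover B)) + (if v = enc full then 0 else 1) + sum w M"
    moreover have "{i. i \<in> {1..n} \<and> mark canon i = v} = M" by (simp add: M_def B(2))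
    ultimately show ?thesis unfolding deg by (simp split: if_splits)
  qed
qed

sublocale can: stable n m \<epsilon> canon "enc full"
  "\<lambda>x. enc (cover n S (set_decode x))" "\<lambda>x. n - card (set_decode x)"
  by unfold_locales (rule canon_root, rule canon_stable)

lemma can_desc: assumes B: "B \<in> fam" shows "can.desc (enc B) = B"
proof -
  have "(mark canon i, enc B) \<in> can.up\<^sup>* \<longleftrightarrow> i \<in> B" if i: "i \<in> full" for i
    unfolding mark_canon[OF i] using can_up[OF smallest(1) B, of "{i}"] smallest_iff[OF i B] i by blast
  then show ?thesis unfolding can.desc_def using fam_sub[OF B] by blast
qed

lemma canon_splits: "split_of n canon ` edges canon = S"
proof -
  have "verts canon - {enc full} = enc ` S"
    using enc_not_root by (auto simp: canonical_tree_def family_def)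
  then show ?thesis unfolding can.split_image using can_desc S_fam by (simp add: image_image)
qed

end

section \<open>Contractions\<close>

text \<open>In a stable tree at most one edge has the split \<open>A\<close>. The sum form gives
  \<open>0\<close> when there is none and is visibly continuous in the lengths.\<close>

definition split_lengths :: "nat \<Rightarrow> marked_tree \<times> (nat set \<Rightarrow> real) \<Rightarrow> nat set \<Rightarrow> real" where
  "split_lengths n p A = (\<Sum>e | e \<in> edges (fst p) \<and> split_of n (fst p) e = A. snd p e)"

text \<open>Contracted edges would join the end points of two kept edges with the same image, and so
  produce a detour around one of them.\<close>

lemma contraction_edges:
  assumes T: "is_tree (verts T) (edges T)" and c: "is_contraction n Z f T T'"
  shows "inj_on (image f) (edges T - Z)"
proof (rule inj_onI)
  fix e e' assume e: "e \<in> edges T - Z" "e' \<in> edges T - Z" "f ` e = f ` e'"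
  have ET: "edges T \<subseteq> {{u, v} | u v. u \<in> verts T \<and> v \<in> verts T \<and> u \<noteq> v}"
    using T by (simp add: is_tree_def)
  obtain u v where uv: "e = {u, v}" "u \<in> verts T" "v \<in> verts T" using ET e(1) by blast
  obtain x y where xy: "e' = {x, y}" "x \<in> verts T" "y \<in> verts T" using ET e(2) by blast
  have Z: "Z \<subseteq> edges T" and f: "\<And>a b. a \<in> verts T \<Longrightarrow> b \<in> verts T \<Longrightarrow> f a = f b \<longleftrightarrow> (a, b) \<in> (adjacency Z)\<^sup>*"
    using c by (auto simp: is_contraction_def)
  show "e = e'"
  proof (rule ccontr)
    assume ne: "e \<noteq> e'"
    let ?F = "edges T - {{u, v}}"
    have ZF: "Z \<subseteq> ?F" using Z e uv by auto
    have e'F: "(x, y) \<in> (adjacency ?F)\<^sup>*" using e xy uv ne by (auto simp: adjacency_def)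
    have "f u = f x \<and> f v = f y \<or> f u = f y \<and> f v = f x"
      using e(3) by (auto simp: uv xy doubleton_eq_iff)
    then have "(u, v) \<in> (adjacency ?F)\<^sup>*"
    proof
      assume "f u = f x \<and> f v = f y"
      then have "(u, x) \<in> (adjacency ?F)\<^sup>*" "(y, v) \<in> (adjacency ?F)\<^sup>*"
        using f uv xy adjacency_mono[OF ZF] adjacency_sym by metis+
      then show ?thesis using e'F by (meson rtrancl_trans)
    next
      assume "f u = f y \<and> f v = f x"
      then have "(u, y) \<in> (adjacency ?F)\<^sup>*" "(x, v) \<in> (adjacency ?F)\<^sup>*"
        using f uv xy adjacency_mono[OF ZF] adjacency_sym by metis+
      then show ?thesis using adjacency_sym[OF e'F] by (meson rtrancl_trans)
    qed
    then show False using tree_bridge[OF T, of u v] e uv by auto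
  qed
qed

text \<open>Paths avoiding \<open>e\<close> project, contracted edges becoming constant. Conversely,
  edges of the image lift to kept edges, and the fibres of \<open>f\<close> are connected through
  contracted edges, none of which is \<open>e\<close>.\<close>

lemma contraction_split:
  assumes T: "is_tree (verts T) (edges T)" and c: "is_contraction n Z f T T'"
    and m: "\<And>i. i \<in> {1..n} \<Longrightarrow> mark T i \<in> verts T" and n: "1 \<le> n" and e: "e \<in> edges T - Z"
  shows "split_of n T' (f ` e) = split_of n T e"
proof -
  have ET: "edges T \<subseteq> {{u, v} | u v. u \<in> verts T \<and> v \<in> verts T \<and> u \<noteq> v}"
    using T by (simp add: is_tree_def)
  have Z: "Z \<subseteq> edges T" and f: "\<And>a b. a \<in> verts T \<Longrightarrow> b \<in> verts T \<Longrightarrow> f a = f b \<longleftrightarrow> (a, b) \<in> (adjacency Z)\<^sup>*"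
    and E': "edges T' = image f ` (edges T - Z)" and m': "\<And>i. i \<in> {1..n} \<Longrightarrow> mark T' i = f (mark T i)"
    using c by (auto simp: is_contraction_def)
  note inj = contraction_edges[OF T c]
  have fwd: "(f a, f b) \<in> (adjacency (edges T' - {f ` e}))\<^sup>*"
    if "(a, b) \<in> (adjacency (edges T - {e}))\<^sup>*" for a b
    using that
  proof (induction rule: rtrancl_induct)
    case (step x y)
    then have xy: "{x, y} \<in> edges T" "{x, y} \<noteq> e" by (auto simp: adjacency_def)
    have v: "x \<in> verts T" "y \<in> verts T"
    proof -
      obtain u v where "{x, y} = {u, v}" "u \<in> verts T" "v \<in> verts T" using ET xy by blast
      then show "x \<in> verts T" "y \<in> verts T" by (auto simp: doubleton_eq_iff)
    qed
    show ?case
    proof (cases "{x, y} \<in> Z")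
      case True
      then have "f x = f y" using f v by (auto simp: adjacency_def)
      then show ?thesis using step by simp
    next
      case False
      then have "f ` {x, y} \<noteq> f ` e" using inj_onD[OF inj, of "{x, y}" e] xy e by blast
      moreover have "f ` {x, y} \<in> edges T'" unfolding E' using xy False by (intro imageI) simp
      ultimately have "(f x, f y) \<in> adjacency (edges T' - {f ` e})" by (simp add: adjacency_def)
      then show ?thesis using step by (meson rtrancl_into_rtrancl)
    qed
  qed simp
  have "Z \<subseteq> edges T - {e}" using Z e by auto
  note mono = adjacency_mono[OF this]
  have fib: "(a, b) \<in> (adjacency (edges T - {e}))\<^sup>*" if "a \<in> verts T" "b \<in> verts T" "f a = f b" for a b
    using f[OF that(1,2)] that(3) mono by simp
  have bwd: "\<forall>a b. a \<in> verts T \<and> b \<in> verts T \<and> f a = p \<and> f b = q \<longrightarrow> (a, b) \<in> (adjacency (edges T - {e}))\<^sup>*"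
    if "(p, q) \<in> (adjacency (edges T' - {f ` e}))\<^sup>*" for p q
    using that
  proof (induction rule: rtrancl_induct)
    case base
    show ?case using fib by simp
  next
    case (step q s)
    show ?case
    proof (intro allI impI)
      fix a b assume ab: "a \<in> verts T \<and> b \<in> verts T \<and> f a = p \<and> f b = s"
      have "{q, s} \<in> edges T'" "{q, s} \<noteq> f ` e" using step by (auto simp: adjacency_def)
      then obtain e' where e': "e' \<in> edges T - Z" "{q, s} = f ` e'" unfolding E' by blast
      then have "e' \<noteq> e" using \<open>{q, s} \<noteq> f ` e\<close> by auto
      obtain u v where "e' = {u, v}" "u \<in> verts T" "v \<in> verts T" using ET e' by blast
      then obtain x y where xy: "e' = {x, y}" "x \<in> verts T" "y \<in> verts T" "f x = q" "f y = s"
        using e'(2) by (auto simp: doubleton_eq_iff insert_commute)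
      have "(a, x) \<in> (adjacency (edges T - {e}))\<^sup>*" using step.IH ab xy by blast
      moreover have "(x, y) \<in> adjacency (edges T - {e})" using e' \<open>e' \<noteq> e\<close> xy by (auto simp: adjacency_def)
      moreover have "(y, b) \<in> (adjacency (edges T - {e}))\<^sup>*"
        using fib xy ab by simp
      ultimately show "(a, b) \<in> (adjacency (edges T - {e}))\<^sup>*"
        by (meson rtrancl_into_rtrancl rtrancl_trans)
    qed
  qed
  have "(mark T' 1, mark T' i) \<in> (adjacency (edges T' - {f ` e}))\<^sup>* \<longleftrightarrow>
      (mark T 1, mark T i) \<in> (adjacency (edges T - {e}))\<^sup>*" if i: "i \<in> {1..n}" for i
  proof -
    have 1: "1 \<in> {1..n}" using n by simp
    show ?thesis unfolding m'[OF i] m'[OF 1] using fwd bwd m[OF i] m[OF 1] by blast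
  qed
  then show ?thesis by (auto simp: split_of_def)
qed

lemma split_lengths_respects:
  assumes T: "is_tree (verts T) (edges T)" and m: "\<And>i. i \<in> {1..n} \<Longrightarrow> mark T i \<in> verts T" and n: "1 \<le> n"
    and fin: "finite (edges T)" and id: "face_identification n (T, l) (T', l')"
  shows "split_lengths n (T, l) = split_lengths n (T', l')"
proof
  fix A
  obtain Z f where c: "is_contraction n Z f T T'" and l: "\<And>e. e \<in> Z \<Longrightarrow> l e = 0"
      "\<And>e. e \<in> edges T - Z \<Longrightarrow> l e = l' (f ` e)"
    using id by (auto simp: face_identification_def)
  have E': "edges T' = image f ` (edges T - Z)" using c by (simp add: is_contraction_def)
  note sp = contraction_split[OF T c m n]
  have "split_lengths n (T', l') A = sum l' (image f ` {e \<in> edges T - Z. split_of n T e = A})"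
  proof -
    have "{e' \<in> edges T'. split_of n T' e' = A} = image f ` {e \<in> edges T - Z. split_of n T e = A}"
      unfolding E' using sp by auto
    then show ?thesis by (simp add: split_lengths_def)
  qed
  also have "\<dots> = (\<Sum>e | e \<in> edges T - Z \<and> split_of n T e = A. l' (f ` e))"
    using contraction_edges[OF T c] by (subst sum.reindex) (auto intro: inj_on_subset simp: o_def)
  also have "\<dots> = (\<Sum>e | e \<in> edges T - Z \<and> split_of n T e = A. l e)"
    using l(2) by (intro sum.cong) auto
  also have "\<dots> = split_lengths n (T, l) A"
    unfolding split_lengths_def fst_conv snd_conv using l(1) fin by (intro sum.mono_neutral_left) auto
  finally show "split_lengths n (T, l) A = split_lengths n (T', l') A" ..
qed

text \<open>A vertex goes to the smallest remaining set that contains its marks. With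
  \<open>S0\<close> all splits, nothing is contracted, and \<open>T\<close> is isomorphic to its
  canonical tree.\<close>

lemma (in stable) contract_canonical:
  assumes S0: "S0 \<subseteq> split_of n T ` edges T"
  shows "\<exists>f. is_contraction n {e \<in> edges T. split_of n T e \<notin> S0} f T (canonical_tree n S0)"
proof -
  have S0': "S0 \<subseteq> desc ` (V - {r})" using S0 split_image by simp
  interpret L: laminar_splits n m \<epsilon> S0
  proof
    show "S0 \<subseteq> splits n m" using S0' desc_splits by blast
    show "laminar S0" unfolding laminar_def using S0' desc_laminar by blast
  qed
  define f where "f v = set_encode (smallest n S0 (desc v))" for v
  let ?Z = "{e \<in> edges T. split_of n T e \<notin> S0}"
  have famV: "\<exists>y\<in>V. C = desc y" if "C \<in> L.fam" for C
    using that S0' rV desc_root by (auto simp: family_def)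
  have dfull: "desc v \<subseteq> L.full" for v by (auto simp: desc_def)
  have edgeZ: "{v, par v} \<in> ?Z \<longleftrightarrow> desc v \<notin> S0" if "v \<in> V" "v \<noteq> r" for v
    using split_edge[OF that] that by (auto simp: E)
  have not_full: "desc v \<noteq> L.full" if "v \<in> V" "v \<noteq> r" for v
    using desc_inj[of v r] that rV desc_root by auto
  have above: "desc v \<subset> C \<longleftrightarrow> desc (par v) \<subseteq> C" if v: "v \<in> V" "v \<noteq> r" and C: "C \<in> L.fam" for v C
  proof -
    obtain y where y: "y \<in> V" "C = desc y" using famV C by blast
    have "desc v \<subset> desc y \<longleftrightarrow> (v, y) \<in> up\<^sup>* \<and> v \<noteq> y"
      using desc_sub_iff[OF v(1) y(1)] desc_inj[OF v(1) y(1)] by auto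
    also have "\<dots> \<longleftrightarrow> (par v, y) \<in> up\<^sup>*"
      using up_par[of v y] par_up[OF v] up_depth[of "par v" y] depth[OF v]
      by (auto intro: converse_rtrancl_into_rtrancl)
    finally show ?thesis using desc_sub_iff[OF parV[OF v] y(1)] y by simp
  qed
  have sm_par: "smallest n S0 (desc (par v)) = smallest n S0 (desc v)" if v: "v \<in> V" "v \<noteq> r" "desc v \<notin> S0" for v
  proof -
    have "desc v \<notin> L.fam" using v not_full by (auto simp: family_def)
    then have "{C \<in> L.fam. desc (par v) \<subseteq> C} = {C \<in> L.fam. desc v \<subseteq> C}"
      using above[OF v(1,2)] by (auto simp: psubset_eq)
    then show ?thesis by (simp add: smallest_def)
  qed
  \<comment> \<open>Climbing through contracted edges ends at the vertex whose own set is the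
    target; it represents the fibre of \<open>f\<close> through \<open>v\<close>.\<close>
  have climb: "\<exists>y\<in>V. desc y = smallest n S0 (desc v) \<and> (v, y) \<in> (adjacency ?Z)\<^sup>*" if "v \<in> V" for v
    using that
  proof (induction "d v" arbitrary: v rule: less_induct)
    case less
    show ?case
    proof (cases "desc v \<in> L.fam")
      case True
      then show ?thesis using L.smallest_fam less.prems by auto
    next
      case False
      have vr: "v \<noteq> r" using False desc_root L.full_fam by auto
      have vS: "desc v \<notin> S0" using False L.S_fam by auto
      obtain y where y: "y \<in> V" "desc y = smallest n S0 (desc (par v))" "(par v, y) \<in> (adjacency ?Z)\<^sup>*"
        using less.hyps[of "par v"] depth[OF less.prems vr] parV[OF less.prems vr] by blast
      have "(v, par v) \<in> adjacency ?Z" using edgeZ[OF less.prems vr] vS by (simp add: adjacency_def)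
      then have "(v, y) \<in> (adjacency ?Z)\<^sup>*" using y(3) by (rule converse_rtrancl_into_rtrancl)
      then show ?thesis using y(1,2) sm_par[OF less.prems vr vS] by (intro bexI[of _ y]) simp_all
    qed
  qed
  have sm: "smallest n S0 (desc v) \<in> L.fam" if "v \<in> V" for v
    using L.smallest(1) desc_nonempty[OF that] dfull by blast
  have f_eq: "f u = f v \<longleftrightarrow> (u, v) \<in> (adjacency ?Z)\<^sup>*" if uv: "u \<in> V" "v \<in> V" for u v
  proof
    assume "f u = f v"
    then have eq: "smallest n S0 (desc u) = smallest n S0 (desc v)"
      unfolding f_def using L.enc_inj sm uv by blast
    obtain x where x: "x \<in> V" "desc x = smallest n S0 (desc u)" "(u, x) \<in> (adjacency ?Z)\<^sup>*"
      using climb[OF uv(1)] by blast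
    obtain y where y: "y \<in> V" "desc y = smallest n S0 (desc v)" "(v, y) \<in> (adjacency ?Z)\<^sup>*"
      using climb[OF uv(2)] by blast
    have "x = y" using desc_inj x y eq by simp
    then show "(u, v) \<in> (adjacency ?Z)\<^sup>*" using x(3) adjacency_sym[OF y(3)] by (meson rtrancl_trans)
  next
    assume "(u, v) \<in> (adjacency ?Z)\<^sup>*"
    then show "f u = f v"
    proof (induction rule: rtrancl_induct)
      case (step x y)
      then have Z: "{x, y} \<in> ?Z" by (simp add: adjacency_def)
      then obtain v where v: "v \<in> V" "v \<noteq> r" "{x, y} = {v, par v}" using E by auto
      have "desc v \<notin> S0" using Z unfolding v(3) edgeZ[OF v(1,2)] .
      then have "f v = f (par v)" using sm_par v by (simp add: f_def)
      then have "f x = f y" using v(3) by (auto simp: doubleton_eq_iff)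
      then show ?case using step by simp
    qed simp
  qed
  have verts: "verts (canonical_tree n S0) = f ` V"
  proof -
    have "L.fam = (\<lambda>v. smallest n S0 (desc v)) ` V"
    proof
      show "L.fam \<subseteq> (\<lambda>v. smallest n S0 (desc v)) ` V"
      proof
        fix C assume C: "C \<in> L.fam"
        then obtain y where "y \<in> V" "C = desc y" using famV by blast
        then show "C \<in> (\<lambda>v. smallest n S0 (desc v)) ` V" using L.smallest_fam[OF C] by (metis image_eqI)
      qed
    qed (use sm in auto)
    then show ?thesis by (simp add: canonical_tree_def f_def image_image)
  qed
  have fpar: "f ` {v, par v} = {set_encode (desc v), set_encode (cover n S0 (desc v))}"
    if v: "v \<in> V" "v \<noteq> r" "desc v \<in> S0" for v
  proof -
    have "cover n S0 (desc v) = smallest n S0 (desc (par v))"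
      unfolding cover_def smallest_def using above[OF v(1,2)] by (intro arg_cong[of _ _ Inter]) auto
    then show ?thesis using L.smallest_fam[OF L.S_fam[OF v(3)]] by (simp add: f_def)
  qed
  have edges: "edges (canonical_tree n S0) = image f ` (edges T - ?Z)"
  proof -
    let ?V0 = "{v \<in> V - {r}. desc v \<in> S0}"
    have "edges T - ?Z = (\<lambda>v. {v, par v}) ` ?V0"
    proof -
      have "edges T - ?Z = {e \<in> edges T. split_of n T e \<in> S0}" by auto
      also have "\<dots> = (\<lambda>v. {v, par v}) ` ?V0" using split_edge by (auto simp: E)
      finally show ?thesis .
    qed
    then have "image f ` (edges T - ?Z) = (\<lambda>v. f ` {v, par v}) ` ?V0" by (simp only: image_image)
    also have "\<dots> = (\<lambda>v. {set_encode (desc v), set_encode (cover n S0 (desc v))}) ` ?V0"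
      using fpar by (intro image_cong) auto
    also have "\<dots> = (\<lambda>B. {set_encode B, set_encode (cover n S0 B)}) ` (desc ` ?V0)"
      by (simp only: image_image)
    also have "desc ` ?V0 = S0" using S0' by auto
    finally show ?thesis by (simp add: canonical_tree_def)
  qed
  have marks: "mark (canonical_tree n S0) i = f (mark T i)" if i: "i \<in> {1..n}" for i
  proof -
    have "i \<in> C \<longleftrightarrow> desc (mark T i) \<subseteq> C" if C: "C \<in> L.fam" for C
    proof -
      obtain y where y: "y \<in> V" "C = desc y" using famV[OF C] by blast
      show ?thesis unfolding y(2) desc_sub_iff[OF mark_V[OF i] y(1)] using i by (simp add: desc_def)
    qed
    then have "smallest n S0 {i} = smallest n S0 (desc (mark T i))"
      unfolding smallest_def by (intro arg_cong[of _ _ Inter]) auto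
    then show ?thesis unfolding L.mark_canon[OF i] f_def by simp
  qed
  show ?thesis
    unfolding is_contraction_def using verts f_eq edges marks by (intro exI[of _ f]) auto
qed

section \<open>The complex as the base of a cone\<close>

lemma tree_cone_scale:
  assumes "x \<in> tree_cone n m" "0 < c"
  shows "(\<lambda>A. c * x A) \<in> tree_cone n m"
  using assms by (simp add: tree_cone_def)

text \<open>\<open>S\<close> may be larger than the support of \<open>x\<close>: zero lengths are
  allowed, so that one tree serves a whole closed set of points.\<close>

definition canonical_point :: "nat \<Rightarrow> nat set set \<Rightarrow> (nat set \<Rightarrow> real) \<Rightarrow> marked_tree \<times> (nat set \<Rightarrow> real)" where
  "canonical_point n S x = (canonical_tree n S,
     restrict (\<lambda>e. x (split_of n (canonical_tree n S) e)) (edges (canonical_tree n S)))"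

section \<open>The complex and the slice of total length one\<close>

context weights
begin

abbreviation Z where "Z \<equiv> sum_topology length_simplex {T. is_stable_tree n w T}"
abbreviation pt where "pt \<equiv> glue_class Z (face_identification n)"
abbreviation supp :: "(nat set \<Rightarrow> real) \<Rightarrow> nat set set" where "supp x \<equiv> {A. x A \<noteq> 0}"

definition total :: "(nat set \<Rightarrow> real) \<Rightarrow> real" where "total x = sum x (splits n m)"

definition normalized :: "(nat set \<Rightarrow> real) set" where
  "normalized = {x \<in> tree_cone n m. total x = 1}"

lemma topspace_Z: "(T, l) \<in> topspace Z \<longleftrightarrow> is_stable_tree n w T \<and>
    l \<in> extensional (edges T) \<and> (\<forall>e\<in>edges T. 0 \<le> l e) \<and> sum l (edges T) = 1"
  by (auto simp: length_simplex_def PiE_def)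

lemma total_supp:
  assumes "x \<in> tree_cone n m" "supp x \<subseteq> S" "S \<subseteq> splits n m"
  shows "sum x S = total x"
  unfolding total_def using assms by (intro sum.mono_neutral_left) auto

lemma canonical_point_in:
  assumes S: "S \<subseteq> splits n m" "laminar S" and x: "x \<in> normalized" "supp x \<subseteq> S"
  shows "canonical_point n S x \<in> topspace Z"
    and "split_lengths n (canonical_point n S x) = x"
proof -
  interpret laminar_splits n m \<epsilon> S using S by unfold_locales
  have xs: "x \<in> tree_cone n m" "total x = 1" using x by (auto simp: normalized_def)
  have "(\<Sum>e\<in>edges canon. x (split_of n canon e)) = sum x (split_of n canon ` edges canon)"
    using can.split_inj by (subst sum.reindex) (auto simp: o_def)
  also have "\<dots> = 1" unfolding canon_splits using total_supp[OF xs(1) x(2) S(1)] xs(2) by simp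
  finally show "canonical_point n S x \<in> topspace Z"
    unfolding canonical_point_def topspace_Z using canon_stable tree_cone_nonneg[OF xs(1)] by simp
  show "split_lengths n (canonical_point n S x) = x"
  proof
    fix A
    show "split_lengths n (canonical_point n S x) A = x A"
    proof (cases "A \<in> S")
      case True
      then have "A \<in> split_of n canon ` edges canon" using canon_splits by simp
      then obtain e where e: "e \<in> edges canon" "split_of n canon e = A" by blast
      then have "{e \<in> edges canon. split_of n canon e = A} = {e}"
        using can.split_inj by (auto simp: inj_on_def)
      then show ?thesis using e by (simp add: split_lengths_def canonical_point_def)
    next
      case False
      then have "{e \<in> edges canon. split_of n canon e = A} = {}" using canon_splits by auto
      moreover have "x A = 0" using False x(2) by auto
      ultimately show ?thesis unfolding split_lengths_def canonical_point_def fst_conv by (simp only: sum.empty)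
    qed
  qed
qed

text \<open>Contracting the edges of length zero turns \<open>T\<close> into the canonical tree of
  the support. So a point of the complex is determined by its split lengths.\<close>

lemma split_lengths_point:
  assumes p: "(T, l) \<in> topspace Z"
  shows "split_lengths n (T, l) \<in> normalized"
    and "pt (T, l) = pt (canonical_point n (supp (split_lengths n (T, l))) (split_lengths n (T, l)))"
proof -
  have T: "is_stable_tree n w T" and l: "\<And>e. e \<in> edges T \<Longrightarrow> 0 \<le> l e" "sum l (edges T) = 1"
    using p unfolding topspace_Z by auto
  obtain r par d where "stable n m \<epsilon> T r par d"
    using stable_tree_rooted[OF weights_axioms T] .
  then interpret stable n m \<epsilon> T r par d .
  define x where "x = split_lengths n (T, l)"
  have xe: "x (split_of n T e) = l e" if "e \<in> edges T" for e
  proof -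
    have "{e' \<in> edges T. split_of n T e' = split_of n T e} = {e}"
      using split_inj that by (auto simp: inj_on_def)
    then show ?thesis by (simp add: x_def split_lengths_def)
  qed
  have x0: "x A = 0" if "A \<notin> split_of n T ` edges T" for A
  proof -
    have "{e \<in> edges T. split_of n T e = A} = {}" using that by auto
    then show ?thesis unfolding x_def split_lengths_def fst_conv by (simp only: sum.empty)
  qed
  have sub: "supp x \<subseteq> split_of n T ` edges T" using x0 by auto
  have sp: "split_of n T ` edges T \<subseteq> splits n m" unfolding split_image using desc_splits by auto
  have lam: "laminar (supp x)"
    using sub desc_laminar unfolding split_image laminar_def by blast
  have "0 \<le> x A" for A
    unfolding x_def split_lengths_def using l(1) by (intro sum_nonneg) auto
  then have tc: "x \<in> tree_cone n m" using sub sp lam by (auto simp: tree_cone_def)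
  have "total x = sum x (split_of n T ` edges T)" using total_supp[OF tc sub sp] by simp
  also have "\<dots> = (\<Sum>e\<in>edges T. x (split_of n T e))" using split_inj by (subst sum.reindex) (auto simp: o_def)
  also have "\<dots> = 1" using l(2) xe by simp
  finally have xs: "x \<in> normalized" using tc by (simp add: normalized_def)
  then show "split_lengths n (T, l) \<in> normalized" by (simp add: x_def)
  obtain f where f: "is_contraction n {e \<in> edges T. split_of n T e \<notin> supp x} f T (canonical_tree n (supp x))"
    using contract_canonical[OF sub] by blast
  let ?Z = "{e \<in> edges T. split_of n T e \<notin> supp x}"
  have E': "edges (canonical_tree n (supp x)) = image f ` (edges T - ?Z)"
    using f unfolding is_contraction_def by blast
  have "face_identification n (T, l) (canonical_point n (supp x) x)"
    unfolding face_identification_def canonical_point_def prod.case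
  proof (intro exI conjI ballI)
    show "is_contraction n ?Z f T (canonical_tree n (supp x))" by (rule f)
    show "l e = 0" if "e \<in> ?Z" for e using that xe by auto
    fix e assume e: "e \<in> edges T - ?Z"
    then have "f ` e \<in> edges (canonical_tree n (supp x))" unfolding E' by (rule imageI)
    moreover have "split_of n (canonical_tree n (supp x)) (f ` e) = split_of n T e"
      using n mark_V by (intro contraction_split[OF is_tree f _ _ e]) auto
    ultimately show "l e = restrict (\<lambda>e. x (split_of n (canonical_tree n (supp x)) e))
        (edges (canonical_tree n (supp x))) (f ` e)"
      using xe e by simp
  qed
  moreover have "canonical_point n (supp x) x \<in> topspace Z"
    using sub sp lam xs by (intro canonical_point_in) auto
  ultimately have "pt (T, l) = pt (canonical_point n (supp x) x)"
    by (intro glue_class_eqI p)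
  then show "pt (T, l) = pt (canonical_point n (supp (split_lengths n (T, l))) (split_lengths n (T, l)))"
    by (simp add: x_def)
qed

lemma total_pos:
  assumes "x \<in> tree_cone n m - {\<lambda>_. 0}"
  shows "0 < total x"
proof -
  have x: "x \<in> tree_cone n m" using assms by blast
  obtain A where A: "x A \<noteq> 0" using assms by auto
  show ?thesis unfolding total_def
    by (rule sum_pos2[of _ A]) (use A tree_cone_nonneg[OF x] tree_cone_splits[OF x A] in \<open>auto simp: less_le\<close>)
qed

lemma normalize_in:
  assumes "x \<in> tree_cone n m - {\<lambda>_. 0}"
  shows "(\<lambda>A. x A / total x) \<in> normalized"
proof -
  have t: "0 < 1 / total x" using total_pos[OF assms] by simp
  have "(\<lambda>A. 1 / total x * x A) \<in> tree_cone n m" using assms t by (intro tree_cone_scale) auto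
  moreover have "total (\<lambda>A. x A / total x) = 1"
    using total_pos[OF assms] unfolding total_def by (simp add: sum_divide_distrib[symmetric])
  ultimately show ?thesis by (simp add: normalized_def)
qed

text \<open>The split lengths identify the complex with the slice of total length one:
  \<open>\<psi> \<circ> \<theta>\<close> is the identity, and \<open>\<theta> \<circ> \<psi>\<close>
  is the radial projection to the slice.\<close>

theorem Delta_0_tree_cone:
  "Delta_0 n w homotopy_equivalent_space top_of_set (tree_cone n m - {\<lambda>_. 0})"
proof -
  let ?C = "tree_cone n m - {\<lambda>_. 0}"
  define D where "D = Delta_0 n w"
  have qm: "quotient_map Z D pt"
    unfolding D_def Delta_0_def by (rule quotient_map_glue_class)
  have sC: "normalized \<subseteq> ?C"
    by (auto simp: normalized_def total_def)
  have h: "continuous_map Z (top_of_set ?C) (split_lengths n)"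
  proof (rule continuous_map_from_sum_topology)
    fix T assume T: "T \<in> {T. is_stable_tree n w T}"
    obtain r par d where "stable n m \<epsilon> T r par d"
      using stable_tree_rooted[OF weights_axioms] T by blast
    then interpret stable n m \<epsilon> T r par d .
    have "continuous_map (length_simplex T) euclideanreal (\<lambda>l. split_lengths n (T, l) A)" for A
      unfolding split_lengths_def fst_conv snd_conv length_simplex_def
      using finite_edges by (intro continuous_map_sum continuous_map_from_subtopology
          continuous_map_product_projection) auto
    then have "continuous_map (length_simplex T) euclidean (\<lambda>l. split_lengths n (T, l))"
      unfolding euclidean_product_topology[symmetric] continuous_map_componentwise_UNIV by blast
    moreover have "split_lengths n (T, l) \<in> ?C" if "l \<in> topspace (length_simplex T)" for l
      using split_lengths_point(1)[of T l] sC T that by auto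
    ultimately show "continuous_map (length_simplex T) (top_of_set ?C) (\<lambda>l. split_lengths n (T, l))"
      by (intro continuous_map_into_subtopology) auto
  qed
  have resp: "split_lengths n p = split_lengths n p'"
    if p: "p \<in> topspace Z" "p' \<in> topspace Z" "face_identification n p p'" for p p'
  proof -
    obtain T l T' l' where pp: "p = (T, l)" "p' = (T', l')" by fastforce
    have T: "is_stable_tree n w T" using p(1) unfolding pp topspace_Z by blast
    obtain r par d where "stable n m \<epsilon> T r par d"
      using stable_tree_rooted[OF weights_axioms T] .
    then interpret stable n m \<epsilon> T r par d .
    show ?thesis unfolding pp
      using n mark_V finite_edges p(3) pp by (intro split_lengths_respects is_tree) auto
  qed
  obtain \<theta> where \<theta>: "continuous_map D (top_of_set ?C) \<theta>"
      "\<And>p. p \<in> topspace Z \<Longrightarrow> \<theta> (pt p) = split_lengths n p"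
  proof (rule quotient_map_lift_exists[OF qm h])
    show "split_lengths n p = split_lengths n p'" if "pt p = pt p'" for p p'
      by (rule glue_class_respects[OF resp that])
  qed (use that in blast)

  define F where "F S x = pt (canonical_point n S (\<lambda>A. x A / total x))" for S x
  define \<psi> where "\<psi> x = F (supp x) x" for x
  have laminar_supp: "supp x \<subseteq> splits n m" "laminar (supp x)" if "x \<in> tree_cone n m" for x
    using that by (auto simp: tree_cone_def)
  \<comment> \<open>A larger \<open>S\<close> only adds edges of length zero, which the gluing
    contracts.\<close>
  have F: "F S x = \<psi> x" if "x \<in> ?C" "supp x \<subseteq> S" "S \<subseteq> splits n m" "laminar S" for S x
  proof -
    let ?y = "\<lambda>A. x A / total x"
    have t: "total x \<noteq> 0" using total_pos[OF that(1)] by simp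
    then have sy: "supp ?y = supp x" by simp
    have y: "?y \<in> normalized" by (rule normalize_in[OF that(1)])
    have c: "canonical_point n S ?y \<in> topspace Z" "split_lengths n (canonical_point n S ?y) = ?y"
      by (rule canonical_point_in[OF that(3,4) y]; use that(2) sy in blast)+
    obtain T l where Tl: "canonical_point n S ?y = (T, l)" by fastforce
    show ?thesis
      using split_lengths_point(2)[of T l] c unfolding Tl F_def \<psi>_def by (simp only: sy)
  qed
  have \<psi>: "continuous_map (top_of_set ?C) D \<psi>"
  \<comment> \<open>There are finitely many laminar \<open>S\<close>, and a support inside
    \<open>S\<close> is a closed condition; so continuity can be checked on one tree at a
    time.\<close>
  proof (rule pasting_lemma_closed[where I = "{S. S \<subseteq> splits n m \<and> laminar S}"
        and T = "\<lambda>S. {x \<in> ?C. supp x \<subseteq> S}" and f = F])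
    show "finite {S. S \<subseteq> splits n m \<and> laminar S}"
      by (rule finite_subset[of _ "Pow (splits n m)"]) auto
    fix S assume S: "S \<in> {S. S \<subseteq> splits n m \<and> laminar S}"
    interpret laminar_splits n m \<epsilon> S using S by unfold_locales auto
    have "closed {x :: nat set \<Rightarrow> real. \<forall>A. A \<notin> S \<longrightarrow> x A = 0}"
      by (intro closed_Collect_all closed_Collect_imp closed_Collect_eq continuous_on_apply
          continuous_on_const) simp
    then have "closedin (top_of_set ?C) (?C \<inter> {x. \<forall>A. A \<notin> S \<longrightarrow> x A = 0})"
      by (rule closedin_closed_Int)
    also have "?C \<inter> {x. \<forall>A. A \<notin> S \<longrightarrow> x A = 0} = {x \<in> ?C. supp x \<subseteq> S}" by auto
    finally show "closedin (top_of_set ?C) {x \<in> ?C. supp x \<subseteq> S}" .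
    let ?K = "{x \<in> ?C. supp x \<subseteq> S}"
    let ?g = "\<lambda>x. restrict (\<lambda>e. x (split_of n canon e) / total x) (edges canon)"
    have "continuous_map (top_of_set ?K) (powertop_real (edges canon)) ?g"
      unfolding continuous_map_componentwise
    proof (intro conjI ballI)
      fix e assume e: "e \<in> edges canon"
      have "continuous_on ?K (\<lambda>x. x (split_of n canon e) / total x)"
        unfolding total_def
      proof (intro continuous_on_divide continuous_on_sum continuous_on_apply ballI)
        fix x assume "x \<in> ?K"
        then show "sum x (splits n m) \<noteq> 0" using total_pos[of x] by (auto simp: total_def)
      qed
      then show "continuous_map (top_of_set ?K) euclideanreal (\<lambda>x. ?g x e)" using e by simp
    qed auto
    moreover have pin: "(canon, ?g x) \<in> topspace Z" if "x \<in> ?K" for x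
    proof -
      have "supp (\<lambda>A. x A / total x) \<subseteq> S" using that by auto
      moreover have "(\<lambda>A. x A / total x) \<in> normalized" using that by (intro normalize_in) simp
      ultimately have "canonical_point n S (\<lambda>A. x A / total x) \<in> topspace Z"
        using canonical_point_in(1)[OF S lam] by blast
      then show ?thesis by (simp only: canonical_point_def)
    qed
    then have "?g x \<in> {l. (\<forall>e\<in>edges canon. 0 \<le> l e) \<and> sum l (edges canon) = 1}" if "x \<in> ?K" for x
      using that unfolding topspace_Z by blast
    ultimately have "continuous_map (top_of_set ?K) (length_simplex canon) ?g"
      unfolding length_simplex_def by (intro continuous_map_into_subtopology) auto
    then have "continuous_map (top_of_set ?K) D (pt \<circ> ((\<lambda>l. (canon, l)) \<circ> ?g))"
      using canon_stable
      by (intro continuous_map_compose[OF _ quotient_imp_continuous_map[OF qm]]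
          continuous_map_compose[OF _ continuous_map_component_injection]) auto
    moreover have "subtopology (top_of_set ?C) ?K = top_of_set ?K"
    proof -
      have "?C \<inter> ?K = ?K" by auto
      then show ?thesis by (simp only: subtopology_subtopology)
    qed
    ultimately show "continuous_map (subtopology (top_of_set ?C) ?K) D (F S)"
      by (simp add: F_def[abs_def] canonical_point_def o_def)
  next
    fix S S' x assume "S \<in> {S. S \<subseteq> splits n m \<and> laminar S}" "S' \<in> {S. S \<subseteq> splits n m \<and> laminar S}"
      "x \<in> topspace (top_of_set ?C) \<inter> {x \<in> ?C. supp x \<subseteq> S} \<inter> {x \<in> ?C. supp x \<subseteq> S'}"
    then show "F S x = F S' x" using F[of x S] F[of x S'] by simp
  next
    fix x assume "x \<in> topspace (top_of_set ?C)"
    then show "\<exists>S. S \<in> {S. S \<subseteq> splits n m \<and> laminar S} \<and> x \<in> {x \<in> ?C. supp x \<subseteq> S} \<and> \<psi> x = F S x"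
      using laminar_supp[of x] by (intro exI[of _ "supp x"]) (auto simp: \<psi>_def)
  qed

  have "\<psi> (\<theta> c) = c" if "c \<in> topspace D" for c
  proof -
    have "c \<in> pt ` topspace Z" using that quotient_imp_surjective_map[OF qm] by simp
    then obtain T l where c: "c = pt (T, l)" "(T, l) \<in> topspace Z" by fastforce
    let ?x = "split_lengths n (T, l)"
    have "total ?x = 1" using split_lengths_point(1)[OF c(2)] by (simp add: normalized_def)
    then show ?thesis
      unfolding c(1) \<theta>(2)[OF c(2)] \<psi>_def F_def using split_lengths_point(2)[OF c(2)] by simp
  qed
  note \<psi>\<theta> = this
  have 1: "homotopic_with (\<lambda>_. True) D D (\<psi> \<circ> \<theta>) id"
    by (rule homotopic_with_id2[of D \<psi> \<theta>, OF \<psi>\<theta>])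
  have "\<theta> (\<psi> x) = (\<lambda>A. x A / total x)" if x: "x \<in> ?C" for x
  proof -
    have "supp (\<lambda>A. x A / total x) \<subseteq> supp x" by auto
    then have "canonical_point n (supp x) (\<lambda>A. x A / total x) \<in> topspace Z"
      "split_lengths n (canonical_point n (supp x) (\<lambda>A. x A / total x)) = (\<lambda>A. x A / total x)"
      using canonical_point_in[OF laminar_supp normalize_in[OF x]] x by auto
    then show ?thesis unfolding \<psi>_def F_def by (simp add: \<theta>(2))
  qed
  note \<theta>\<psi> = this
  have 2: "homotopic_with_canon (\<lambda>_. True) ?C ?C id (\<theta> \<circ> \<psi>)"
  proof (subst homotopic_with)
    \<comment> \<open>Scaling along rays by a positive factor that runs from \<open>1\<close> to
      \<open>1 / total\<close>.\<close>
    let ?H = "\<lambda>p. \<lambda>A. (1 - fst p + fst p / total (snd p)) * snd p A"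
    have "continuous_on ({0..1::real} \<times> ?C) ?H"
      unfolding total_def
    proof (intro continuous_on_coordinatewise_then_product cont_intros continuous_on_divide ballI)
      fix p :: "real \<times> (nat set \<Rightarrow> real)" assume "p \<in> {0..1} \<times> ?C"
      then show "sum (snd p) (splits n m) \<noteq> 0" using total_pos[of "snd p"] by (auto simp: total_def)
    qed
    moreover have "?H (t, x) \<in> ?C" if t: "t \<in> {0..1}" and x: "x \<in> ?C" for t x
    proof -
      have c: "0 < 1 - t + t / total x"
      proof (cases "t = 0")
        case False
        then have "0 < t / total x" using t total_pos[OF x] by simp
        then show ?thesis using t by (intro add_nonneg_pos) auto
      qed simp
      have "(\<lambda>A. (1 - t + t / total x) * x A) \<in> tree_cone n m" using x c by (intro tree_cone_scale) auto
      moreover have "(\<lambda>A. (1 - t + t / total x) * x A) \<noteq> (\<lambda>_. 0)"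
        using x c by (auto simp: fun_eq_iff)
      ultimately show ?thesis by simp
    qed
    ultimately show "\<exists>h. continuous_map (prod_topology (top_of_set {0..1::real}) (top_of_set ?C)) (top_of_set ?C) h \<and>
        (\<forall>x\<in>topspace (top_of_set ?C). h (0, x) = id x) \<and>
        (\<forall>x\<in>topspace (top_of_set ?C). h (1, x) = (\<theta> \<circ> \<psi>) x) \<and> (\<forall>t\<in>{0..1::real}. True)"
      by (intro exI[of _ ?H]) (auto simp: \<theta>\<psi>)
  qed simp
  show ?thesis
    unfolding D_def[symmetric] homotopy_equivalent_space_def
    using \<theta>(1) \<psi> 1 homotopic_with_symD[OF 2] by blast
qed

end

text \<open>The factors \<open>2, 3, ...\<close> stop growing at \<open>m - 1\<close>. With
  \<open>m = 3 + p\<close>, the case \<open>k = 0\<close> has the \<open>p\<close> factors of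
  \<open>fact (m - 2)\<close>, and each light mark contributes one more \<open>m - 1\<close>. For
  \<open>m = 2\<close> all factors are \<open>1\<close>.\<close>

lemma prod_legs:
  assumes "2 \<le> m" "3 \<le> m + k"
  shows "(\<Prod>j<m + k - 3. min (j + 3) m - 1) = fact (m - 2) * (m - 1) ^ k"
proof (cases "m = 2")
  case True
  then show ?thesis by simp
next
  case False
  then have "m = 3 + (m - 3)" using assms(1) by simp
  then obtain p where p: "m = 3 + p" by blast
  have fact: "(\<Prod>j<q. j + 2) = (fact (Suc q) :: nat)" for q
    by (induction q) (simp_all add: algebra_simps)
  have "(\<Prod>j<p + k. min (j + 3) m - 1) = fact (Suc p) * (p + 2) ^ k"
  proof (induction k)
    case 0
    have "(\<Prod>j<p. min (j + 3) m - 1) = (\<Prod>j<p. j + 2)" using p by (intro prod.cong) auto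
    then show ?case using fact[of p] by simp
  next
    case (Suc k)
    have "min (p + k + 3) m - 1 = p + 2" using p by simp
    then have "(\<Prod>j<p + Suc k. min (j + 3) m - 1) = fact (Suc p) * (p + 2) ^ k * (p + 2)"
      using Suc by (simp only: add_Suc_right prod.lessThan_Suc)
    then show ?case by (simp only: power_Suc ac_simps)
  qed
  then show ?thesis by (simp add: p)
qed

theorem theorem7p4:
  fixes m k :: nat
  assumes "m \<ge> 2" and "m + k \<ge> 3"
  shows "\<forall>\<^sub>F \<epsilon> in at_right 0.
    Delta_0 (m + k) (heavy_light m \<epsilon>) homotopy_equivalent_space
      wedge_of_spheres (fact (m - 2) * (m - 1) ^ k) (int m + int k - 4)"
proof -
  let ?n = "m + k" and ?r = "m + k - 3" and ?a = "\<lambda>j. min (j + 3) m"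
  let ?W = "wedge_of_spheres (fact (m - 2) * (m - 1) ^ k) (int m + int k - 4)"
  have "cone_equiv (tree_cone ?n m) (\<lambda>_. 0) (spiders ?r ?a) (\<lambda>_ _. 0)"
    using cone_equiv_tree_cone[OF assms(1), of ?r] assms(2) by simp
  then have 1: "top_of_set (tree_cone ?n m - {\<lambda>_. 0}) homotopy_equivalent_space
      top_of_set (spiders ?r ?a - {\<lambda>_ _. 0})"
    by (rule cone_equiv_imp_homotopy_equivalent)
  have 2: "top_of_set (spiders ?r ?a - {\<lambda>_ _. 0}) homotopy_equivalent_space ?W"
  \<comment> \<open>With three marks in total both spaces are empty: the sphere has dimension
    \<open>-1\<close>.\<close>
  proof (cases "?r = 0")
    case True
    then have "topspace (top_of_set (spiders ?r ?a - {\<lambda>_ _. 0})) = {}" by (auto simp: spiders_def)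
    then have A: "top_of_set (spiders ?r ?a - {\<lambda>_ _. 0}) = trivial_topology"
      by (simp only: null_topspace_iff_trivial)
    have "int m + int k - 4 < 0" using True by simp
    then have "topspace ?W = {}"
      by (simp add: wedge_of_spheres_def wedge_def topspace_quotient_space sphere_space_def
          del: null_topspace_iff_trivial)
    then have B: "?W = trivial_topology" by (simp only: null_topspace_iff_trivial)
    show ?thesis unfolding A B
      by (intro homeomorphic_imp_homotopy_equivalent_space) (simp only: homeomorphic_empty_space_eq)
  next
    case False
    interpret spider_product ?r ?a using assms False by unfold_locales auto
    have "int ?r - 1 = int m + int k - 4" using assms(2) by simp
    then show ?thesis using spiders_wedge prod_legs[OF assms] by simp
  qed
  have "Delta_0 ?n (heavy_light m \<epsilon>) homotopy_equivalent_space ?W"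
    if "0 < \<epsilon>" "\<epsilon> < 1 / real ?n" for \<epsilon>
  proof -
    have "real ?n * \<epsilon> \<le> 1" using that assms(2) by (simp add: field_simps)
    then interpret weights ?n m \<epsilon> using assms that by unfold_locales auto
    show ?thesis by (rule homotopy_eqv_trans[OF Delta_0_tree_cone homotopy_eqv_trans[OF 1 2]])
  qed
  moreover have "\<forall>\<^sub>F \<epsilon> in at_right 0. \<epsilon> \<in> {0<..<1 / real ?n}"
    using assms(2) by (intro eventually_at_right_real) simp
  ultimately show ?thesis by (auto elim: eventually_mono)
qed

end
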